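(* Let $\mathbb K$ be a field. If $(\kappa_n)_{n\geq 1}$ is a sequence of free cumulants in $\mathbb K$, then the corresponding classical cumulants $(c_n)_{n\ge 1}$ are given, for all $n\ge 1$, by \[-c_n=\sum_{\mathcal H\in\mathrm{VHC}(S_{n-1})}(-\kappa_\bullet)_{\vert\mathcal H}.\]
   Context: Cumulants. $\Pi(n)$ is the set of set partitions of $[n]=\{1,\ldots,n\}$. Two distinct blocks $B,B'$ form a crossing if there are $i,j\in B$ and $i',j'\in B'$ with $i<i'<j<j'$ or $i>i'>j>j'$; a partition is noncrossing if no two of its blocks form a crossing; $\mathrm{NC}(n)$ is the set of noncrossing partitions in $\Pi(n)$. For a sequence $(u_n)_{n\ge1}$ in $\mathbb K$ and a set partition $\rho$, put $(u_\bullet)_\rho=\prod_{B\in\rho}u_{|B|}$; thus $(-\kappa_\bullet)_\rho=\prod_{B\in\rho}(-\kappa_{|B|})$. A sequence $(\kappa_n)$ of free cumulants and a sequence $(c_n)$ of classical cumulants correspond to each other if they have the same moment sequence $(m_n)_{n\ge1}$, i.e. for all $n\ge1$, $m_n=\sum_{\rho\in\Pi(n)}(c_\bullet)_\rho=\sum_{\eta\in\mathrm{NC}(n)}(\kappa_\bullet)_\eta$. Each sequence determines the others. Valid hook configurations. $S_n$ is the set of permutations $\pi=\pi_1\cdots\pi_n$ of $[n]$ ($S_0$ contains only the empty permutation); a descent of $\pi$ is an index $i\in[n-1]$ with $\pi_i>\pi_{i+1}$; the plot of $\pi$ is the set of points $(i,\pi_i)$. A hook of $\pi$ with southwest endpoint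 $(i,\pi_i)$ and northeast endpoint $(j,\pi_j)$, where $i<j$ and $\pi_i<\pi_j$, is the union of the vertical segment from $(i,\pi_i)$ to $(i,\pi_j)$ and the horizontal segment from $(i,\pi_j)$ to $(j,\pi_j)$. If $d_1<\cdots<d_k$ are the descents of $\pi$, a valid hook configuration of $\pi$ is a tuple $\mathcal H=(H_1,\ldots,H_k)$ of hooks of $\pi$ such that: (1) the southwest endpoint of $H_i$ is $(d_i,\pi_{d_i})$ for each $i$; (2) no point of the plot lies directly above a hook (i.e. if $H_m$ has northeast endpoint $(j_m,\pi_{j_m})$, then $\pi_x<\pi_{j_m}$ for all $d_m<x<j_m$); (3) no two hooks intersect or overlap unless the northeast endpoint of one is the southwest endpoint of the other. $\mathrm{VHC}(\pi)$ is the set of valid hook configurations of $\pi$ (a single empty configuration if $\pi$ has no descents). A valid hook configuration includes its underlying permutation as part of its identity, and $\mathrm{VHC}(S_{n-1})=\bigcup_{\pi\in S_{n-1}}\mathrm{VHC}(\pi)$ (a disjoint union). The partition $\vert\mathcal H$. Let $\pi\in S_{n-1}$ and $\mathcal H=(H_1,\dots,H_k)\in\mathrm{VHC}(\pi)$, with $H_m$ having northeast endpoint $(j_m,\pi_{j_m})$. Give the hooks distinct colors and the "sky" another color (blue). Color the points of the plot as follows (modified coloring): the northeast endpoint of a hook gets the color of that hook; any other point $(i,\pi_i)$ gets the color of the hook $H_m$ with $d_m<i<j_m$ for which $\pi_{j_m}$ is smallest (the first hook seen looking straight up, where a southwest endpoint looks around the left side of its own hook), or blue if there is no such $m$. The set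 partition $\vert\mathcal H\in\Pi(n)$ is defined by: $a,a'\in[n]$ are in the same block iff the points with heights ($y$-coordinates) $a$ and $a'$ have the same color, where the sky is treated as a blue point of height $n$. *)

theory Defs
  imports
    "HOL-Analysis.Analysis"
    "HOL-Combinatorics.Permutations"
    "HOL-Library.Disjoint_Sets"
begin

section \<open>Cumulants\<close>

definition set_partitions :: "nat \<Rightarrow> nat set set set" where
  "set_partitions n = {\<rho>. partition_on {1..n} \<rho>}"

definition crossing :: "nat set \<Rightarrow> nat set \<Rightarrow> bool" where
  "crossing B B' \<longleftrightarrow>
     (\<exists>i\<in>B. \<exists>j\<in>B. \<exists>i'\<in>B'. \<exists>j'\<in>B'. (i < i' \<and> i' < j \<and> j < j') \<or> (i > i' \<and> i' > j \<and> j > j'))"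

definition noncrossing_partitions :: "nat \<Rightarrow> nat set set set" where
  "noncrossing_partitions n =
     {\<eta> \<in> set_partitions n. \<forall>B\<in>\<eta>. \<forall>B'\<in>\<eta>. B \<noteq> B' \<longrightarrow> \<not> crossing B B'}"

definition partition_weight :: "(nat \<Rightarrow> 'a::comm_monoid_mult) \<Rightarrow> nat set set \<Rightarrow> 'a" where
  "partition_weight u \<rho> = (\<Prod>B\<in>\<rho>. u (card B))"

text \<open>Sequences are indexed by the positive integers; the value at \<open>0\<close> is never used, because
  blocks of a set partition are nonempty.\<close>

definition cumulants_correspond :: "(nat \<Rightarrow> 'a::field) \<Rightarrow> (nat \<Rightarrow> 'a) \<Rightarrow> bool" where
  "cumulants_correspond \<kappa> c \<longleftrightarrow>
     (\<exists>m. \<forall>n\<ge>1. m n = (\<Sum>\<rho>\<in>set_partitions n. partition_weight c \<rho>) \<and>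
                m n = (\<Sum>\<eta>\<in>noncrossing_partitions n. partition_weight \<kappa> \<eta>))"

section \<open>Valid hook configurations\<close>

text \<open>A permutation in $S_m$ is a function \<open>\<pi>\<close> with \<open>\<pi> permutes {1..m}\<close>. A hook with southwest
  endpoint \<open>(i, \<pi> i)\<close> and northeast endpoint \<open>(j, \<pi> j)\<close> is recorded as the pair \<open>(i, j)\<close>;
  \<open>hook_points\<close> gives the corresponding subset of the plane.\<close>

type_synonym hook = "nat \<times> nat"

definition descents :: "nat \<Rightarrow> (nat \<Rightarrow> nat) \<Rightarrow> nat set" where
  "descents m \<pi> = {i. 1 \<le> i \<and> i < m \<and> \<pi> i > \<pi> (i + 1)}"

definition hooks :: "nat \<Rightarrow> (nat \<Rightarrow> nat) \<Rightarrow> hook set" where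
  "hooks m \<pi> = {(i, j). 1 \<le> i \<and> i < j \<and> j \<le> m \<and> \<pi> i < \<pi> j}"

definition hook_points :: "(nat \<Rightarrow> nat) \<Rightarrow> hook \<Rightarrow> (real \<times> real) set" where
  "hook_points \<pi> h = (case h of (i, j) \<Rightarrow>
     closed_segment (real i, real (\<pi> i)) (real i, real (\<pi> j)) \<union>
     closed_segment (real i, real (\<pi> j)) (real j, real (\<pi> j)))"

text \<open>The tuple $(H_1,\ldots,H_k)$ is a list, whose \<open>i\<close>-th entry starts at the \<open>i\<close>-th descent.\<close>

definition VHC :: "nat \<Rightarrow> (nat \<Rightarrow> nat) \<Rightarrow> hook list set" where
  "VHC m \<pi> = {H.
     set H \<subseteq> hooks m \<pi> \<and>
     map fst H = sorted_list_of_set (descents m \<pi>) \<and>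
     (\<forall>(d, j)\<in>set H. \<forall>x. d < x \<and> x < j \<longrightarrow> \<pi> x < \<pi> j) \<and>
     (\<forall>h\<in>set H. \<forall>h'\<in>set H. h \<noteq> h' \<longrightarrow>
        hook_points \<pi> h \<inter> hook_points \<pi> h' = {} \<or> snd h = fst h' \<or> snd h' = fst h)}"

definition VHC_all :: "nat \<Rightarrow> ((nat \<Rightarrow> nat) \<times> hook list) set" where
  "VHC_all m = (SIGMA \<pi>:{\<pi>. \<pi> permutes {1..m}}. VHC m \<pi>)"

text \<open>A color is \<open>Some h\<close> for the color of the hook \<open>h\<close> and \<open>None\<close> for blue, the color of the sky.
  For a valid hook configuration, distinct hooks have distinct northeast endpoints, so \<open>THE\<close> and
  \<open>arg_min\<close> below select uniquely determined hooks.\<close>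

definition point_color :: "(nat \<Rightarrow> nat) \<Rightarrow> hook list \<Rightarrow> nat \<Rightarrow> hook option" where
  "point_color \<pi> H i =
     (if \<exists>h\<in>set H. snd h = i then Some (THE h. h \<in> set H \<and> snd h = i)
      else if \<exists>h\<in>set H. fst h < i \<and> i < snd h
      then Some (arg_min (\<lambda>h. \<pi> (snd h)) (\<lambda>h. h \<in> set H \<and> fst h < i \<and> i < snd h))
      else None)"

text \<open>Here \<open>\<pi>\<close> is a permutation of \<open>{1..n - 1}\<close>; the point at height \<open>a < n\<close> has abscissa
  \<open>inv \<pi> a\<close>, and height \<open>n\<close> is the sky.\<close>

definition height_color :: "nat \<Rightarrow> (nat \<Rightarrow> nat) \<Rightarrow> hook list \<Rightarrow> nat \<Rightarrow> hook option" where
  "height_color n \<pi> H a = (if a = n then None else point_color \<pi> H (inv \<pi> a))"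

definition VHC_partition :: "nat \<Rightarrow> (nat \<Rightarrow> nat) \<Rightarrow> hook list \<Rightarrow> nat set set" where
  "VHC_partition n \<pi> H =
     {1..n} // {(a, a'). a \<in> {1..n} \<and> a' \<in> {1..n} \<and> height_color n \<pi> H a = height_color n \<pi> H a'}"

end

theory Submission
  imports Defs "HOL-Library.Tree"
begin

text \<open>
  Call a point of a valid hook configuration visible if no hook passes over it. Read from left to
  right, the visible points increase; the first is blue, and each later one is blue or the
  northeast endpoint of a hook that starts at the preceding visible point. Below such a hook
  sits a smaller configuration, for which the northeast endpoint plays the role of the sky. The
  hook starts at a descent, so the only condition that ties the smaller configuration to its
  surroundings is that its first point is lower than the preceding visible point. A
  configuration is therefore a binary tree whose right spine carries the visible points, with
  the configuration below a hook as left subtree of its northeast endpoint (\<open>hook_tree\<close>,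
  \<open>bij_betw_hook_trees_VHC\<close>). The block of a hook consists of its northeast endpoint and the
  blue points of the configuration below it, so that the weight is multiplicative along the tree
  (\<open>partition_weight_hook_arcs\<close>).

  Put \<open>w k = - \<kappa> k\<close>. For a finite set \<open>S\<close> of labels let \<open>V S\<close> be the weighted sum of all trees on
  \<open>S\<close> (\<open>tree_sum\<close>), let \<open>U s S\<close> be the part in which the first label exceeds \<open>s\<close>
  (\<open>high_tree_sum\<close>), and let \<open>K s S\<close> sum over all ways in which a chain of visible points that
  has reached the label \<open>s\<close> can go on with hooks only (\<open>chain_sum w 0\<close>). Such functions of \<open>s\<close>
  and \<open>S\<close> are called kernels; the product \<open>f \<odot> g\<close> glues them at an intermediate label. The next
  hook of a chain leads to \<open>K = \<delta> + (V - U) \<odot> K\<close>, and cutting a tree at its blue visible points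
  expresses \<open>U\<close> through products of copies of \<open>K\<close>:
  \<open>U = w 1 * \<delta> + (\<Sum>j. w (j + 2) * (\<delta> \<odot> K \<odot> ... \<odot> K))\<close> with \<open>j + 1\<close> factors \<open>K\<close>. Hence \<open>U \<odot> K\<close>
  contains each such product again, with \<open>w (j + 1)\<close> in front, and the minus sign in \<open>w\<close> turns
  the equation for \<open>K\<close> into \<open>K = \<delta> + V \<odot> K + (\<Sum>j. \<kappa> (j + 1) * (\<delta> \<odot> K \<odot> ... \<odot> K))\<close>
  (\<open>chain_sum_moment_eqn\<close>).

  Without the term \<open>V \<odot> K\<close> this is the recursion that noncrossing partitions satisfy when the
  block of the least element is removed, and its solution is given by the moments. The
  additional term shuffles the moments with the exponential of \<open>V\<close>, so \<open>K s S\<close> is the sum of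
  \<open>m (card A) * exp_kernel V s (S - A)\<close> over the sets \<open>A\<close> of labels above \<open>s\<close>
  (\<open>seq_kernel_nc_moment_eqn\<close>, \<open>chain_sum_eq_seq_kernel\<close>). At \<open>s = 0\<close> the sums \<open>U\<close> and \<open>V\<close> agree
  and the first equation collapses to \<open>K = \<delta>\<close>. So the moments and the exponential of \<open>V\<close> are
  inverse to each other for the convolution over subsets. Since the moments are the exponential
  of the classical cumulants, their inverse is also the exponential of the negated cumulants;
  comparing the two by induction gives \<open>V S = - c (card S + 1)\<close> (\<open>tree_sum_eq_cumulant\<close>).
\<close>

section \<open>Exponential sums over set partitions\<close>

definition partition_sum :: "('b set \<Rightarrow> 'a::comm_ring_1) \<Rightarrow> 'b set \<Rightarrow> 'a" where
  "partition_sum f X = (\<Sum>\<rho>\<in>{\<rho>. partition_on X \<rho>}. \<Prod>B\<in>\<rho>. f B)"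

lemma partition_sum_empty [simp]: "partition_sum f {} = 1"
  by (simp add: partition_sum_def partition_on_empty)

lemma partition_on_remove_block:
  assumes "partition_on X \<rho>" "B \<in> \<rho>"
  shows "partition_on (X - B) (\<rho> - {B})"
proof -
  have "disjnt B (\<Union>(\<rho> - {B}))"
    using partition_onD2[OF assms(1)] assms(2) by (auto simp: pairwise_def disjnt_def)
  then show ?thesis
    using partition_on_insert[of B "\<rho> - {B}" X] assms by (auto simp: insert_absorb)
qed

lemma partition_on_insert_block:
  assumes "partition_on (X - B) \<rho>" "B \<subseteq> X" "B \<noteq> {}"
  shows "partition_on X (insert B \<rho>)" "B \<notin> \<rho>"
proof -
  have "disjnt B (\<Union>\<rho>)"
    using partition_onD1[OF assms(1)] by (auto simp: disjnt_def)
  then show "partition_on X (insert B \<rho>)" "B \<notin> \<rho>"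
    using partition_on_insert[of B \<rho> X] assms by (auto simp: disjnt_def)
qed

text \<open>The recursion of the exponential formula: the block that contains a chosen element is
  removed.\<close>

lemma partition_sum_split_block:
  assumes "finite X" "x \<in> X"
  shows "partition_sum f X = (\<Sum>B\<in>{B. B \<subseteq> X \<and> x \<in> B}. f B * partition_sum f (X - B))"
proof -
  have fin: "finite {B. B \<subseteq> X \<and> x \<in> B}"
    using assms by simp
  have "(\<Sum>B\<in>{B. B \<subseteq> X \<and> x \<in> B}. f B * partition_sum f (X - B))
      = (\<Sum>(B, \<rho>)\<in>(SIGMA B:{B. B \<subseteq> X \<and> x \<in> B}. {\<rho>. partition_on (X - B) \<rho>}). f B * (\<Prod>B\<in>\<rho>. f B))"
    unfolding partition_sum_def sum_distrib_left
    by (rule sum.Sigma) (use assms in \<open>auto intro: finitely_many_partition_on\<close>)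
  also have "\<dots> = partition_sum f X"
    unfolding partition_sum_def
  proof (rule sum.reindex_bij_witness[of _ "\<lambda>\<rho>. (THE B. B \<in> \<rho> \<and> x \<in> B, \<rho> - {THE B. B \<in> \<rho> \<and> x \<in> B})"
        "\<lambda>(B, \<rho>). insert B \<rho>"], goal_cases)
    case (1 a)
    then obtain B \<rho> where a: "a = (B, \<rho>)" "B \<subseteq> X" "x \<in> B" "partition_on (X - B) \<rho>" by auto
    have "B \<notin> \<rho>" using partition_on_insert_block(2)[OF a(4,2)] a(3) by auto
    moreover have "(THE C. C \<in> insert B \<rho> \<and> x \<in> C) = B"
      using a partition_onD1[OF a(4)] by (intro the_equality) auto
    ultimately show ?case using a by simp
  next
    case (2 a)
    then show ?case by (auto intro!: partition_on_insert_block)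
  next
    case (3 \<rho>)
    then have p: "partition_on X \<rho>" by simp
    have "\<exists>!B. B \<in> \<rho> \<and> x \<in> B"
      using assms(2) partition_onD1[OF p] partition_onD2[OF p] by (auto simp: disjoint_def)
    from theI'[OF this] show ?case by (simp add: insert_absorb)
  next
    case (4 \<rho>)
    then have p: "partition_on X \<rho>" by simp
    have "\<exists>!B. B \<in> \<rho> \<and> x \<in> B"
      using assms(2) partition_onD1[OF p] partition_onD2[OF p] by (auto simp: disjoint_def)
    from theI'[OF this] show ?case
      using partition_on_remove_block[OF p] partition_onD1[OF p] by auto
  next
    case (5 a)
    then obtain B \<rho> where a: "a = (B, \<rho>)" "B \<subseteq> X" "x \<in> B" "partition_on (X - B) \<rho>" by auto
    have "B \<notin> \<rho>" using partition_on_insert_block(2)[OF a(4,2)] a(3) by auto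
    moreover have "finite \<rho>" using a(4) assms finite_elements by blast
    ultimately show ?case using a by simp
  qed
  finally show ?thesis ..
qed

lemma partition_sum_cong:
  assumes "\<And>B. B \<subseteq> X \<Longrightarrow> B \<noteq> {} \<Longrightarrow> f B = g B"
  shows "partition_sum f X = partition_sum g X"
  unfolding partition_sum_def
  by (intro sum.cong prod.cong refl assms) (auto simp: partition_on_def)

lemma partition_sum_zero:
  assumes "finite X" "x \<in> X" "\<And>B. B \<subseteq> X \<Longrightarrow> x \<in> B \<Longrightarrow> f B = 0"
  shows "partition_sum f X = 0"
  using assms by (simp add: partition_sum_split_block)

lemma sum_Pow_split:
  fixes g :: "'b set \<Rightarrow> 'a::comm_ring_1"
  assumes "finite X" "x \<in> X"
  shows "(\<Sum>Y\<in>Pow X. g Y) = (\<Sum>Y\<in>{Y. Y \<subseteq> X \<and> x \<in> Y}. g Y) + (\<Sum>Y\<in>{Y. Y \<subseteq> X \<and> x \<notin> Y}. g Y)"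
proof -
  have "Pow X = {Y. Y \<subseteq> X \<and> x \<in> Y} \<union> {Y. Y \<subseteq> X \<and> x \<notin> Y}" by auto
  then show ?thesis using assms by (simp add: sum.union_disjoint[symmetric] disjoint_iff)
qed

text \<open>Color the blocks of a partition with two colors; \<open>Y\<close> is the union of the blocks of the first
  color. In terms of generating functions this is the functional equation of the exponential.\<close>

lemma partition_sum_add:
  assumes "finite X"
  shows "partition_sum (\<lambda>B. f B + g B) X = (\<Sum>Y\<in>Pow X. partition_sum f Y * partition_sum g (X - Y))"
  using assms
proof (induction "card X" arbitrary: X rule: less_induct)
  case less
  show ?case
  proof (cases "X = {}")
    case False
    then obtain x where x: "x \<in> X" by auto
    let ?\<B> = "{B. B \<subseteq> X \<and> x \<in> B}"
    let ?S = "\<lambda>B. \<Sum>Y\<in>Pow (X - B). partition_sum f Y * partition_sum g (X - B - Y)"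
    have fin: "finite X" by fact
    have IH: "partition_sum (\<lambda>B. f B + g B) (X - B) = ?S B" if "B \<in> ?\<B>" for B
      using that fin x by (intro less) (auto intro!: psubset_card_mono)
    have 1: "(\<Sum>Y\<in>{Y. Y \<subseteq> X \<and> x \<in> Y}. partition_sum f Y * partition_sum g (X - Y))
           = (\<Sum>B\<in>?\<B>. f B * ?S B)"
    proof -
      have "(\<Sum>Y\<in>{Y. Y \<subseteq> X \<and> x \<in> Y}. partition_sum f Y * partition_sum g (X - Y))
          = (\<Sum>Y\<in>{Y. Y \<subseteq> X \<and> x \<in> Y}. \<Sum>B\<in>{B. B \<subseteq> Y \<and> x \<in> B}. f B * partition_sum f (Y - B) * partition_sum g (X - Y))"
        using fin by (intro sum.cong refl) (auto simp: partition_sum_split_block[of _ x] finite_subset sum_distrib_right)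
      also have "\<dots> = (\<Sum>B\<in>?\<B>. \<Sum>Z\<in>Pow (X - B). f B * (partition_sum f Z * partition_sum g (X - B - Z)))"
        apply (subst sum.Sigma)
        subgoal using fin by auto
        subgoal using fin by (auto simp: finite_subset)
        apply (subst sum.Sigma)
        subgoal using fin by auto
        subgoal using fin by (auto simp: finite_subset)
        apply (rule sum.reindex_bij_witness[of _ "\<lambda>(B, Z). (B \<union> Z, B)" "\<lambda>(Y, B). (B, Y - B)"])
        by (auto simp: mult.assoc Un_absorb1 Diff_eq Int_assoc Un_Diff intro!: arg_cong[where f="partition_sum g"] arg_cong[where f="partition_sum f"] arg_cong2[where f="(*)"])
      finally show ?thesis by (simp add: sum_distrib_left)
    qed
    have 2: "(\<Sum>Y\<in>{Y. Y \<subseteq> X \<and> x \<notin> Y}. partition_sum f Y * partition_sum g (X - Y))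
           = (\<Sum>B\<in>?\<B>. g B * ?S B)"
    proof -
      have "(\<Sum>Y\<in>{Y. Y \<subseteq> X \<and> x \<notin> Y}. partition_sum f Y * partition_sum g (X - Y))
          = (\<Sum>Y\<in>{Y. Y \<subseteq> X \<and> x \<notin> Y}. \<Sum>B\<in>{B. B \<subseteq> X - Y \<and> x \<in> B}. g B * (partition_sum f Y * partition_sum g (X - Y - B)))"
        using fin x by (intro sum.cong refl) (auto simp: partition_sum_split_block[of _ x] sum_distrib_left mult_ac)
      also have "\<dots> = (\<Sum>B\<in>?\<B>. \<Sum>Z\<in>Pow (X - B). g B * (partition_sum f Z * partition_sum g (X - B - Z)))"
        apply (subst sum.Sigma)
        subgoal using fin by auto
        subgoal using fin by (auto simp: finite_subset)
        apply (subst sum.Sigma)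
        subgoal using fin by auto
        subgoal using fin by (auto simp: finite_subset)
        apply (rule sum.reindex_bij_witness[of _ "\<lambda>(B, Z). (Z, B)" "\<lambda>(Y, B). (B, Y)"])
        by (auto simp: Diff_eq Int_ac)
      finally show ?thesis by (simp add: sum_distrib_left)
    qed
    have "partition_sum (\<lambda>B. f B + g B) X = (\<Sum>B\<in>?\<B>. (f B + g B) * ?S B)"
      by (simp add: partition_sum_split_block[OF fin x] IH)
    also have "\<dots> = (\<Sum>Y\<in>Pow X. partition_sum f Y * partition_sum g (X - Y))"
      by (simp add: sum_Pow_split[OF fin x] 1 2 distrib_right sum.distrib)
    finally show ?thesis .
  qed simp
qed

lemma partition_sum_uminus:
  assumes "finite X"
  shows "(\<Sum>Y\<in>Pow X. partition_sum f Y * partition_sum (\<lambda>B. - f B) (X - Y)) = (if X = {} then 1 else 0)"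
proof (cases "X = {}")
  case False
  then obtain x where "x \<in> X" by auto
  then have "partition_sum (\<lambda>B. f B + - f B) X = 0"
    using assms by (intro partition_sum_zero) auto
  then show ?thesis
    using partition_sum_add[OF assms, of f "\<lambda>B. - f B"] False by simp
qed simp

lemma sum_Pow_card_cong:
  assumes "finite X" "finite Y" "card X = card Y"
  shows "(\<Sum>A\<in>Pow X. h (card A)) = (\<Sum>A\<in>Pow Y. h (card A))"
proof -
  obtain b where b: "bij_betw b X Y" using finite_same_card_bij assms by blast
  have "(\<Sum>A\<in>Pow X. h (card A)) = (\<Sum>A\<in>Pow X. h (card (b ` A)))"
    using b by (intro sum.cong refl arg_cong[where f=h]) 
      (auto intro!: card_image[symmetric] simp: bij_betw_def inj_on_subset)
  also have "\<dots> = (\<Sum>A\<in>Pow Y. h (card A))"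
    by (rule sum.reindex_bij_betw) (rule bij_betw_Pow[OF b])
  finally show ?thesis .
qed

lemma sum_subsets_containing:
  assumes "x \<in> X"
  shows "(\<Sum>B\<in>{B. B \<subseteq> X \<and> x \<in> B}. h B) = (\<Sum>A\<in>Pow (X - {x}). h (insert x A))"
  by (rule sum.reindex_bij_witness[of _ "insert x" "\<lambda>B. B - {x}"])
    (use assms in \<open>auto simp: insert_absorb\<close>)

text \<open>Proved by the recursion rather than by transporting partitions along a bijection: by
  induction, the sum of the remaining blocks depends on their number of elements only, and then so
  does a sum over subsets.\<close>

lemma partition_sum_card_cong:
  fixes X Y :: "'b set"
  assumes "finite X" "finite Y" "card X = card Y"
  shows "partition_sum (\<lambda>B. c (card B)) X = partition_sum (\<lambda>B. c (card B)) Y"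
  using assms
proof (induction "card X" arbitrary: X Y rule: less_induct)
  case less
  show ?case
  proof (cases "X = {}")
    case False
    with less.prems have "Y \<noteq> {}" by auto
    with False obtain x y where xy: "x \<in> X" "y \<in> Y" by auto
    \<comment> \<open>The common value on all sets with \<open>n\<close> elements, read off from some subset of \<open>X\<close>.\<close>
    define g where "g n = partition_sum (\<lambda>B. c (card B)) (SOME Z. Z \<subseteq> X \<and> card Z = n)" for n
    have g: "partition_sum (\<lambda>B. c (card B)) Z = g (card Z)" if "finite Z" "card Z < card X" for Z :: "'b set"
    proof -
      have "\<exists>Z'. Z' \<subseteq> X \<and> card Z' = card Z"
        using that obtain_subset_with_card_n[of "card Z" X] by (metis less_imp_le)
      from someI_ex[OF this] show ?thesis
        unfolding g_def using that less.prems by (intro less(1)) (auto intro: finite_subset)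
    qed
    have *: "partition_sum (\<lambda>B. c (card B)) Z
        = (\<Sum>A\<in>Pow (Z - {z}). c (Suc (card A)) * g (card (Z - {z}) - card A))"
      if Z: "finite Z" "card Z = card X" "z \<in> Z" for Z and z :: 'b
    proof -
      have "partition_sum (\<lambda>B. c (card B)) (Z - insert z A) = g (card (Z - {z}) - card A)"
        if A: "A \<subseteq> Z - {z}" for A
      proof -
        have "Z - insert z A = (Z - {z}) - A" by auto
        moreover have "card ((Z - {z}) - A) = card (Z - {z}) - card A"
          using A Z by (intro card_Diff_subset) (auto intro: finite_subset)
        moreover have "card (Z - insert z A) < card Z"
          using Z by (intro psubset_card_mono) auto
        ultimately show ?thesis using g[of "Z - insert z A"] Z by simp
      qed
      moreover have "card (insert z A) = Suc (card A)" if "A \<subseteq> Z - {z}" for A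
        using that Z by (subst card_insert_disjoint) (auto intro: finite_subset)
      ultimately show ?thesis
        using Z by (simp add: partition_sum_split_block[of _ z] sum_subsets_containing)
    qed
    have "card (X - {x}) = card (Y - {y})"
      using less.prems xy by simp
    then show ?thesis
      using *[OF less.prems(1) refl xy(1)] *[OF less.prems(2) less.prems(3)[symmetric] xy(2)]
        sum_Pow_card_cong[of "X - {x}" "Y - {y}" "\<lambda>k. c (Suc k) * g (card (X - {x}) - k)"] less.prems
      by simp
  qed (use less in auto)
qed

section \<open>Convolution of kernels\<close>

text \<open>The first argument is the label that an increasing chain has reached, the second one the set
  of labels that the rest of the chain uses up.\<close>

type_synonym 'a kernel = "nat \<Rightarrow> nat set \<Rightarrow> 'a"

text \<open>The ways to go on from a chain of labels that has reached \<open>s\<close>: choose the next label \<open>u\<close> of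
  the chain and a set \<open>R\<close> of labels below \<open>u\<close> that is dealt with before \<open>u\<close>. The labels in \<open>R\<close>,
  and those left over for later, may lie below \<open>s\<close>.\<close>

definition splits :: "nat \<Rightarrow> nat set \<Rightarrow> (nat set \<times> nat) set" where
  "splits s S = {(R, u). u \<in> S \<and> s < u \<and> R \<subseteq> S \<and> (\<forall>x\<in>R. x < u)}"

text \<open>The discrete form of the composition of integral kernels: think of \<open>f s S\<close> as the
  coefficient of \<open>S\<close> in an iterated integral over points \<open>s < x1 < x2 < ... < x\<close>. The convolution
  inserts one more integration variable \<open>u\<close> between the two factors. So it is associative but has
  no unit; \<open>\<delta> \<odot> g\<close> integrates \<open>g\<close> once.\<close>

definition kconv :: "'a::comm_ring_1 kernel \<Rightarrow> 'a kernel \<Rightarrow> 'a kernel" (infixr "\<odot>" 70) where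
  "(f \<odot> g) s S = (\<Sum>(R, u)\<in>splits s S. f s R * g u (S - R - {u}))"

definition unit_kernel :: "'a::comm_ring_1 kernel" ("\<delta>") where
  "\<delta> s S = (if S = {} then 1 else 0)"

lemma finite_splits [simp]: "finite S \<Longrightarrow> finite (splits s S)"
  by (rule finite_subset[of _ "Pow S \<times> S"]) (auto simp: splits_def)

lemma splits_card:
  assumes "finite S" "(R, u) \<in> splits s S"
  shows "card R < card S" "card (S - R - {u}) < card S" "finite R"
proof -
  show "card R < card S" 
    using assms by (intro psubset_card_mono) (auto simp: splits_def)
  show "card (S - R - {u}) < card S"
    using assms by (intro psubset_card_mono) (auto simp: splits_def)
  show "finite R" using assms by (auto simp: splits_def intro: finite_subset)
qed

lemma kconv_cong:
  assumes "\<And>R u. (R, u) \<in> splits s S \<Longrightarrow> f s R = f' s R"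
    and "\<And>R u. (R, u) \<in> splits s S \<Longrightarrow> g u (S - R - {u}) = g' u (S - R - {u})"
  shows "(f \<odot> g) s S = (f' \<odot> g') s S"
  unfolding kconv_def using assms by (intro sum.cong refl) auto

lemma kconv_assoc:
  assumes "finite S"
  shows "((f \<odot> g) \<odot> h) s S = (f \<odot> (g \<odot> h)) s S"
proof -
  have fin: "finite R" if "(R, u) \<in> splits s S" for R u
    using splits_card[OF assms that] by simp
  have "((f \<odot> g) \<odot> h) s S = (\<Sum>((R, u), (Q, v))\<in>(SIGMA (R, u):splits s S. splits s R).
       f s Q * g v (R - Q - {v}) * h u (S - R - {u}))"
    unfolding kconv_def case_prod_beta sum_distrib_right
    by (subst sum.Sigma) (use assms fin in \<open>auto simp: case_prod_beta\<close>)
  also have "\<dots> = (\<Sum>((Q, v), (R, u))\<in>(SIGMA (Q, v):splits s S. splits v (S - Q - {v})).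
       f s Q * (g v R * h u (S - Q - {v} - R - {u})))"
  proof (rule sum.reindex_bij_witness[of _ "\<lambda>((Q, v), (R, u)). ((insert v (Q \<union> R), u), (Q, v))"
          "\<lambda>((R, u), (Q, v)). ((Q, v), (R - Q - {v}, u))"], goal_cases)
    case (5 a)
    then obtain R u Q v where a: "a = ((R, u), (Q, v))" "(R, u) \<in> splits s S" "(Q, v) \<in> splits s R"
      by auto
    have "S - Q - {v} - (R - Q - {v}) - {u} = S - R - {u}"
      using a by (auto simp: splits_def)
    then show ?case using a by (simp add: mult.assoc)
  qed (auto simp: splits_def)
  also have "\<dots> = (f \<odot> (g \<odot> h)) s S"
    unfolding kconv_def case_prod_beta sum_distrib_left
    by (subst sum.Sigma) (use assms in \<open>auto simp: case_prod_beta\<close>)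
  finally show ?thesis .
qed

lemma kconv_empty [simp]: "(f \<odot> g) s {} = 0"
  by (simp add: kconv_def splits_def)

lemma kconv_add_left: "((\<lambda>s S. f s S + f' s S) \<odot> g) s S = (f \<odot> g) s S + (f' \<odot> g) s S"
  by (simp add: kconv_def case_prod_beta distrib_right sum.distrib)

lemma kconv_diff_left: "((\<lambda>s S. f s S - f' s S) \<odot> g) s S = (f \<odot> g) s S - (f' \<odot> g) s S"
  by (simp add: kconv_def case_prod_beta left_diff_distrib sum_subtractf)

lemma kconv_add_right: "(f \<odot> (\<lambda>s S. g s S + g' s S)) s S = (f \<odot> g) s S + (f \<odot> g') s S"
  by (simp add: kconv_def case_prod_beta distrib_left sum.distrib)

lemma kconv_scale_left: "((\<lambda>s S. c * f s S) \<odot> g) s S = c * (f \<odot> g) s S"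
  by (simp add: kconv_def case_prod_beta sum_distrib_left mult_ac)

lemma kconv_sum_left: "((\<lambda>s S. \<Sum>i\<in>I. f i s S) \<odot> g) s S = (\<Sum>i\<in>I. (f i \<odot> g) s S)"
  unfolding kconv_def case_prod_beta sum_distrib_right by (rule sum.swap)

lemma kconv_sum_right: "(g \<odot> (\<lambda>s S. \<Sum>i\<in>I. f i s S)) s S = (\<Sum>i\<in>I. (g \<odot> f i) s S)"
  unfolding kconv_def case_prod_beta sum_distrib_left by (rule sum.swap)

lemma kconv_scale_right: "(f \<odot> (\<lambda>s S. c * g s S)) s S = c * (f \<odot> g) s S"
  by (simp add: kconv_def case_prod_beta sum_distrib_left mult_ac)

text \<open>Convolution always passes to smaller sets, so a linear equation determines its solution
  recursively.\<close>

lemma kernel_eqn_unique: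
  assumes "finite S"
    and "\<And>s S. finite S \<Longrightarrow> f s S = g s S + (h \<odot> f) s S"
    and "\<And>s S. finite S \<Longrightarrow> f' s S = g s S + (h \<odot> f') s S"
  shows "f s S = f' s S"
  using assms(1)
proof (induction "card S" arbitrary: s S rule: less_induct)
  case less
  have "(h \<odot> f) s S = (h \<odot> f') s S"
    using less by (intro kconv_cong) (auto dest: splits_card)
  then show ?case
    using assms(2)[OF less.prems, of s] assms(3)[OF less.prems, of s] by simp
qed

text \<open>The exponent counts the convolutions, so that \<open>kernel_pow f k\<close> has \<open>k + 1\<close> factors; there is
  no unit that could serve as an empty power.\<close>

fun kernel_pow :: "'a::comm_ring_1 kernel \<Rightarrow> nat \<Rightarrow> 'a kernel" where
  "kernel_pow f 0 = f"
| "kernel_pow f (Suc k) = f \<odot> kernel_pow f k"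

text \<open>Associativity moves the additional factor from the right end to the left end.\<close>

lemma kernel_pow_kconv:
  assumes "finite S"
  shows "(kernel_pow f k \<odot> f) s S = kernel_pow f (Suc k) s S"
  using assms
proof (induction k arbitrary: s S)
  case (Suc k)
  have "(kernel_pow f (Suc k) \<odot> f) s S = (f \<odot> (kernel_pow f k \<odot> f)) s S"
    using Suc.prems by (simp add: kconv_assoc)
  also have "\<dots> = (f \<odot> kernel_pow f (Suc k)) s S"
    using Suc by (intro kconv_cong) auto
  finally show ?case by simp
qed simp

text \<open>Each convolution uses up one label.\<close>

lemma kernel_pow_eq_0:
  assumes "finite S" "card S < k"
  shows "kernel_pow f k s S = 0"
  using assms
proof (induction k arbitrary: s S)
  case (Suc k)
  then show ?case
    unfolding kernel_pow.simps kconv_def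
    by (intro sum.neutral) (auto dest: splits_card(2)[rotated])
qed simp

lemma kernel_pow_cong:
  assumes "finite S" "\<And>s R. R \<subseteq> S \<Longrightarrow> f s R = g s R"
  shows "kernel_pow f k s S = kernel_pow g k s S"
  using assms
proof (induction k arbitrary: s S)
  case (Suc k)
  have "kernel_pow f k u (S - R - {u}) = kernel_pow g k u (S - R - {u})" if "(R, u) \<in> splits s S" for R u
    using Suc.prems by (intro Suc.IH) auto
  then show ?case unfolding kernel_pow.simps
    using Suc.prems by (intro kconv_cong) (auto simp: splits_def)
qed simp

lemma kernel_pow_unit_eq_0:
  assumes "finite S" "card S \<le> k"
  shows "(\<delta> \<odot> kernel_pow f k) s S = 0"
  unfolding kconv_def
proof (intro sum.neutral ballI, clarify)
  fix R u assume "(R, u) \<in> splits s S"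
  from splits_card[OF assms(1) this] show "\<delta> s R * kernel_pow f k u (S - R - {u}) = 0"
    using assms by (simp add: kernel_pow_eq_0)
qed

section \<open>The exponential kernel\<close>

text \<open>The weight of an item of a chain: its position in the chain is its largest label, which has
  to lie above \<open>s\<close>, and the other labels hang below it.\<close>

definition top_weight :: "(nat set \<Rightarrow> 'a::comm_ring_1) \<Rightarrow> nat \<Rightarrow> nat set \<Rightarrow> 'a" where
  "top_weight v s B = (if s < Max B then v (B - {Max B}) else 0)"

text \<open>If \<open>Q\<close> is the generating function with derivative \<open>v\<close>, this is the exponential of the
  increment of \<open>Q\<close> between \<open>s\<close> and the end of the chain.\<close>

definition exp_kernel :: "(nat set \<Rightarrow> 'a::comm_ring_1) \<Rightarrow> 'a kernel" where
  "exp_kernel v s = partition_sum (top_weight v s)"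

lemma exp_kernel_empty [simp]: "exp_kernel v s {} = 1"
  by (simp add: exp_kernel_def)

text \<open>The increment of an exponent is additive: a block belongs to the first or the second factor
  according to whether its maximum lies below or above \<open>u\<close>.\<close>

lemma exp_kernel_split:
  assumes "finite X" "s \<le> u" "u \<notin> X"
  shows "exp_kernel v s X = (\<Sum>Y\<in>Pow {x\<in>X. x < u}. exp_kernel v s Y * exp_kernel v u (X - Y))"
proof -
  define g where "g B = (if Max B < u then top_weight v s B else 0)" for B
  have "exp_kernel v s X = partition_sum (\<lambda>B. g B + top_weight v u B) X"
    unfolding exp_kernel_def
  proof (rule partition_sum_cong)
    fix B assume "B \<subseteq> X" "B \<noteq> {}"
    then have "Max B \<in> X" using assms finite_subset Max_in by blast
    then have "Max B \<noteq> u" using assms by auto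
    then show "top_weight v s B = g B + top_weight v u B"
      using assms by (auto simp: g_def top_weight_def)
  qed
  also have "\<dots> = (\<Sum>Y\<in>Pow X. partition_sum g Y * exp_kernel v u (X - Y))"
    unfolding exp_kernel_def by (rule partition_sum_add) fact
  also have "\<dots> = (\<Sum>Y\<in>Pow {x\<in>X. x < u}. partition_sum g Y * exp_kernel v u (X - Y))"
  proof (intro sum.mono_neutral_right ballI)
    fix Y assume "Y \<in> Pow X - Pow {x \<in> X. x < u}"
    then obtain x where x: "x \<in> Y" "\<not> x < u" "Y \<subseteq> X" by auto
    have "finite Y" using x assms finite_subset by blast
    then have "partition_sum g Y = 0"
    proof (rule partition_sum_zero[OF _ x(1)])
      fix B assume "B \<subseteq> Y" "x \<in> B"
      then have "x \<le> Max B" using \<open>finite Y\<close> finite_subset by (intro Max_ge) auto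
      then show "g B = 0" using x(2) by (simp add: g_def)
    qed
    then show "partition_sum g Y * exp_kernel v u (X - Y) = 0" by simp
  qed (use assms in auto)
  also have "\<dots> = (\<Sum>Y\<in>Pow {x\<in>X. x < u}. exp_kernel v s Y * exp_kernel v u (X - Y))"
  proof (intro sum.cong refl)
    fix Y assume Y: "Y \<in> Pow {x \<in> X. x < u}"
    have "partition_sum g Y = exp_kernel v s Y"
      unfolding exp_kernel_def
    proof (rule partition_sum_cong)
      fix B assume "B \<subseteq> Y" "B \<noteq> {}"
      then have "Max B \<in> Y" using Y assms finite_subset[of B X] Max_in[of B] by blast
      then show "g B = top_weight v s B"
        using Y by (auto simp: g_def)
    qed
    then show "partition_sum g Y * exp_kernel v u (X - Y) = exp_kernel v s Y * exp_kernel v u (X - Y)" by simp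
  qed
  finally show ?thesis .
qed

text \<open>Blocks ordered by their maxima form an increasing chain, and the first of them is split off.
  The proof moves \<open>s\<close> up to the least label \<open>x\<close> above it; the blocks lost by this are those with
  maximum \<open>x\<close>, of which a partition contains at most one.\<close>

lemma exp_kernel_peel:
  assumes "finite X"
  shows "exp_kernel v s X = \<delta> s X + ((\<lambda>_. v) \<odot> exp_kernel v) s X"
  using assms
proof (induction "card {x\<in>X. s < x}" arbitrary: s rule: less_induct)
  case less
  note fin = \<open>finite X\<close>
  show ?case
  proof (cases "{x\<in>X. s < x} = {}")
    case True
    then have "splits s X = {}" by (auto simp: splits_def)
    moreover have "exp_kernel v s X = 0" if "X \<noteq> {}"
    proof -
      from that obtain x where "x \<in> X" by auto
      then show ?thesis unfolding exp_kernel_def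
      proof (rule partition_sum_zero[OF fin])
        fix B assume B: "B \<subseteq> X" "x \<in> B"
        then have "Max B \<in> B" using fin finite_subset by (intro Max_in) auto
        then show "top_weight v s B = 0" using B True by (auto simp: top_weight_def)
      qed
    qed
    ultimately show ?thesis by (auto simp: unit_kernel_def kconv_def)
  next
    case False
    define x where "x = Min {x\<in>X. s < x}"
    have x: "x \<in> X" "s < x" and xmin: "\<And>y. y \<in> X \<Longrightarrow> s < y \<Longrightarrow> x \<le> y"
      using False fin Min_in[of "{x\<in>X. s < x}"] by (auto simp: x_def)
    \<comment> \<open>The weight of the blocks that are lost when \<open>s\<close> moves up to \<open>x\<close>.\<close>
    define g where "g B = (if Max B = x then v (B - {x}) else 0)" for B
    let ?lower = "{y\<in>X. y < x}"
    have "exp_kernel v s X = partition_sum (\<lambda>B. g B + top_weight v x B) X"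
      unfolding exp_kernel_def
    proof (rule partition_sum_cong)
      fix B assume "B \<subseteq> X" "B \<noteq> {}"
      then have "Max B \<in> X" using fin finite_subset Max_in by blast
      then show "top_weight v s B = g B + top_weight v x B"
        using xmin[of "Max B"] x by (auto simp: g_def top_weight_def)
    qed
    also have "\<dots> = (\<Sum>Y\<in>Pow X. partition_sum g Y * exp_kernel v x (X - Y))"
      unfolding exp_kernel_def by (rule partition_sum_add) fact
    also have "\<dots> = (\<Sum>Y\<in>insert {} (insert x ` Pow ?lower). partition_sum g Y * exp_kernel v x (X - Y))"
    proof (intro sum.mono_neutral_right ballI)
      fix Y assume Y: "Y \<in> Pow X - insert {} (insert x ` Pow ?lower)"
      have finY: "finite Y" using Y fin finite_subset by blast
      have "partition_sum g Y = 0"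
      proof (cases "\<exists>y\<in>Y. x < y")
        case True
        then obtain y where y: "y \<in> Y" "x < y" by auto
        have "g B = 0" if B: "B \<subseteq> Y" "y \<in> B" for B
        proof -
          have "y \<le> Max B" using B finY finite_subset by (intro Max_ge) auto
          then show ?thesis using y by (simp add: g_def)
        qed
        then show ?thesis using y finY by (intro partition_sum_zero[of _ y]) auto
      next
        case le: False
        from Y obtain y where y: "y \<in> Y" by auto
        have "x \<notin> Y"
        proof
          assume "x \<in> Y"
          then have "Y = insert x (Y - {x})" "Y - {x} \<subseteq> ?lower" using le Y by (auto simp: not_less le_less)
          with Y show False by blast
        qed
        have "g B = 0" if B: "B \<subseteq> Y" "y \<in> B" for B
        proof -
          have "Max B \<in> B" using B finY finite_subset by (intro Max_in) auto
          then have "Max B \<noteq> x" using B \<open>x \<notin> Y\<close> by blast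
          then show ?thesis by (simp add: g_def)
        qed
        then show ?thesis using y finY by (intro partition_sum_zero[of _ y]) auto
      qed
      then show "partition_sum g Y * exp_kernel v x (X - Y) = 0" by simp
    qed (use fin x in auto)
    also have "\<dots> = exp_kernel v x X + (\<Sum>Y\<in>insert x ` Pow ?lower. partition_sum g Y * exp_kernel v x (X - Y))"
      by (subst sum.insert) (use fin in auto)
    also have "(\<Sum>Y\<in>insert x ` Pow ?lower. partition_sum g Y * exp_kernel v x (X - Y))
       = (\<Sum>R\<in>Pow ?lower. partition_sum g (insert x R) * exp_kernel v x (X - insert x R))"
      by (subst sum.reindex) (auto simp: inj_on_def)
    also have "\<dots> = (\<Sum>R\<in>Pow ?lower. v R * exp_kernel v x (X - R - {x}))"
    proof (intro sum.cong refl)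
      fix R assume R: "R \<in> Pow ?lower"
      have finR: "finite R" using R fin by (auto intro: finite_subset[of R X])
      have "partition_sum g (insert x R) = g (insert x R)"
      proof (cases "R = {}")
        case True
        moreover have "{B. B \<subseteq> {x} \<and> x \<in> B} = {{x}}" by auto
        ultimately show ?thesis using partition_sum_split_block[of "{x}" x g] by simp
      next
        case False
        then obtain y where y: "y \<in> R" by auto
        have "partition_sum g (insert x R) = (\<Sum>B\<in>{B. B \<subseteq> insert x R \<and> y \<in> B}. g B * partition_sum g (insert x R - B))"
          using finR y by (intro partition_sum_split_block) auto
        also have "\<dots> = (\<Sum>B\<in>{insert x R}. g B * partition_sum g (insert x R - B))"
        proof (intro sum.mono_neutral_right ballI)
          fix B assume B: "B \<in> {B. B \<subseteq> insert x R \<and> y \<in> B} - {insert x R}"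
          show "g B * partition_sum g (insert x R - B) = 0"
          proof (cases "x \<in> B")
            case True
            with B obtain z where z: "z \<in> insert x R - B" by auto
            have "g C = 0" if C: "C \<subseteq> insert x R - B" "z \<in> C" for C
            proof -
              have "Max C \<in> C" using C finR finite_subset[of C "insert x R - B"] by (intro Max_in) auto
              then have "Max C \<noteq> x" using C True by blast
              then show ?thesis by (simp add: g_def)
            qed
            then show ?thesis using z finR by (subst partition_sum_zero[of _ z]) auto
          next
            case False
            have "Max B \<in> B" using B finR finite_subset[of B "insert x R"] by (intro Max_in) auto
            then have "Max B \<noteq> x" using False by blast
            then have "g B = 0" by (simp add: g_def)
            then show ?thesis by simp
          qed
        qed (use finR y in auto)
        finally show ?thesis by simp
      qed
      moreover have "Max (insert x R) = x"
        using R finR by (intro Max_eqI) (auto simp: less_imp_le)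
      moreover have "insert x R - {x} = R" "X - insert x R = X - R - {x}" using R by auto
      ultimately show "partition_sum g (insert x R) * exp_kernel v x (X - insert x R) = v R * exp_kernel v x (X - R - {x})"
        by (simp add: g_def)
    qed
    also have "exp_kernel v x X = \<delta> x X + ((\<lambda>_. v) \<odot> exp_kernel v) x X"
      using x fin by (intro less) (auto intro!: psubset_card_mono)
    finally have 1: "exp_kernel v s X = \<delta> s X + (((\<lambda>_. v) \<odot> exp_kernel v) x X + (\<Sum>R\<in>Pow ?lower. v R * exp_kernel v x (X - R - {x})))"
      by (simp add: unit_kernel_def add_ac)
    have sp: "splits s X = splits x X \<union> (\<lambda>R. (R, x)) ` Pow ?lower"
    proof (rule set_eqI, clarify)
      fix R u
      have "u \<in> X \<and> s < u \<longleftrightarrow> u \<in> X \<and> x < u \<or> u = x"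
        using x xmin[of u] by auto
      then show "(R, u) \<in> splits s X \<longleftrightarrow> (R, u) \<in> splits x X \<union> (\<lambda>R. (R, x)) ` Pow ?lower"
        by (auto simp: splits_def)
    qed
    have "((\<lambda>_. v) \<odot> exp_kernel v) s X = ((\<lambda>_. v) \<odot> exp_kernel v) x X + (\<Sum>(R, u)\<in>(\<lambda>R. (R, x)) ` Pow ?lower. v R * exp_kernel v u (X - R - {u}))"
    proof -
      have "splits x X \<inter> (\<lambda>R. (R, x)) ` Pow ?lower = {}" by (auto simp: splits_def)
      then show ?thesis
        unfolding kconv_def sp using fin by (subst sum.union_disjoint) simp_all
    qed
    also have "(\<Sum>(R, u)\<in>(\<lambda>R. (R, x)) ` Pow ?lower. v R * exp_kernel v u (X - R - {u}))
      = (\<Sum>R\<in>Pow ?lower. v R * exp_kernel v x (X - R - {x}))"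
      by (subst sum.reindex) (auto simp: inj_on_def)
    finally show ?thesis using 1 by simp
  qed
qed

section \<open>Sequences shuffled with an exponential\<close>

text \<open>The exponential, shuffled with plain points: the labels in \<open>A\<close> lie on the chain with nothing
  hanging below them, and contribute through their number only.\<close>

definition seq_kernel :: "(nat set \<Rightarrow> 'a::comm_ring_1) \<Rightarrow> (nat \<Rightarrow> 'a) \<Rightarrow> 'a kernel" where
  "seq_kernel v a s S = (\<Sum>A\<in>Pow {x\<in>S. s < x}. a (card A) * exp_kernel v s (S - A))"

text \<open>The coefficients of \<open>a(x) * x * b(x)\<close> for generating functions \<open>a\<close> and \<open>b\<close>; the factor \<open>x\<close>
  is the label at which two kernels are glued.\<close>

definition shift_conv :: "(nat \<Rightarrow> 'a::comm_ring_1) \<Rightarrow> (nat \<Rightarrow> 'a) \<Rightarrow> nat \<Rightarrow> 'a" where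
  "shift_conv a b n = (\<Sum>i<n. a i * b (n - Suc i))"

text \<open>An element of a finite set is determined by the number of smaller elements.\<close>

lemma sum_positions:
  assumes "finite (Z::nat set)"
  shows "(\<Sum>u\<in>Z. h (card {x\<in>Z. x < u})) = (\<Sum>i<card Z. h i)"
proof -
  have "bij_betw (\<lambda>u. card {x\<in>Z. x < u}) Z {..<card Z}"
    unfolding bij_betw_def
  proof
    show inj: "inj_on (\<lambda>u. card {x\<in>Z. x < u}) Z"
    proof (rule linorder_inj_onI)
      fix x y assume "x < y" "x \<in> Z" "y \<in> Z"
      then have "card {z\<in>Z. z < x} < card {z\<in>Z. z < y}"
        using assms by (intro psubset_card_mono) auto
      then show "card {z\<in>Z. z < x} \<noteq> card {z\<in>Z. z < y}" by simp
    qed auto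
    show "(\<lambda>u. card {x\<in>Z. x < u}) ` Z = {..<card Z}"
      using assms by (intro card_subset_eq) (auto simp: card_image inj intro!: psubset_card_mono)
  qed
  from sum.reindex_bij_betw[OF this, of h] show ?thesis by simp
qed

text \<open>Continuous analogue: both factors are a function of the difference of the endpoints times an
  exponential of an increment. The exponentials multiply to one that does not depend on the
  intermediate point \<open>u\<close>, and what is left is an ordinary convolution. In the proof \<open>Z\<close> collects
  the plain points of both factors together with \<open>u\<close>, and \<open>Q\<close> the remaining labels that are used
  before \<open>u\<close>.\<close>

lemma seq_kernel_kconv:
  assumes "finite S"
  shows "(seq_kernel v a \<odot> seq_kernel v b) s S = seq_kernel v (shift_conv a b) s S"
proof -
  let ?lo = "\<lambda>Z u. {x\<in>Z. x < u}" and ?hi = "\<lambda>Z u. {x\<in>Z. u < x}"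
  let ?F = "\<lambda>Z u. a (card (?lo Z u)) * b (card (?hi Z u)) *
    (\<Sum>Q\<in>Pow (?lo (S - Z) u). exp_kernel v s Q * exp_kernel v u (S - Z - Q))"
  have fin: "finite R" if "(R, u) \<in> splits s S" for R u
    using splits_card[OF assms that] by simp
  have "(seq_kernel v a \<odot> seq_kernel v b) s S = (\<Sum>(R, u)\<in>splits s S. \<Sum>A\<in>Pow (?hi R s). \<Sum>C\<in>Pow (?hi (S - R - {u}) u).
      (a (card A) * exp_kernel v s (R - A)) * (b (card C) * exp_kernel v u (S - R - {u} - C)))"
    unfolding kconv_def seq_kernel_def by (intro sum.cong refl) (auto simp: sum_product)
  also have "\<dots> = (\<Sum>((R, u), A, C)\<in>(SIGMA (R, u):splits s S. Pow (?hi R s) \<times> Pow (?hi (S - R - {u}) u)).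
      (a (card A) * exp_kernel v s (R - A)) * (b (card C) * exp_kernel v u (S - R - {u} - C)))"
    unfolding case_prod_beta sum.cartesian_product
    by (subst sum.Sigma) (use assms fin in \<open>auto simp: case_prod_beta\<close>)
  also have "\<dots> = (\<Sum>(Z, u, Q)\<in>(SIGMA Z:Pow (?hi S s). SIGMA u:Z. Pow (?lo (S - Z) u)).
      a (card (?lo Z u)) * b (card (?hi Z u)) * (exp_kernel v s Q * exp_kernel v u (S - Z - Q)))"
  proof (rule sum.reindex_bij_witness[of _ "\<lambda>(Z, u, Q). ((Q \<union> ?lo Z u, u), ?lo Z u, ?hi Z u)"
          "\<lambda>((R, u), A, C). (insert u (A \<union> C), u, R - A)"], goal_cases)
    case (1 x)
    obtain R u A C where x: "x = ((R, u), A, C)" by (cases x) auto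
    with 1 have *: "u \<in> S" "s < u" "R \<subseteq> S" "\<forall>x\<in>R. x < u" 
      "A \<subseteq> R" "\<forall>x\<in>A. s < x" "\<forall>x\<in>A. x < u" "C \<subseteq> S - R" "\<forall>x\<in>C. u < x"
      by (auto simp: splits_def)
    then have "?lo (insert u (A \<union> C)) u = A" "?hi (insert u (A \<union> C)) u = C" "R - A \<union> A = R"
      by auto
    with x show ?case by simp
  next
    case (2 x)
    obtain R u A C where x: "x = ((R, u), A, C)" by (cases x) auto
    with 2 have *: "u \<in> S" "s < u" "R \<subseteq> S" "\<forall>x\<in>R. x < u" 
      "A \<subseteq> R" "\<forall>x\<in>A. s < x" "\<forall>x\<in>A. x < u" "C \<subseteq> S - R" "\<forall>x\<in>C. u < x"
      by (auto simp: splits_def)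
    show ?case unfolding x using * by auto
  next
    case (3 x)
    obtain Z u Q where x: "x = (Z, u, Q)" by (cases x) auto
    with 3 have *: "Z \<subseteq> S" "\<forall>x\<in>Z. s < x" "u \<in> Z" "Q \<subseteq> S - Z" "\<forall>x\<in>Q. x < u"
      by auto
    then have "insert u (?lo Z u \<union> ?hi Z u) = Z" "Q \<union> ?lo Z u - ?lo Z u = Q"
      by auto
    with x show ?case by simp
  next
    case (4 x)
    obtain Z u Q where x: "x = (Z, u, Q)" by (cases x) auto
    with 4 have *: "Z \<subseteq> S" "\<forall>x\<in>Z. s < x" "u \<in> Z" "Q \<subseteq> S - Z" "\<forall>x\<in>Q. x < u"
      by auto
    then have "(Q \<union> ?lo Z u, u) \<in> splits s S" "?lo Z u \<subseteq> ?hi (Q \<union> ?lo Z u) s"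
      "?hi Z u \<subseteq> ?hi (S - (Q \<union> ?lo Z u) - {u}) u"
      by (auto simp: splits_def)
    with x show ?case by simp
  next
    case (5 x)
    obtain R u A C where x: "x = ((R, u), A, C)" by (cases x) auto
    with 5 have *: "u \<in> S" "s < u" "R \<subseteq> S" "\<forall>x\<in>R. x < u" 
      "A \<subseteq> R" "\<forall>x\<in>A. s < x" "\<forall>x\<in>A. x < u" "C \<subseteq> S - R" "\<forall>x\<in>C. u < x"
      by (auto simp: splits_def)
    then have "?lo (insert u (A \<union> C)) u = A" "?hi (insert u (A \<union> C)) u = C" 
      "S - insert u (A \<union> C) - (R - A) = S - R - {u} - C" by auto
    with x show ?case by (simp add: mult_ac)
  qed
  also have "\<dots> = (\<Sum>Z\<in>Pow (?hi S s). \<Sum>u\<in>Z. ?F Z u)"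
  proof -
    have finZ: "finite Z" if "Z \<in> Pow (?hi S s)" for Z
      using that assms by (auto intro: finite_subset[of Z S])
    have "(\<Sum>Z\<in>Pow (?hi S s). \<Sum>u\<in>Z. \<Sum>Q\<in>Pow (?lo (S - Z) u). h Z u Q)
        = (\<Sum>(Z, u, Q)\<in>(SIGMA Z:Pow (?hi S s). SIGMA u:Z. Pow (?lo (S - Z) u)). h Z u Q)"
      for h :: "nat set \<Rightarrow> nat \<Rightarrow> nat set \<Rightarrow> 'a"
    proof -
      have "(\<Sum>u\<in>Z. \<Sum>Q\<in>Pow (?lo (S - Z) u). h Z u Q)
          = (\<Sum>(u, Q)\<in>(SIGMA u:Z. Pow (?lo (S - Z) u)). h Z u Q)" if "Z \<in> Pow (?hi S s)" for Z
        using finZ[OF that] assms by (intro sum.Sigma) auto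
      moreover have "(\<Sum>Z\<in>Pow (?hi S s). \<Sum>(u, Q)\<in>(SIGMA u:Z. Pow (?lo (S - Z) u)). h Z u Q)
          = (\<Sum>(Z, u, Q)\<in>(SIGMA Z:Pow (?hi S s). SIGMA u:Z. Pow (?lo (S - Z) u)). h Z u Q)"
        using finZ assms by (intro sum.Sigma ballI finite_SigmaI) auto
      ultimately show ?thesis by simp
    qed
    then show ?thesis by (simp add: sum_distrib_left)
  qed
  also have "\<dots> = (\<Sum>Z\<in>Pow (?hi S s). shift_conv a b (card Z) * exp_kernel v s (S - Z))"
  proof (intro sum.cong refl)
    fix Z assume Z: "Z \<in> Pow (?hi S s)"
    then have finZ: "finite Z" using assms by (auto intro: finite_subset[of Z S])
    have "(\<Sum>u\<in>Z. ?F Z u)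
       = (\<Sum>u\<in>Z. a (card (?lo Z u)) * b (card Z - Suc (card (?lo Z u))) * exp_kernel v s (S - Z))"
    proof (intro sum.cong refl)
      fix u assume u: "u \<in> Z"
      have "Z = insert u (?lo Z u \<union> ?hi Z u)" using u by auto
      then have "card Z = card (insert u (?lo Z u \<union> ?hi Z u))" by simp
      also have "\<dots> = Suc (card (?lo Z u) + card (?hi Z u))"
        using finZ by (subst card_insert_disjoint, simp, simp, subst card_Un_disjoint) auto
      finally have "card (?hi Z u) = card Z - Suc (card (?lo Z u))" by simp
      moreover have "exp_kernel v s (S - Z) = (\<Sum>Q\<in>Pow (?lo (S - Z) u). exp_kernel v s Q * exp_kernel v u (S - Z - Q))"
        using assms Z u by (intro exp_kernel_split) auto
      ultimately show "?F Z u
         = a (card (?lo Z u)) * b (card Z - Suc (card (?lo Z u))) * exp_kernel v s (S - Z)" by simp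
    qed
    also have "\<dots> = shift_conv a b (card Z) * exp_kernel v s (S - Z)"
      using sum_positions[OF finZ, of "\<lambda>i. a i * b (card Z - Suc i)"]
      by (simp add: sum_distrib_right[symmetric] shift_conv_def)
    finally show "(\<Sum>u\<in>Z. ?F Z u)
      = shift_conv a b (card Z) * exp_kernel v s (S - Z)" .
  qed
  finally show ?thesis by (simp add: seq_kernel_def)
qed

section \<open>Noncrossing partitions\<close>

definition nc_parts :: "nat set \<Rightarrow> nat set set set" where
  "nc_parts X = {\<rho>. partition_on X \<rho> \<and> (\<forall>B\<in>\<rho>. \<forall>B'\<in>\<rho>. B \<noteq> B' \<longrightarrow> \<not> crossing B B')}"

text \<open>The value vanishes unless all labels lie above \<open>s\<close>: noncrossing partitions are to fill the
  gaps between consecutive elements of a block.\<close>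

definition nc_kernel :: "(nat \<Rightarrow> 'a::comm_ring_1) \<Rightarrow> 'a kernel" where
  "nc_kernel \<kappa> s X = (if \<forall>x\<in>X. s < x then \<Sum>\<rho>\<in>nc_parts X. partition_weight \<kappa> \<rho> else 0)"

text \<open>Noncrossing partitions of \<open>insert u X\<close> in which the block of \<open>u\<close> is \<open>insert u C\<close> and is not
  listed. With \<open>u\<close> below \<open>X\<close>, this is the state in which the block has been read up to \<open>u\<close> and
  still lacks \<open>k\<close> elements.\<close>

definition open_nc_parts :: "nat \<Rightarrow> nat \<Rightarrow> nat set \<Rightarrow> (nat set \<times> nat set set) set" where
  "open_nc_parts k u X = {(C, \<rho>). C \<subseteq> X \<and> card C = k \<and> \<rho> \<in> nc_parts (X - C)
      \<and> (\<forall>B\<in>\<rho>. \<not> crossing (insert u C) B)}"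

definition open_nc_kernel :: "(nat \<Rightarrow> 'a::comm_ring_1) \<Rightarrow> nat \<Rightarrow> 'a kernel" where
  "open_nc_kernel \<kappa> k u X =
     (if \<forall>x\<in>X. u < x then \<Sum>(C, \<rho>)\<in>open_nc_parts k u X. partition_weight \<kappa> \<rho> else 0)"

lemma crossing_iff:
  "crossing B B' \<longleftrightarrow>
     (\<exists>i\<in>B. \<exists>j\<in>B. \<exists>i'\<in>B'. \<exists>j'\<in>B'. i < i' \<and> i' < j \<and> j < j' \<or> i' < i \<and> i < j' \<and> j' < j)"
  unfolding crossing_def by blast

lemma crossing_sym: "crossing B B' \<longleftrightarrow> crossing B' B"
  unfolding crossing_iff by blast

lemma finite_nc_parts [simp]: "finite X \<Longrightarrow> finite (nc_parts X)"
  by (rule finite_subset[OF _ finitely_many_partition_on]) (auto simp: nc_parts_def)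

lemma finite_open_nc_parts [simp]:
  assumes "finite X"
  shows "finite (open_nc_parts k u X)"
proof (rule finite_subset)
  show "open_nc_parts k u X \<subseteq> (SIGMA C:Pow X. nc_parts (X - C))"
    by (auto simp: open_nc_parts_def)
qed (use assms in auto)

lemma nc_parts_empty [simp]: "nc_parts {} = {{}}"
  by (auto simp: nc_parts_def partition_on_empty)

lemma open_nc_kernel_0: "finite X \<Longrightarrow> open_nc_kernel \<kappa> 0 u X = nc_kernel \<kappa> u X"
proof -
  assume "finite X"
  have "(\<Sum>(C, \<rho>)\<in>open_nc_parts 0 u X. partition_weight \<kappa> \<rho>) = (\<Sum>\<rho>\<in>nc_parts X. partition_weight \<kappa> \<rho>)"
  proof (rule sum.reindex_bij_witness[of _ "\<lambda>\<rho>. ({}, \<rho>)" snd], goal_cases)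
    case (1 z)
    obtain C \<rho> where z: "z = (C, \<rho>)" by (cases z)
    with 1 have C: "C \<subseteq> X" "card C = 0" "\<rho> \<in> nc_parts (X - C)" by (auto simp: open_nc_parts_def)
    then have "C = {}" using \<open>finite X\<close> by (auto dest: finite_subset)
    then show ?case using C z by simp
  next
    case (2 z)
    obtain C \<rho> where z: "z = (C, \<rho>)" by (cases z)
    with 2 have C: "C \<subseteq> X" "card C = 0" "\<rho> \<in> nc_parts (X - C)" by (auto simp: open_nc_parts_def)
    then have "C = {}" using \<open>finite X\<close> by (auto dest: finite_subset)
    then show ?case using C z by simp
  next
    case (4 \<rho>)
    have "\<not> crossing {u} B" for B unfolding crossing_iff by auto
    with 4 show ?case by (simp add: open_nc_parts_def)
  qed (auto simp: case_prod_beta)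
  then show ?thesis by (simp add: open_nc_kernel_def nc_kernel_def)
qed

lemma partition_on_Un:
  assumes "X \<inter> Y = {}"
  shows "partition_on X \<rho> \<Longrightarrow> partition_on Y \<sigma> \<Longrightarrow> partition_on (X \<union> Y) (\<rho> \<union> \<sigma>)"
proof -
  assume p: "partition_on X \<rho>" "partition_on Y \<sigma>"
  show ?thesis
  proof (rule partition_onI)
    show "\<Union>(\<rho> \<union> \<sigma>) = X \<union> Y" "{} \<notin> \<rho> \<union> \<sigma>" using p by (auto simp: partition_on_def)
    fix A B assume AB: "A \<in> \<rho> \<union> \<sigma>" "B \<in> \<rho> \<union> \<sigma>" "A \<noteq> B"
    have "A \<inter> B \<subseteq> X \<inter> Y" if "A \<in> \<rho> \<and> B \<in> \<sigma> \<or> A \<in> \<sigma> \<and> B \<in> \<rho>"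
      using p that by (auto simp: partition_on_def)
    moreover have "disjnt A B" if "A \<in> \<rho> \<and> B \<in> \<rho> \<or> A \<in> \<sigma> \<and> B \<in> \<sigma>"
      using p that AB(3) by (auto simp: partition_on_def pairwise_def)
    ultimately show "disjnt A B"
      using AB assms by (auto simp: disjnt_def)
  qed
qed

lemma partition_on_filter:
  assumes "partition_on X \<rho>" "\<And>B. B \<in> \<rho> \<Longrightarrow> B \<subseteq> Y \<or> B \<inter> Y = {}" "Y \<subseteq> X"
  shows "partition_on Y {B\<in>\<rho>. B \<subseteq> Y}"
proof (rule partition_onI)
  show "\<Union>{B\<in>\<rho>. B \<subseteq> Y} = Y"
  proof
    show "Y \<subseteq> \<Union>{B\<in>\<rho>. B \<subseteq> Y}"
    proof
      fix y assume "y \<in> Y"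
      then obtain B where "B \<in> \<rho>" "y \<in> B" using assms(1,3) by (auto simp: partition_on_def)
      then show "y \<in> \<Union>{B\<in>\<rho>. B \<subseteq> Y}" using assms(2)[of B] \<open>y \<in> Y\<close> by auto
    qed
  qed auto
qed (use assms(1) in \<open>auto simp: partition_on_def pairwise_def\<close>)

lemma partition_weight_Un:
  assumes "partition_on X \<rho>" "partition_on Y \<sigma>" "X \<inter> Y = {}" "finite X" "finite Y"
  shows "partition_weight \<kappa> (\<rho> \<union> \<sigma>) = partition_weight \<kappa> \<rho> * partition_weight \<kappa> \<sigma>"
  unfolding partition_weight_def
proof (rule prod.union_disjoint)
  show "\<rho> \<inter> \<sigma> = {}"
  proof (rule ccontr)
    assume "\<rho> \<inter> \<sigma> \<noteq> {}"
    then obtain B where "B \<in> \<rho>" "B \<in> \<sigma>" by auto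
    then have "B \<subseteq> X \<inter> Y" "B \<noteq> {}" using assms by (auto simp: partition_on_def)
    with assms show False by auto
  qed
qed (use assms finite_elements in auto)

text \<open>The next element \<open>v\<close> of the open block separates everything else: a block with elements on
  both sides of \<open>v\<close> would cross the open block. Conversely, the labels between \<open>u\<close> and \<open>v\<close> are not
  interleaved with the open block, and for the labels above \<open>v\<close> its elements \<open>u\<close> and \<open>v\<close> are
  interchangeable.\<close>

lemma open_nc_parts_Suc_iff:
  assumes u: "\<forall>x\<in>X. u < x" and v: "v \<in> X" and fin: "finite X"
    and lo: "lo = {x\<in>X. x < v}" and hi: "hi = {x\<in>X. v < x}"
  shows "(C, \<rho>) \<in> open_nc_parts (Suc k) u X \<and> v \<in> C \<and> C \<inter> lo = {} \<longleftrightarrow>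
     (\<exists>C' \<rho>1 \<rho>2. C = insert v C' \<and> \<rho> = \<rho>1 \<union> \<rho>2 \<and> \<rho>1 \<in> nc_parts lo \<and> (C', \<rho>2) \<in> open_nc_parts k v hi)"
  (is "?L \<longleftrightarrow> ?R")
proof
  assume L: ?L
  then have C: "C \<subseteq> X" "card C = Suc k" "\<rho> \<in> nc_parts (X - C)" "v \<in> C" "C \<inter> lo = {}"
    and nx: "\<And>B. B \<in> \<rho> \<Longrightarrow> \<not> crossing (insert u C) B"
    by (auto simp: open_nc_parts_def)
  have part: "partition_on (X - C) \<rho>" using C by (simp add: nc_parts_def)
  have side: "B \<subseteq> lo \<or> B \<subseteq> hi - C" if B: "B \<in> \<rho>" for B
  proof (rule ccontr)
    have BX: "B \<subseteq> X - C" using part B by (auto simp: partition_on_def)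
    assume "\<not> (B \<subseteq> lo \<or> B \<subseteq> hi - C)"
    then obtain b b' where b: "b \<in> B" "b \<notin> lo" "b' \<in> B" "b' \<notin> hi" using BX by auto
    then have "b' < v" "v < b" "u < b'" using BX C(4) u by (auto simp: lo hi not_less le_less)
    then have "crossing (insert u C) B"
      unfolding crossing_def using b C(4) by blast
    with nx B show False by blast
  qed
  have "hi - (C - {v}) = hi - C" by (auto simp: hi)
  moreover have "partition_on lo {B\<in>\<rho>. B \<subseteq> lo}"
  proof (rule partition_on_filter[OF part])
    show "B \<subseteq> lo \<or> B \<inter> lo = {}" if "B \<in> \<rho>" for B
      using side[OF that] by (auto simp: lo hi)
    show "lo \<subseteq> X - C" using C by (auto simp: lo)
  qed
  moreover have "partition_on (hi - C) {B\<in>\<rho>. B \<subseteq> hi - C}"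
  proof (rule partition_on_filter[OF part])
    show "B \<subseteq> hi - C \<or> B \<inter> (hi - C) = {}" if "B \<in> \<rho>" for B
      using side[OF that] by (auto simp: lo hi)
    show "hi - C \<subseteq> X - C" by (auto simp: hi)
  qed
  moreover have "\<rho> = {B\<in>\<rho>. B \<subseteq> lo} \<union> {B\<in>\<rho>. B \<subseteq> hi - C}" using side by auto
  moreover have "\<not> crossing (insert v (C - {v})) B" if "B \<in> \<rho>" for B
  proof -
    have "insert v (C - {v}) \<subseteq> insert u C" using C by auto
    then show ?thesis using nx[OF that] unfolding crossing_def by blast
  qed
  moreover have "C - {v} \<subseteq> hi" using C v by (auto simp: lo hi disjoint_iff not_less le_less)
  moreover have "card (C - {v}) = k" using C by simp
  ultimately have "{B\<in>\<rho>. B \<subseteq> lo} \<in> nc_parts lo" "(C - {v}, {B\<in>\<rho>. B \<subseteq> hi - C}) \<in> open_nc_parts k v hi"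
    using C(3) by (auto simp: nc_parts_def open_nc_parts_def)
  moreover have "C = insert v (C - {v})" using C by auto
  ultimately show ?R using \<open>\<rho> = _\<close> by blast
next
  assume ?R
  then obtain C' \<rho>1 \<rho>2 where R: "C = insert v C'" "\<rho> = \<rho>1 \<union> \<rho>2" "\<rho>1 \<in> nc_parts lo"
    "C' \<subseteq> hi" "card C' = k" "\<rho>2 \<in> nc_parts (hi - C')" "\<And>B. B \<in> \<rho>2 \<Longrightarrow> \<not> crossing (insert v C') B"
    by (auto simp: open_nc_parts_def)
  have p: "partition_on lo \<rho>1" "partition_on (hi - C') \<rho>2" using R by (auto simp: nc_parts_def)
  have B1: "B \<subseteq> lo" if "B \<in> \<rho>1" for B using p that by (auto simp: partition_on_def)
  have B2: "B \<subseteq> hi - C'" if "B \<in> \<rho>2" for B using p that by (auto simp: partition_on_def)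
  have "X - C = lo \<union> (hi - C')" using R(1,4) v by (auto simp: lo hi)
  moreover have "lo \<inter> (hi - C') = {}" by (auto simp: lo hi)
  ultimately have pXC: "partition_on (X - C) \<rho>"
    using partition_on_Un[OF _ p] R(2) by simp
  have c12: "\<not> crossing A B" if "A \<in> \<rho>1" "B \<in> \<rho>2" for A B
  proof
    have lt: "a < b" if "a \<in> A" "b \<in> B" for a b
      using B1[OF \<open>A \<in> \<rho>1\<close>] B2[OF \<open>B \<in> \<rho>2\<close>] that by (auto simp: lo hi dest!: subsetD)
    assume "crossing A B"
    then obtain i j i' j' where "i \<in> A" "j \<in> A" "i' \<in> B" "j' \<in> B"
      "i < i' \<and> i' < j \<and> j < j' \<or> i' < i \<and> i < j' \<and> j' < j"
      unfolding crossing_iff by blast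
    then show False using lt[of j i'] lt[of i i'] by auto
  qed
  have "\<not> crossing A B" if "A \<in> \<rho>" "B \<in> \<rho>" "A \<noteq> B" for A B
  proof -
    have "\<not> crossing A B" if "A \<in> \<rho>1" "B \<in> \<rho>1"
      using R(3) that \<open>A \<noteq> B\<close> by (simp add: nc_parts_def)
    moreover have "\<not> crossing A B" if "A \<in> \<rho>2" "B \<in> \<rho>2"
      using R(6) that \<open>A \<noteq> B\<close> by (simp add: nc_parts_def)
    moreover have "\<not> crossing A B" if "A \<in> \<rho>2" "B \<in> \<rho>1"
      using c12[OF that(2,1)] by (simp add: crossing_sym)
    ultimately show ?thesis using that(1,2) R(2) c12 by blast
  qed
  with pXC have ncXC: "\<rho> \<in> nc_parts (X - C)" by (simp add: nc_parts_def)
  have n1: "\<not> crossing (insert u C) B" if "B \<in> \<rho>1" for B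
  proof
    have lt: "\<And>b. b \<in> B \<Longrightarrow> u < b \<and> b < v" using B1[OF that] u by (auto simp: lo)
    have ge: "\<And>c. c \<in> insert u C \<Longrightarrow> c = u \<or> v \<le> c" using R(1,4) by (auto simp: hi)
    assume "crossing (insert u C) B"
    then obtain i j i' j' where "i \<in> insert u C" "j \<in> insert u C" "i' \<in> B" "j' \<in> B"
      "i < i' \<and> i' < j \<and> j < j' \<or> i' < i \<and> i < j' \<and> j' < j"
      unfolding crossing_iff by blast
    then show False using lt[of i'] lt[of j'] ge[of i] ge[of j] by auto
  qed
  have n2: "\<not> crossing (insert u C) B" if "B \<in> \<rho>2" for B
  proof
    have gt: "\<And>b. b \<in> B \<Longrightarrow> v < b" using B2[OF that] by (auto simp: hi)
    assume "crossing (insert u C) B"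
    then obtain i j i' j' where c: "i \<in> insert u C" "j \<in> insert u C" "i' \<in> B" "j' \<in> B"
      "i < i' \<and> i' < j \<and> j < j' \<or> i' < i \<and> i < j' \<and> j' < j"
      unfolding crossing_iff by blast
    have "u < v" using u v by auto
    \<comment> \<open>As \<open>B\<close> lies above \<open>v\<close>, replacing \<open>u\<close> by \<open>v\<close> changes no comparison with elements of \<open>B\<close>.\<close>
    define r where "r c = (if c = u then v else c)" for c
    have r: "r i \<in> C" "r j \<in> C" using c R(1) by (auto simp: r_def)
    have "r i < i' \<and> i' < r j \<and> r j < j' \<or> i' < r i \<and> r i < j' \<and> j' < r j"
      using c(5) gt[OF c(3)] gt[OF c(4)] \<open>u < v\<close> by (auto simp: r_def)
    then have "crossing (insert v C') B"
      unfolding crossing_iff using r c(3,4) R(1) by blast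
    with R(7)[OF that] show False ..
  qed
  have CX: "C \<subseteq> X" "v \<in> C" "C \<inter> lo = {}"
    using R(1,4) v by (auto simp: lo hi)
  have "card C = Suc k"
  proof -
    have "finite C'" "v \<notin> C'" using R(4) fin by (auto simp: hi intro: finite_subset[of C' X])
    then show ?thesis using R by simp
  qed
  moreover have "\<forall>B\<in>\<rho>. \<not> crossing (insert u C) B" using n1 n2 R(2) by auto
  ultimately show ?L
    unfolding open_nc_parts_def using CX ncXC by simp
qed

lemma unit_kconv:
  assumes "finite X"
  shows "(\<delta> \<odot> f) s X = (\<Sum>u\<in>{u\<in>X. s < u}. f u (X - {u}))"
proof -
  have "(\<delta> \<odot> f) s X = (\<Sum>(R, u)\<in>(\<lambda>u. ({}, u)) ` {u\<in>X. s < u}. \<delta> s R * f u (X - R - {u}))"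
    unfolding kconv_def
  proof (rule sum.mono_neutral_right)
    show "finite (splits s X)" using assms by (rule finite_splits)
  qed (auto simp: splits_def unit_kernel_def split: if_splits)
  also have "\<dots> = (\<Sum>u\<in>{u\<in>X. s < u}. f u (X - {u}))"
    by (subst sum.reindex) (auto simp: inj_on_def unit_kernel_def)
  finally show ?thesis .
qed

text \<open>Only one split contributes for each \<open>v\<close>, because the second kernel vanishes unless \<open>R\<close>
  consists of all labels below \<open>v\<close>.\<close>

lemma open_nc_kernel_Suc:
  assumes fin: "finite X"
  shows "open_nc_kernel \<kappa> (Suc k) u X = (nc_kernel \<kappa> \<odot> open_nc_kernel \<kappa> k) u X"
proof (cases "\<forall>x\<in>X. u < x")
  case False
  have "(nc_kernel \<kappa> \<odot> open_nc_kernel \<kappa> k) u X = 0"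
    unfolding kconv_def
  proof (intro sum.neutral ballI, clarify)
    fix R v assume s: "(R, v) \<in> splits u X"
    obtain x where x: "x \<in> X" "x \<le> u" using False by (auto simp: not_less)
    have "u < v" using s by (simp add: splits_def)
    have "\<not> (\<forall>x\<in>R. u < x) \<or> \<not> (\<forall>x\<in>X - R - {v}. v < x)"
    proof (cases "x \<in> R")
      case False
      then have "x \<in> X - R - {v}" "\<not> v < x" using x \<open>u < v\<close> by auto
      then show ?thesis by blast
    qed (use x in \<open>auto simp: not_less\<close>)
    then show "nc_kernel \<kappa> u R * open_nc_kernel \<kappa> k v (X - R - {v}) = 0"
      by (auto simp: nc_kernel_def open_nc_kernel_def)
  qed
  moreover have "open_nc_kernel \<kappa> (Suc k) u X = 0"
    unfolding open_nc_kernel_def using False by (rule if_not_P)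
  ultimately show ?thesis by simp
next
  case True
  let ?lo = "\<lambda>v. {x\<in>X. x < v}" and ?hi = "\<lambda>v. {x\<in>X. v < x}"
  have "(nc_kernel \<kappa> \<odot> open_nc_kernel \<kappa> k) u X
      = (\<Sum>(R, v)\<in>(\<lambda>v. (?lo v, v)) ` X. nc_kernel \<kappa> u R * open_nc_kernel \<kappa> k v (X - R - {v}))"
    unfolding kconv_def
  proof (intro sum.mono_neutral_right ballI)
    show "(\<lambda>v. (?lo v, v)) ` X \<subseteq> splits u X" using True by (auto simp: splits_def)
    fix z assume z: "z \<in> splits u X - (\<lambda>v. (?lo v, v)) ` X"
    obtain R v where Rv: "z = (R, v)" by (cases z)
    with z have "R \<noteq> ?lo v" and s: "v \<in> X" "R \<subseteq> X" "\<forall>x\<in>R. x < v" by (auto simp: splits_def)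
    then obtain x where "x \<in> X" "x < v" "x \<notin> R" by auto
    then have "x \<in> X - R - {v}" "\<not> v < x" by auto
    then have "\<not> (\<forall>x\<in>X - R - {v}. v < x)" by blast
    then have "open_nc_kernel \<kappa> k v (X - R - {v}) = 0" by (auto simp: open_nc_kernel_def)
    then show "(case z of (R, v) \<Rightarrow> nc_kernel \<kappa> u R * open_nc_kernel \<kappa> k v (X - R - {v})) = 0"
      using Rv by simp
  qed (use fin in simp)
  also have "\<dots> = (\<Sum>v\<in>X. nc_kernel \<kappa> u (?lo v) * open_nc_kernel \<kappa> k v (?hi v))"
  proof -
    have "X - ?lo v - {v} = ?hi v" for v by auto
    then show ?thesis by (subst sum.reindex) (auto simp: inj_on_def)
  qed
  also have "\<dots> = (\<Sum>v\<in>X. \<Sum>(\<rho>1, C', \<rho>2)\<in>nc_parts (?lo v) \<times> open_nc_parts k v (?hi v).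
        partition_weight \<kappa> \<rho>1 * partition_weight \<kappa> \<rho>2)"
    using True by (simp add: nc_kernel_def open_nc_kernel_def sum_product sum.cartesian_product case_prod_beta)
  also have "\<dots> = (\<Sum>(v, \<rho>1, C', \<rho>2)\<in>(SIGMA v:X. nc_parts (?lo v) \<times> open_nc_parts k v (?hi v)).
        partition_weight \<kappa> \<rho>1 * partition_weight \<kappa> \<rho>2)"
    by (rule sum.Sigma) (use fin in auto)
  also have "\<dots> = (\<Sum>(C, \<rho>)\<in>open_nc_parts (Suc k) u X. partition_weight \<kappa> \<rho>)"
  proof -
    let ?A = "SIGMA v:X. nc_parts (?lo v) \<times> open_nc_parts k v (?hi v)"
    let ?j = "\<lambda>(v, \<rho>1, C', \<rho>2). (insert v C', \<rho>1 \<union> \<rho>2)"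
    let ?i = "\<lambda>(C, \<rho>). (Min C, {B\<in>\<rho>. B \<subseteq> ?lo (Min C)}, C - {Min C}, {B\<in>\<rho>. \<not> B \<subseteq> ?lo (Min C)})"
    have ij: "?i (?j z) = z" if "z \<in> ?A" for z
    proof -
      obtain v \<rho>1 C' \<rho>2 where z: "z = (v, \<rho>1, C', \<rho>2)" by (cases z) auto
      with that have *: "v \<in> X" "\<rho>1 \<in> nc_parts (?lo v)" "C' \<subseteq> ?hi v" "\<rho>2 \<in> nc_parts (?hi v - C')"
        by (auto simp: open_nc_parts_def)
      have "finite C'" using * fin by (auto intro: finite_subset[of C' X])
      then have "Min (insert v C') = v" using * by (intro Min_eqI) auto
      moreover have "insert v C' - {v} = C'" using * by auto
      moreover have "B \<subseteq> ?lo v" if "B \<in> \<rho>1" for B 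
        using * that by (auto simp: nc_parts_def partition_on_def)
      moreover have "\<not> B \<subseteq> ?lo v" if "B \<in> \<rho>2" for B 
      proof -
        have "B \<noteq> {}" "B \<subseteq> ?hi v" using * that by (auto simp: nc_parts_def partition_on_def)
        then show ?thesis by fastforce
      qed
      ultimately show ?thesis using z by auto
    qed
    have j: "?j z \<in> open_nc_parts (Suc k) u X" if "z \<in> ?A" for z
      using that open_nc_parts_Suc_iff[OF True _ fin refl refl] by fast
    have surj: "\<exists>y\<in>?A. ?j y = z" if "z \<in> open_nc_parts (Suc k) u X" for z
    proof -
      obtain C \<rho> where z: "z = (C, \<rho>)" by (cases z)
      with that have C: "C \<subseteq> X" "card C = Suc k" by (auto simp: open_nc_parts_def)
      then have "finite C" "C \<noteq> {}" using fin finite_subset by auto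
      have "Min C \<in> C" using \<open>finite C\<close> \<open>C \<noteq> {}\<close> by (rule Min_in)
      moreover have "C \<inter> ?lo (Min C) = {}"
      proof -
        have "\<not> x < Min C" if "x \<in> C" for x using \<open>finite C\<close> that by (simp add: not_less)
        then show ?thesis by blast
      qed
      moreover have "Min C \<in> X" using C(1) \<open>Min C \<in> C\<close> by blast
      moreover have "(C, \<rho>) \<in> open_nc_parts (Suc k) u X" using that z by simp
      ultimately have "\<exists>C' \<rho>1 \<rho>2. C = insert (Min C) C' \<and> \<rho> = \<rho>1 \<union> \<rho>2 \<and>
        \<rho>1 \<in> nc_parts (?lo (Min C)) \<and> (C', \<rho>2) \<in> open_nc_parts k (Min C) (?hi (Min C))"
        by (intro open_nc_parts_Suc_iff[OF True _ fin refl refl, THEN iffD1] conjI)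
      then obtain C' \<rho>1 \<rho>2 where C': "C = insert (Min C) C'" "\<rho> = \<rho>1 \<union> \<rho>2" 
        "\<rho>1 \<in> nc_parts (?lo (Min C))" "(C', \<rho>2) \<in> open_nc_parts k (Min C) (?hi (Min C))"
        by (elim exE conjE)
      show ?thesis
      proof (rule bexI)
        show "?j (Min C, \<rho>1, C', \<rho>2) = z" using z C'(1,2) by (simp only: case_prod_conv)
        show "(Min C, \<rho>1, C', \<rho>2) \<in> ?A" using C'(3,4) \<open>Min C \<in> X\<close> by simp
      qed
    qed
    show ?thesis
    proof (rule sum.reindex_bij_witness[where i = ?i and j = ?j])
      fix z assume "z \<in> open_nc_parts (Suc k) u X"
      from surj[OF this] obtain y where y: "y \<in> ?A" "?j y = z" by (rule bexE)
      have iz: "?i z = y" using ij[OF y(1)] unfolding y(2) .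
      show "?i z \<in> ?A" unfolding iz by (rule y(1))
      show "?j (?i z) = z" unfolding iz by (rule y(2))
    next
      fix z assume z': "z \<in> ?A"
      show "?i (?j z) = z" using z' by (rule ij)
      show "?j z \<in> open_nc_parts (Suc k) u X" using z' by (rule j)
      obtain v \<rho>1 C' \<rho>2 where z: "z = (v, \<rho>1, C', \<rho>2)" by (cases z) auto
      with z' have *: "partition_on (?lo v) \<rho>1" "partition_on (?hi v - C') \<rho>2"
        by (auto simp: open_nc_parts_def nc_parts_def)
      show "(case ?j z of (C, \<rho>) \<Rightarrow> partition_weight \<kappa> \<rho>)
          = (case z of (v, \<rho>1, C', \<rho>2) \<Rightarrow> partition_weight \<kappa> \<rho>1 * partition_weight \<kappa> \<rho>2)"
        using partition_weight_Un[OF *] z fin by (auto simp: disjoint_iff)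
    qed
  qed
  also have "\<dots> = open_nc_kernel \<kappa> (Suc k) u X"
    unfolding open_nc_kernel_def by (rule if_P[OF True, symmetric])
  finally show ?thesis ..
qed

text \<open>All other labels must lie above the first label of the chain, which is therefore the
  minimum.\<close>

lemma unit_kconv_open_nc:
  assumes "finite X" "X \<noteq> {}"
  shows "(\<delta> \<odot> open_nc_kernel \<kappa> k) s X = (if s < Min X then open_nc_kernel \<kappa> k (Min X) (X - {Min X}) else 0)"
proof -
  have 0: "open_nc_kernel \<kappa> k u (X - {u}) = 0" if "u \<in> X" "u \<noteq> Min X" for u
  proof -
    have "Min X \<in> X - {u}" "\<not> u < Min X" using that assms Min_le[OF assms(1), of u] by auto
    then show ?thesis unfolding open_nc_kernel_def by (intro if_not_P) blast
  qed
  show ?thesis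
  proof (cases "s < Min X")
    case True
    have "(\<delta> \<odot> open_nc_kernel \<kappa> k) s X = (\<Sum>u\<in>{Min X}. open_nc_kernel \<kappa> k u (X - {u}))"
      unfolding unit_kconv[OF assms(1)]
      by (rule sum.mono_neutral_right) (use True assms 0 in auto)
    with True show ?thesis by simp
  next
    case False
    have "(\<delta> \<odot> open_nc_kernel \<kappa> k) s X = 0"
      unfolding unit_kconv[OF assms(1)]
      by (rule sum.neutral) (use False 0 in auto)
    with False show ?thesis by simp
  qed
qed

lemma nc_parts_by_first_block:
  fixes \<kappa> :: "nat \<Rightarrow> 'a::comm_ring_1"
  assumes fin: "finite X" and u: "u \<in> X" and N: "card X \<le> N"
  shows "(\<Sum>\<rho>\<in>nc_parts X. partition_weight \<kappa> \<rho>)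
      = (\<Sum>k<N. \<kappa> (Suc k) * (\<Sum>(C, \<rho>)\<in>open_nc_parts k u (X - {u}). partition_weight \<kappa> \<rho>))"
proof -
  let ?sum = "\<Sum>k<N. \<kappa> (Suc k) * (\<Sum>(C, \<rho>)\<in>open_nc_parts k u (X - {u}). partition_weight \<kappa> \<rho>)"
  let ?A = "SIGMA k:{..<N}. open_nc_parts k u (X - {u})"
  let ?B = "\<lambda>\<rho>. THE B. B \<in> \<rho> \<and> u \<in> B"
  let ?i = "\<lambda>\<rho>. (card (?B \<rho>) - 1, ?B \<rho> - {u}, \<rho> - {?B \<rho>})"
  let ?j = "\<lambda>(k, C, \<rho>). insert (insert u C) \<rho>"
  have "?sum
      = (\<Sum>(k, C, \<rho>)\<in>?A. \<kappa> (Suc k) * partition_weight \<kappa> \<rho>)"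
  proof -
    have "?sum
        = (\<Sum>k<N. \<Sum>(C, \<rho>)\<in>open_nc_parts k u (X - {u}). \<kappa> (Suc k) * partition_weight \<kappa> \<rho>)"
      by (simp add: sum_distrib_left case_prod_beta)
    also have "\<dots> = (\<Sum>(k, C, \<rho>)\<in>?A. \<kappa> (Suc k) * partition_weight \<kappa> \<rho>)"
      by (rule sum.Sigma) (use fin in auto)
    finally show ?thesis .
  qed
  also have "\<dots> = (\<Sum>\<rho>\<in>nc_parts X. partition_weight \<kappa> \<rho>)"
  proof (rule sum.reindex_bij_witness[where i = ?i and j = ?j])
    fix z assume z: "z \<in> ?A"
    obtain k C \<rho> where zk: "z = (k, C, \<rho>)" by (cases z) auto
    with z have C: "C \<subseteq> X - {u}" "card C = k" "\<rho> \<in> nc_parts (X - {u} - C)" 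
      "\<And>B. B \<in> \<rho> \<Longrightarrow> \<not> crossing (insert u C) B"
      by (auto simp: open_nc_parts_def)
    have "X - {u} - C = X - insert u C" by auto
    with C(3) have p: "partition_on (X - insert u C) \<rho>" and nc: "\<And>A B. A \<in> \<rho> \<Longrightarrow> B \<in> \<rho> \<Longrightarrow> A \<noteq> B \<Longrightarrow> \<not> crossing A B"
      by (auto simp: nc_parts_def)
    have ins: "partition_on X (insert (insert u C) \<rho>)" "insert u C \<notin> \<rho>"
      using partition_on_insert_block[OF p] u C(1) by auto
    have the: "?B (insert (insert u C) \<rho>) = insert u C"
      using p by (intro the_equality) (auto simp: partition_on_def)
    have "finite C" using C(1) fin by (auto intro: finite_subset[of C X])
    have cardC: "card (insert u C) = Suc k"
      using C(1,2) \<open>finite C\<close> by (subst card_insert_disjoint) auto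
    have "insert u C - {u} = C" using C(1) by auto
    then show "?i (?j z) = z"
      unfolding zk case_prod_conv the using cardC ins(2) by simp
    have "\<not> crossing A B" if "A \<in> insert (insert u C) \<rho>" "B \<in> insert (insert u C) \<rho>" "A \<noteq> B" for A B
      using that nc C(4) crossing_sym[of A "insert u C"] by auto
    then show "?j z \<in> nc_parts X"
      unfolding zk case_prod_conv nc_parts_def using ins(1) by simp
    have "finite \<rho>" using p fin finite_elements by blast
    then show "partition_weight \<kappa> (?j z) = (case z of (k, C, \<rho>) \<Rightarrow> \<kappa> (Suc k) * partition_weight \<kappa> \<rho>)"
      unfolding zk case_prod_conv partition_weight_def using ins(2) cardC by simp
  next
    fix \<rho> assume \<rho>: "\<rho> \<in> nc_parts X"
    then have p: "partition_on X \<rho>" and nc: "\<And>A B. A \<in> \<rho> \<Longrightarrow> B \<in> \<rho> \<Longrightarrow> A \<noteq> B \<Longrightarrow> \<not> crossing A B"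
      by (auto simp: nc_parts_def)
    have "\<exists>!B. B \<in> \<rho> \<and> u \<in> B"
      using u partition_onD1[OF p] partition_onD2[OF p] by (auto simp: disjoint_def)
    from theI'[OF this] obtain B where B: "?B \<rho> = B" "B \<in> \<rho>" "u \<in> B" by blast
    have BX: "B \<subseteq> X" using B(2) p by (auto simp: partition_on_def)
    then have "finite B" using fin finite_subset by blast
    then have c: "card B = Suc (card (B - {u}))" using B(3) by (rule card.remove)
    have iu: "insert u (B - {u}) = B" using B(3) by auto
    show "?j (?i \<rho>) = \<rho>" unfolding B(1) case_prod_conv iu using B(2) by auto
    have X: "X - {u} - (B - {u}) = X - B" using B(3) by auto
    have "card B \<le> N" using card_mono[OF fin BX] N by simp
    moreover have "\<rho> - {B} \<in> nc_parts (X - B)"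
      using partition_on_remove_block[OF p B(2)] nc by (auto simp: nc_parts_def)
    moreover have "\<forall>B'\<in>\<rho> - {B}. \<not> crossing B B'" using nc B(2) by auto
    ultimately show "?i \<rho> \<in> ?A"
      unfolding B(1) open_nc_parts_def using c X iu BX by auto
  qed
  finally show ?thesis ..
qed

text \<open>The block of the least label is opened; the index \<open>k\<close> counts its other elements.\<close>

lemma nc_kernel_peel:
  assumes fin: "finite X" and N: "card X \<le> N"
  shows "nc_kernel \<kappa> s X = \<delta> s X + (\<Sum>k<N. \<kappa> (Suc k) * (\<delta> \<odot> open_nc_kernel \<kappa> k) s X)"
proof (cases "X = {}")
  case True
  then show ?thesis by (simp add: nc_kernel_def unit_kernel_def partition_weight_def)
next
  case False
  have lt: "(\<forall>x\<in>X. s < x) \<longleftrightarrow> s < Min X" using fin False by simp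
  have u: "Min X \<in> X" using fin False by simp
  have "\<forall>x\<in>X - {Min X}. Min X < x" using fin by (auto simp: le_less[symmetric] order_less_le)
  then have "open_nc_kernel \<kappa> k (Min X) (X - {Min X})
      = (\<Sum>(C, \<rho>)\<in>open_nc_parts k (Min X) (X - {Min X}). partition_weight \<kappa> \<rho>)" for k
    unfolding open_nc_kernel_def by (rule if_P)
  then show ?thesis
    unfolding unit_kconv_open_nc[OF fin False] nc_kernel_def lt nc_parts_by_first_block[OF fin u N]
    using False by (simp add: unit_kernel_def)
qed

section \<open>The recursion of the moments\<close>

text \<open>The coefficients of \<open>m(x) * (x * m(x)) ^ k\<close>.\<close>

fun shift_pow :: "(nat \<Rightarrow> 'a::comm_ring_1) \<Rightarrow> nat \<Rightarrow> nat \<Rightarrow> 'a" where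
  "shift_pow m 0 = m"
| "shift_pow m (Suc k) = shift_conv m (shift_pow m k)"

lemma kernel_pow_seq_kernel:
  assumes "finite S"
  shows "kernel_pow (seq_kernel v m) k s S = seq_kernel v (shift_pow m k) s S"
  using assms
proof (induction k arbitrary: s S)
  case (Suc k)
  have "(seq_kernel v m \<odot> kernel_pow (seq_kernel v m) k) s S = (seq_kernel v m \<odot> seq_kernel v (shift_pow m k)) s S"
    using Suc by (intro kconv_cong) auto
  then show ?case using Suc.prems by (simp add: seq_kernel_kconv)
qed simp

text \<open>The coefficients of the constant generating function \<open>1\<close>.\<close>

definition seq_unit :: "nat \<Rightarrow> 'a::comm_ring_1" where
  "seq_unit n = (if n = 0 then 1 else 0)"

lemma seq_kernel_unit:
  fixes v :: "nat set \<Rightarrow> 'a::comm_ring_1"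
  assumes "finite S"
  shows "seq_kernel v seq_unit s S = exp_kernel v s S"
proof -
  have "seq_kernel v seq_unit s S = (\<Sum>A\<in>{{}}. seq_unit (card A) * exp_kernel v s (S - A))"
    unfolding seq_kernel_def
  proof (rule sum.mono_neutral_right)
    have "card A \<noteq> 0" if "A \<subseteq> {x \<in> S. s < x}" "A \<noteq> {}" for A
    proof -
      have "finite A" by (rule finite_subset[OF _ assms]) (use that in auto)
      then show ?thesis using that by simp
    qed
    then have "seq_unit (card A) = (0 :: 'a)" if "A \<in> Pow {x \<in> S. s < x} - {{}}" for A
      unfolding seq_unit_def using that by (intro if_not_P) blast
    then show "\<forall>A\<in>Pow {x \<in> S. s < x} - {{}}. seq_unit (card A) * exp_kernel v s (S - A) = 0"
      by simp
  qed (use assms in auto)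
  then show ?thesis by (simp add: seq_unit_def)
qed

lemma exp_kernel_zero: "finite S \<Longrightarrow> exp_kernel (\<lambda>_. 0) s S = \<delta> s S"
  unfolding exp_kernel_def unit_kernel_def by (auto intro: partition_sum_zero simp: top_weight_def)

lemma seq_kernel_zero:
  assumes "finite S"
  shows "seq_kernel (\<lambda>_. 0) a s S = (if \<forall>x\<in>S. s < x then a (card S) else 0)"
proof -
  have "seq_kernel (\<lambda>_. 0) a s S = (\<Sum>A\<in>Pow {x\<in>S. s < x}. if A = S then a (card S) else 0)"
    unfolding seq_kernel_def using assms by (intro sum.cong refl) (auto simp: exp_kernel_zero unit_kernel_def)
  also have "\<dots> = (if S \<in> Pow {x\<in>S. s < x} then a (card S) else 0)"
    using assms by (simp add: sum.delta)
  finally show ?thesis by (auto simp: subset_iff)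
qed

definition nc_moment :: "(nat \<Rightarrow> 'a::comm_ring_1) \<Rightarrow> nat \<Rightarrow> 'a" where
  "nc_moment \<kappa> n = (\<Sum>\<rho>\<in>nc_parts {1..n}. partition_weight \<kappa> \<rho>)"

lemma open_nc_kernel_eq_kernel_pow:
  assumes "finite X"
  shows "open_nc_kernel \<kappa> k u X = kernel_pow (nc_kernel \<kappa>) k u X"
  using assms
proof (induction k arbitrary: u X)
  case 0
  then show ?case by (simp add: open_nc_kernel_0)
next
  case (Suc k)
  have "(nc_kernel \<kappa> \<odot> open_nc_kernel \<kappa> k) u X = (nc_kernel \<kappa> \<odot> kernel_pow (nc_kernel \<kappa>) k) u X"
    using Suc by (intro kconv_cong) auto
  then show ?case using Suc.prems by (simp add: open_nc_kernel_Suc)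
qed

lemma seq_kernel_sum: "seq_kernel v (\<lambda>n. \<Sum>k\<in>I. c k * b k n) s S = (\<Sum>k\<in>I. c k * seq_kernel v (b k) s S)"
  unfolding seq_kernel_def sum_distrib_left sum_distrib_right mult.assoc by (rule sum.swap)

text \<open>The gaps of the open block are smaller sets, so by induction their contribution depends on
  their number of elements only, and then the same formula applies to every set with as many
  elements as \<open>X\<close>. Comparing \<open>X\<close> with the interval \<open>{1..card X}\<close> identifies its value as the
  moment.\<close>

lemma nc_kernel_and_moment_recursion:
  fixes \<kappa> :: "nat \<Rightarrow> 'a::comm_ring_1"
  assumes "finite X"
  shows "nc_kernel \<kappa> s X = seq_kernel (\<lambda>_. 0) (nc_moment \<kappa>) s X
    \<and> (\<forall>N\<ge>card X. nc_moment \<kappa> (card X)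
       = (seq_unit (card X) + (\<Sum>k<N. \<kappa> (Suc k) * shift_conv seq_unit (shift_pow (nc_moment \<kappa>) k) (card X))))"
  using assms
proof (induction "card X" arbitrary: s X rule: less_induct)
  case less
  let ?m = "nc_moment \<kappa>" and ?K = "seq_kernel (\<lambda>_. 0) (nc_moment \<kappa>)"
  define F where "F N n = (\<Sum>k<N. \<kappa> (Suc k) * shift_conv seq_unit (shift_pow ?m k) n)" for N n
  have IH: "nc_kernel \<kappa> s R = ?K s R" if "finite R" "card R < card X" for s R
    using less(1)[of R s] that by simp
  have *: "nc_kernel \<kappa> s Y = (if \<forall>y\<in>Y. s < y then seq_unit (card X) + F N (card X) else 0)"
    if Y: "finite Y" "card Y = card X" and N: "card X \<le> N" for s Y N
  proof -
    have "(\<delta> \<odot> open_nc_kernel \<kappa> k) s Y = seq_kernel (\<lambda>_. 0) (shift_conv seq_unit (shift_pow ?m k)) s Y" for k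
    proof -
      have "(\<delta> \<odot> open_nc_kernel \<kappa> k) s Y = (seq_kernel (\<lambda>_. 0) seq_unit \<odot> seq_kernel (\<lambda>_. 0) (shift_pow ?m k)) s Y"
      proof (rule kconv_cong)
        fix R u assume s: "(R, u) \<in> splits s Y"
        note c = splits_card[OF Y(1) s]
        show "\<delta> s R = seq_kernel (\<lambda>_. 0) seq_unit s R" using c(3) by (simp add: seq_kernel_unit exp_kernel_zero)
        have fin: "finite (Y - R - {u})" using Y by simp
        have "open_nc_kernel \<kappa> k u (Y - R - {u}) = kernel_pow (nc_kernel \<kappa>) k u (Y - R - {u})"
          by (rule open_nc_kernel_eq_kernel_pow[OF fin])
        also have "\<dots> = kernel_pow ?K k u (Y - R - {u})"
        proof (rule kernel_pow_cong[OF fin], rule IH)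
          fix Q assume Q: "Q \<subseteq> Y - R - {u}"
          then show "finite Q" using fin finite_subset by blast
          show "card Q < card X" using card_mono[OF fin Q] c(2) Y(2) by simp
        qed
        also have "\<dots> = seq_kernel (\<lambda>_. 0) (shift_pow ?m k) u (Y - R - {u})"
          by (rule kernel_pow_seq_kernel[OF fin])
        finally show "open_nc_kernel \<kappa> k u (Y - R - {u}) = seq_kernel (\<lambda>_. 0) (shift_pow ?m k) u (Y - R - {u})" .
      qed
      also have "\<dots> = seq_kernel (\<lambda>_. 0) (shift_conv seq_unit (shift_pow ?m k)) s Y"
        by (rule seq_kernel_kconv[OF Y(1)])
      finally show ?thesis .
    qed
    then have "nc_kernel \<kappa> s Y = \<delta> s Y + seq_kernel (\<lambda>_. 0) (F N) s Y"
      using nc_kernel_peel[OF Y(1), of N \<kappa> s] Y N unfolding F_def seq_kernel_sum by simp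
    then show ?thesis
      using Y by (auto simp: seq_kernel_zero unit_kernel_def seq_unit_def)
  qed
  have "?m (card X) = nc_kernel \<kappa> 0 {1..card X}"
    by (simp add: nc_moment_def nc_kernel_def)
  then have m: "?m (card X) = seq_unit (card X) + F N (card X)" if "card X \<le> N" for N
    using *[of "{1..card X}" N 0] that by simp
  have "nc_kernel \<kappa> s X = ?K s X"
    using *[OF less(2) refl order.refl, of s] m[OF order.refl] less(2) by (simp add: seq_kernel_zero)
  then show ?case using m unfolding F_def by blast
qed

text \<open>In generating functions this is \<open>m(x) = 1 + (\<Sum>k. \<kappa> (k + 1) * (x * m(x)) ^ (k + 1))\<close>. The
  terms with \<open>k \<ge> n\<close> vanish, which is why any sufficiently large \<open>N\<close> will do.\<close>

lemma nc_moment_recursion: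
  assumes "n \<le> N"
  shows "nc_moment \<kappa> n = seq_unit n + (\<Sum>k<N. \<kappa> (Suc k) * shift_conv seq_unit (shift_pow (nc_moment \<kappa>) k) n)"
  using nc_kernel_and_moment_recursion[of "{1..n}" \<kappa> 0] assms by simp

lemma seq_kernel_add: "seq_kernel v (\<lambda>n. a n + b n) s S = seq_kernel v a s S + seq_kernel v b s S"
  by (simp add: seq_kernel_def distrib_right sum.distrib)

text \<open>Write \<open>M\<close> for the moments shuffled with the exponential \<open>E\<close> and \<open>G\<close> for the sum of the
  powers of \<open>M\<close> with coefficients \<open>\<kappa> (k + 1)\<close>. The recursion of the moments, multiplied by \<open>E\<close>,
  reads \<open>M = E + E \<odot> G\<close>, and \<open>E = \<delta> + v \<odot> E\<close> turns this into \<open>M = \<delta> + v \<odot> M + \<delta> \<odot> G\<close>.\<close>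

lemma seq_kernel_nc_moment_eqn:
  fixes \<kappa> :: "nat \<Rightarrow> 'a::comm_ring_1" and v :: "nat set \<Rightarrow> 'a"
  assumes fin: "finite S" and N: "card S \<le> N"
  defines "M \<equiv> seq_kernel v (nc_moment \<kappa>)"
  shows "M s S = \<delta> s S + ((\<lambda>_. v) \<odot> M) s S + (\<Sum>k<N. \<kappa> (Suc k) * (\<delta> \<odot> kernel_pow M k) s S)"
proof -
  let ?m = "nc_moment \<kappa>"
  define G where "G s S = (\<Sum>k<N. \<kappa> (Suc k) * kernel_pow M k s S)" for s S
  have M: "M s S = exp_kernel v s S + (exp_kernel v \<odot> G) s S" if S: "finite S" "card S \<le> N" for s S
  proof -
    have eq: "seq_kernel v (shift_conv seq_unit (shift_pow ?m k)) s S = (exp_kernel v \<odot> kernel_pow M k) s S" for k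
      unfolding seq_kernel_kconv[OF S(1), symmetric] M_def
    proof (rule kconv_cong)
      fix R u assume "(R, u) \<in> splits s S"
      then show "seq_kernel v seq_unit s R = exp_kernel v s R" using splits_card[OF S(1)] seq_kernel_unit by blast
      show "seq_kernel v (shift_pow ?m k) u (S - R - {u}) = kernel_pow (seq_kernel v ?m) k u (S - R - {u})"
        using S(1) by (intro kernel_pow_seq_kernel[symmetric]) simp
    qed
    have "M s S = seq_kernel v (\<lambda>n. seq_unit n + (\<Sum>k<N. \<kappa> (Suc k) * shift_conv seq_unit (shift_pow ?m k) n)) s S"
      unfolding M_def seq_kernel_def
    proof (intro sum.cong refl arg_cong2[where f="(*)"] nc_moment_recursion)
      fix A assume "A \<in> Pow {x \<in> S. s < x}"
      then have "card A \<le> card S" using S(1) by (intro card_mono) auto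
      then show "card A \<le> N" using S(2) by simp
    qed
    also have "\<dots> = seq_kernel v seq_unit s S + (\<Sum>k<N. \<kappa> (Suc k) * seq_kernel v (shift_conv seq_unit (shift_pow ?m k)) s S)"
      unfolding seq_kernel_add seq_kernel_sum ..
    finally show ?thesis unfolding eq G_def kconv_sum_right kconv_scale_right seq_kernel_unit[OF S(1)] .
  qed
  have "(exp_kernel v \<odot> G) s S = ((\<lambda>s S. \<delta> s S + ((\<lambda>_. v) \<odot> exp_kernel v) s S) \<odot> G) s S"
    by (rule kconv_cong) (use splits_card[OF fin] exp_kernel_peel in blast)+
  also have "\<dots> = (\<delta> \<odot> G) s S + ((\<lambda>_. v) \<odot> (exp_kernel v \<odot> G)) s S"
    by (simp add: kconv_add_left kconv_assoc fin)
  finally have "M s S = \<delta> s S + (((\<lambda>_. v) \<odot> exp_kernel v) s S + ((\<lambda>_. v) \<odot> (exp_kernel v \<odot> G)) s S) + (\<delta> \<odot> G) s S"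
    using M[OF fin N, of s] exp_kernel_peel[OF fin, of v s] by simp
  also have "((\<lambda>_. v) \<odot> exp_kernel v) s S + ((\<lambda>_. v) \<odot> (exp_kernel v \<odot> G)) s S = ((\<lambda>_. v) \<odot> M) s S"
    unfolding kconv_add_right[symmetric]
  proof (rule kconv_cong)
    fix R u assume "(R, u) \<in> splits s S"
    from splits_card(2)[OF fin this] N fin
    show "exp_kernel v u (S - R - {u}) + (exp_kernel v \<odot> G) u (S - R - {u}) = M u (S - R - {u})"
      by (intro M[symmetric]) auto
  qed simp
  finally show ?thesis unfolding G_def kconv_sum_right kconv_scale_right .
qed

section \<open>Hook trees\<close>

text \<open>The inorder traversal of the tree is the permutation. The right spine holds the visible
  points; \<open>s\<close> is the label of the preceding visible point. A nonempty left subtree is the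
  configuration below a hook that ends at the root and starts at the preceding point; that this
  point is a descent means that the first label of the subtree is at most \<open>s\<close>. The subtree itself
  starts with \<open>s = 0\<close>: since labels are positive, this forces the left subtree of its root to be
  empty, which says that its first point is visible and blue. The root is then also first in the
  inorder traversal, hence \<open>value l\<close> is that first label.\<close>

fun hook_tree :: "nat \<Rightarrow> nat tree \<Rightarrow> bool" where
  "hook_tree s Leaf = True"
| "hook_tree s (Node l v r) \<longleftrightarrow> s < v \<and> hook_tree 0 l \<and> (\<forall>x\<in>set_tree l. x < v) \<and>
     (l = Leaf \<or> value l \<le> s) \<and> hook_tree v r"

definition hook_trees :: "nat \<Rightarrow> nat set \<Rightarrow> nat tree set" where
  "hook_trees s S = {t. hook_tree s t \<and> set_tree t = S \<and> distinct (inorder t)}"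

text \<open>The number of blue points. The sky adds one to the size of the blue block.\<close>

fun blue_count :: "'b tree \<Rightarrow> nat" where
  "blue_count Leaf = 0"
| "blue_count (Node l v r) = (if l = Leaf then Suc (blue_count r) else blue_count r)"

text \<open>The weight of all blocks but the blue one. The block of a hook has one more element than
  there are blue points below the hook, namely the northeast endpoint.\<close>

fun hook_weight :: "(nat \<Rightarrow> 'a::comm_ring_1) \<Rightarrow> 'b tree \<Rightarrow> 'a" where
  "hook_weight w Leaf = 1"
| "hook_weight w (Node l v r) =
     hook_weight w r * (if l = Leaf then 1 else hook_weight w l * w (Suc (blue_count l)))"

definition total_weight :: "(nat \<Rightarrow> 'a::comm_ring_1) \<Rightarrow> 'b tree \<Rightarrow> 'a" where
  "total_weight w t = hook_weight w t * w (Suc (blue_count t))"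

text \<open>The nonempty configurations that may stand below a hook starting at a point with label \<open>s\<close>.\<close>

definition hook_children :: "nat \<Rightarrow> nat set \<Rightarrow> nat tree set" where
  "hook_children s R = {l \<in> hook_trees 0 R. l \<noteq> Leaf \<and> value l \<le> s}"

lemma Leaf_in_hook_trees [simp]: "Leaf \<in> hook_trees s S \<longleftrightarrow> S = {}"
  by (auto simp: hook_trees_def)

lemma hook_trees_empty [simp]: "hook_trees s {} = {Leaf}"
  by (auto simp: hook_trees_def)

lemma hook_tree_greater: "hook_tree s t \<Longrightarrow> t \<noteq> Leaf \<Longrightarrow> s < value t"
  by (cases t) auto

lemma Node_in_hook_trees:
  "Node l u r \<in> hook_trees s S \<longleftrightarrow>
     (set_tree l, u) \<in> splits s S \<and> (l = Leaf \<or> l \<in> hook_children s (set_tree l)) \<and>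
     r \<in> hook_trees u (S - set_tree l - {u})"
proof
  assume "Node l u r \<in> hook_trees s S"
  then show "(set_tree l, u) \<in> splits s S \<and> (l = Leaf \<or> l \<in> hook_children s (set_tree l)) \<and>
     r \<in> hook_trees u (S - set_tree l - {u})"
    by (auto simp: hook_trees_def splits_def hook_children_def)
next
  assume "(set_tree l, u) \<in> splits s S \<and> (l = Leaf \<or> l \<in> hook_children s (set_tree l)) \<and>
     r \<in> hook_trees u (S - set_tree l - {u})"
  then show "Node l u r \<in> hook_trees s S"
    by (auto simp: hook_trees_def splits_def hook_children_def)
qed

lemma hook_trees_decomp:
  assumes "S \<noteq> {}"
  shows "hook_trees s S = (\<lambda>((R, u), l, r). Node l u r) `
    (SIGMA (R, u):splits s S. ((if R = {} then {Leaf} else {}) \<union> hook_children s R) \<times> hook_trees u (S - R - {u}))"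
    (is "_ = ?f ` ?A")
proof (intro equalityI subsetI)
  fix t assume t: "t \<in> hook_trees s S"
  then obtain l u r where "t = Node l u r" using assms by (cases t) auto
  with t show "t \<in> ?f ` ?A"
    unfolding Node_in_hook_trees by (intro image_eqI[of _ _ "((set_tree l, u), l, r)"]) (auto simp: Node_in_hook_trees)
next
  fix t assume "t \<in> ?f ` ?A"
  then obtain R u l r where t: "t = Node l u r" "(R, u) \<in> splits s S" "l \<in> (if R = {} then {Leaf} else {}) \<union> hook_children s R"
    "r \<in> hook_trees u (S - R - {u})"
    by auto
  then have "R = set_tree l" by (auto simp: hook_children_def hook_trees_def split: if_splits)
  with t show "t \<in> hook_trees s S" by (auto simp: Node_in_hook_trees split: if_splits)
qed

lemma finite_hook_trees [simp]:
  assumes "finite S"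
  shows "finite (hook_trees s S)"
  using assms
proof (induction "card S" arbitrary: s S rule: less_induct)
  case less
  show ?case
  proof (cases "S = {}")
    case False
    let ?T = "\<lambda>(R, u). ((if R = {} then {Leaf} else {}) \<union> hook_children s R) \<times> hook_trees u (S - R - {u})"
    have "finite (Sigma (splits s S) ?T)"
    proof (rule finite_SigmaI)
      show "finite (splits s S)" using less.prems by simp
      fix z assume z: "z \<in> splits s S"
      obtain R u where zz: "z = (R, u)" by (cases z)
      note c = splits_card[OF less.prems z[unfolded zz]]
      have "finite (hook_trees 0 R)" "finite (hook_trees u (S - R - {u}))"
        using less c by auto
      then show "finite (?T z)"
        unfolding zz hook_children_def by simp
    qed
    then show ?thesis unfolding hook_trees_decomp[OF False] by (rule finite_imageI)
  qed simp
qed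

lemma finite_hook_children [simp]: "finite R \<Longrightarrow> finite (hook_children s R)"
  by (simp add: hook_children_def)

lemma sum_hook_trees:
  assumes "finite S"
  shows "(\<Sum>t\<in>hook_trees s S. \<phi> t) = (if S = {} then \<phi> Leaf else 0)
    + (\<Sum>u\<in>{u\<in>S. s < u}. \<Sum>r\<in>hook_trees u (S - {u}). \<phi> (Node Leaf u r))
    + (\<Sum>(R, u)\<in>splits s S. \<Sum>l\<in>hook_children s R. \<Sum>r\<in>hook_trees u (S - R - {u}). (\<phi> (Node l u r) :: 'a::comm_ring_1))"
proof (cases "S = {}")
  case True
  then show ?thesis by (simp add: splits_def)
next
  case False
  let ?L = "\<lambda>R. if R = {} then {Leaf} else ({} :: nat tree set)"
  let ?T = "SIGMA (R, u):splits s S. (?L R \<union> hook_children s R) \<times> hook_trees u (S - R - {u})"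
  have fin: "finite R" if "(R, u) \<in> splits s S" for R u
    using splits_card(3)[OF assms that] .
  have set_l: "set_tree l = R" if "l \<in> ?L R \<union> hook_children s R" for l R
    using that by (auto simp: hook_children_def hook_trees_def split: if_splits)
  have dis: "?L R \<inter> hook_children s R = {}" for R by (auto simp: hook_children_def)
  have "(\<Sum>t\<in>hook_trees s S. \<phi> t) = (\<Sum>((R, u), l, r)\<in>?T. \<phi> (Node l u r))"
    unfolding hook_trees_decomp[OF False]
  proof (subst sum.reindex)
    show "inj_on (\<lambda>((R, u), l, r). Node l u r) ?T"
    proof (rule inj_onI)
      fix x y
      assume x: "x \<in> ?T"
        and y: "y \<in> ?T"
        and eq: "(\<lambda>((R, u), l, r). Node l u r) x = (\<lambda>((R, u), l, r). Node l u r) y"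
      obtain R u l r where xx: "x = ((R, u), l, r)" by (cases x) auto
      obtain R' u' l' r' where yy: "y = ((R', u'), l', r')" by (cases y) auto
      have "l \<in> ?L R \<union> hook_children s R" using x unfolding xx by simp
      moreover have "l' \<in> ?L R' \<union> hook_children s R'" using y unfolding yy by simp
      moreover have "l = l'" "u = u'" "r = r'" using eq unfolding xx yy by simp_all
      ultimately show "x = y" using set_l[of l R] set_l[of l' R'] unfolding xx yy by simp
    qed
  qed (simp add: case_prod_beta)
  also have "\<dots> = (\<Sum>(R, u)\<in>splits s S. \<Sum>(l, r)\<in>(?L R \<union> hook_children s R) \<times> hook_trees u (S - R - {u}). \<phi> (Node l u r))"
  proof -
    have "\<forall>z\<in>splits s S. finite ((?L (fst z) \<union> hook_children s (fst z)) \<times> hook_trees (snd z) (S - fst z - {snd z}))"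
      using fin assms by (auto intro!: finite_cartesian_product)
    from sum.Sigma[OF finite_splits[OF assms] this, of "\<lambda>z y. \<phi> (Node (fst y) (snd z) (snd y))", symmetric]
    show ?thesis by (simp only: case_prod_unfold)
  qed
  also have "\<dots> = (\<Sum>(R, u)\<in>splits s S. \<Sum>l\<in>?L R \<union> hook_children s R. \<Sum>r\<in>hook_trees u (S - R - {u}). \<phi> (Node l u r))"
    by (simp add: sum.cartesian_product)
  also have "\<dots> = (\<Sum>(R, u)\<in>splits s S. (\<Sum>l\<in>?L R. \<Sum>r\<in>hook_trees u (S - R - {u}). \<phi> (Node l u r))
       + (\<Sum>l\<in>hook_children s R. \<Sum>r\<in>hook_trees u (S - R - {u}). \<phi> (Node l u r)))"
    by (intro sum.cong refl, clarify, rule sum.union_disjoint) (use fin dis in auto)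
  also have "\<dots> = (\<Sum>(R, u)\<in>splits s S. \<delta> s R * (\<Sum>r\<in>hook_trees u (S - R - {u}). \<phi> (Node Leaf u r)))
       + (\<Sum>(R, u)\<in>splits s S. \<Sum>l\<in>hook_children s R. \<Sum>r\<in>hook_trees u (S - R - {u}). \<phi> (Node l u r))"
    unfolding case_prod_beta sum.distrib
    by (intro arg_cong2[where f="(+)"] refl sum.cong) (auto simp: unit_kernel_def)
  also have "(\<Sum>(R, u)\<in>splits s S. \<delta> s R * (\<Sum>r\<in>hook_trees u (S - R - {u}). \<phi> (Node Leaf u r)))
     = (\<Sum>u\<in>{u\<in>S. s < u}. \<Sum>r\<in>hook_trees u (S - {u}). \<phi> (Node Leaf u r))"
    using unit_kconv[OF assms, of "\<lambda>u S. \<Sum>r\<in>hook_trees u S. \<phi> (Node Leaf u r)" s]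
    by (simp add: kconv_def)
  finally show ?thesis using False by simp
qed

definition tree_sum :: "(nat \<Rightarrow> 'a::comm_ring_1) \<Rightarrow> nat set \<Rightarrow> 'a" where
  "tree_sum w S = (\<Sum>t\<in>hook_trees 0 S. total_weight w t)"

definition high_tree_sum :: "(nat \<Rightarrow> 'a::comm_ring_1) \<Rightarrow> 'a kernel" where
  "high_tree_sum w s S = (\<Sum>t\<in>{t \<in> hook_trees 0 S. t = Leaf \<or> s < value t}. total_weight w t)"

text \<open>The sum over continuations, from the label \<open>s\<close> on, with exactly \<open>j\<close> blue visible points; the
  weight of the blue block, whose size depends on the whole chain, is left out.\<close>

definition chain_sum :: "(nat \<Rightarrow> 'a::comm_ring_1) \<Rightarrow> nat \<Rightarrow> 'a kernel" where
  "chain_sum w j s S = (\<Sum>t\<in>hook_trees s S. if blue_count t = j then hook_weight w t else 0)"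

text \<open>The descent condition at the start of a hook enters only through this difference.\<close>

lemma tree_sum_diff:
  assumes "finite R"
  shows "tree_sum w R - high_tree_sum w s R = (\<Sum>l\<in>hook_children s R. total_weight w l)"
proof -
  have "hook_trees 0 R = {t \<in> hook_trees 0 R. t = Leaf \<or> s < value t} \<union> hook_children s R"
    by (auto simp: hook_children_def)
  then have "tree_sum w R = (\<Sum>t\<in>{t \<in> hook_trees 0 R. t = Leaf \<or> s < value t} \<union> hook_children s R. total_weight w t)"
    unfolding tree_sum_def by simp
  also have "\<dots> = high_tree_sum w s R + (\<Sum>l\<in>hook_children s R. total_weight w l)"
    unfolding high_tree_sum_def
    by (rule sum.union_disjoint) (use assms in \<open>auto simp: hook_children_def\<close>)
  finally show ?thesis by simp
qed

text \<open>The root of a tree with threshold \<open>0\<close> is positive.\<close>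

lemma high_tree_sum_0: "high_tree_sum w 0 S = tree_sum w S"
proof -
  have "t = Leaf \<or> 0 < value t" if "t \<in> hook_trees 0 S" for t
  proof (cases "t = Leaf")
    case False
    have "hook_tree 0 t" using that by (simp add: hook_trees_def)
    from hook_tree_greater[OF this False] show ?thesis by simp
  qed simp
  then have "{t \<in> hook_trees 0 S. t = Leaf \<or> 0 < value t} = hook_trees 0 S"
    by (intro set_eqI iffI CollectI conjI) (simp_all only: mem_Collect_eq)
  then show ?thesis by (simp only: tree_sum_def high_tree_sum_def)
qed

lemma chain_sum_hooks:
  assumes "finite S"
  shows "(\<Sum>(R, u)\<in>splits s S. \<Sum>l\<in>hook_children s R. \<Sum>r\<in>hook_trees u (S - R - {u}).
      if blue_count (Node l u r) = j then hook_weight w (Node l u r) else 0)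
    = ((\<lambda>s R. tree_sum w R - high_tree_sum w s R) \<odot> chain_sum w j) s S"
  unfolding kconv_def
proof (intro sum.cong refl, clarify)
  fix R u assume Ru: "(R, u) \<in> splits s S"
  have "(\<Sum>l\<in>hook_children s R. \<Sum>r\<in>hook_trees u (S - R - {u}).
      if blue_count (Node l u r) = j then hook_weight w (Node l u r) else 0)
     = (\<Sum>l\<in>hook_children s R. \<Sum>r\<in>hook_trees u (S - R - {u}).
      total_weight w l * (if blue_count r = j then hook_weight w r else 0))"
    by (intro sum.cong refl) (auto simp: hook_children_def total_weight_def mult_ac)
  also have "\<dots> = (tree_sum w R - high_tree_sum w s R) * chain_sum w j u (S - R - {u})"
    unfolding tree_sum_diff[OF splits_card(3)[OF assms Ru]] chain_sum_def by (simp add: sum_product)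
  finally show "(\<Sum>l\<in>hook_children s R. \<Sum>r\<in>hook_trees u (S - R - {u}).
      if blue_count (Node l u r) = j then hook_weight w (Node l u r) else 0)
     = (tree_sum w R - high_tree_sum w s R) * chain_sum w j u (S - R - {u})" .
qed

lemma chain_sum_0_eqn:
  assumes "finite S"
  shows "chain_sum w 0 s S = \<delta> s S + ((\<lambda>s R. tree_sum w R - high_tree_sum w s R) \<odot> chain_sum w 0) s S"
  unfolding chain_sum_hooks[OF assms, symmetric] 
  by (subst chain_sum_def, subst sum_hook_trees[OF assms]) (simp add: unit_kernel_def)

lemma chain_sum_Suc_eqn:
  assumes "finite S"
  shows "chain_sum w (Suc j) s S = (\<delta> \<odot> chain_sum w j) s S
    + ((\<lambda>s R. tree_sum w R - high_tree_sum w s R) \<odot> chain_sum w (Suc j)) s S"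
  unfolding chain_sum_hooks[OF assms, symmetric] unit_kconv[OF assms]
  by (subst chain_sum_def, subst sum_hook_trees[OF assms]) (simp add: chain_sum_def cong: if_cong)

text \<open>The blue points cut the chain into \<open>j + 1\<close> stretches that consist of hooks only. Formally,
  both sides solve the same linear equation, by associativity of the convolution.\<close>

lemma chain_sum_eq_kernel_pow:
  assumes "finite S"
  shows "chain_sum w j s S = kernel_pow (chain_sum w 0) j s S"
  using assms
proof (induction j arbitrary: s S)
  case (Suc j)
  let ?h = "\<lambda>s R. tree_sum w R - high_tree_sum w s R"
  have "chain_sum w (Suc j) s S = (chain_sum w 0 \<odot> chain_sum w j) s S"
  proof (rule kernel_eqn_unique[where g = "\<delta> \<odot> chain_sum w j" and h = ?h])
    fix s S assume fin: "finite (S :: nat set)"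
    show "chain_sum w (Suc j) s S = (\<delta> \<odot> chain_sum w j) s S + (?h \<odot> chain_sum w (Suc j)) s S"
      by (rule chain_sum_Suc_eqn[OF fin])
    have "(chain_sum w 0 \<odot> chain_sum w j) s S = ((\<lambda>s S. \<delta> s S + (?h \<odot> chain_sum w 0) s S) \<odot> chain_sum w j) s S"
      by (rule kconv_cong) (use splits_card(3)[OF fin] chain_sum_0_eqn in blast)+
    then show "(chain_sum w 0 \<odot> chain_sum w j) s S = (\<delta> \<odot> chain_sum w j) s S + (?h \<odot> (chain_sum w 0 \<odot> chain_sum w j)) s S"
      by (simp add: kconv_add_left kconv_assoc[OF fin])
  qed fact
  also have "\<dots> = (chain_sum w 0 \<odot> kernel_pow (chain_sum w 0) j) s S"
    using Suc by (intro kconv_cong) auto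
  finally show ?case by simp
qed simp

lemma blue_count_le_size: "blue_count t \<le> size t"
  by (induction t) auto

lemma blue_count_le_card: "t \<in> hook_trees s S \<Longrightarrow> blue_count t \<le> card S"
  using blue_count_le_size[of t] distinct_card[of "inorder t"] by (simp add: hook_trees_def)

text \<open>A nonempty tree starts with a blue point, and here this point is only required to lie above
  \<open>s\<close>. After it the chain has \<open>j\<close> further blue points; with the first one and the sky the blue
  block has \<open>j + 2\<close> elements. The bound \<open>N\<close> merely makes the sum finite.\<close>

lemma high_tree_sum_eqn:
  assumes "finite S" "card S \<le> N"
  shows "high_tree_sum w s S = w 1 * \<delta> s S + (\<Sum>j<N. w (j + 2) * (\<delta> \<odot> chain_sum w j) s S)"
proof (cases "S = {}")
  case True
  have "{t. t = Leaf \<and> (t = Leaf \<or> s < value t)} = {Leaf}" by auto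
  with True show ?thesis by (simp add: high_tree_sum_def unit_kernel_def total_weight_def)
next
  case False
  let ?A = "SIGMA u:{u\<in>S. s < u}. hook_trees u (S - {u})"
  have eq: "{t \<in> hook_trees 0 S. t = Leaf \<or> s < value t} = (\<lambda>(u, r). Node Leaf u r) ` ?A"
  proof (intro equalityI subsetI)
    fix t assume t: "t \<in> {t \<in> hook_trees 0 S. t = Leaf \<or> s < value t}"
    then obtain l u r where lur: "t = Node l u r" using False by (cases t) auto
    have "l = Leaf"
    proof (rule ccontr)
      assume "l \<noteq> Leaf"
      then have "hook_tree 0 l" "value l \<le> 0" using t lur by (auto simp: hook_trees_def)
      with hook_tree_greater[of 0 l] \<open>l \<noteq> Leaf\<close> show False by simp
    qed
    with t lur show "t \<in> (\<lambda>(u, r). Node Leaf u r) ` ?A"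
      by (auto simp: Node_in_hook_trees splits_def)
  next
    fix t assume "t \<in> (\<lambda>(u, r). Node Leaf u r) ` ?A"
    then show "t \<in> {t \<in> hook_trees 0 S. t = Leaf \<or> s < value t}"
      by (auto simp: Node_in_hook_trees splits_def)
  qed
  have "high_tree_sum w s S = (\<Sum>(u, r)\<in>?A. total_weight w (Node Leaf u r))"
    unfolding high_tree_sum_def eq by (subst sum.reindex) (auto simp: inj_on_def case_prod_beta)
  also have "\<dots> = (\<Sum>u\<in>{u\<in>S. s < u}. \<Sum>r\<in>hook_trees u (S - {u}). total_weight w (Node Leaf u r))"
    using assms(1) by (subst sum.Sigma) auto
  also have "\<dots> = (\<Sum>u\<in>{u\<in>S. s < u}. \<Sum>r\<in>hook_trees u (S - {u}). \<Sum>j<N. w (j + 2) * (if blue_count r = j then hook_weight w r else 0))"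
  proof (intro sum.cong refl)
    fix u r assume u: "u \<in> {u\<in>S. s < u}" and r: "r \<in> hook_trees u (S - {u})"
    have "blue_count r < N"
      using blue_count_le_card[OF r] u assms card_Diff1_less[of S u] by auto
    then have "(\<Sum>j<N. w (j + 2) * (if blue_count r = j then hook_weight w r else 0))
        = (\<Sum>j\<in>{blue_count r}. w (j + 2) * hook_weight w r)"
      by (intro sum.mono_neutral_cong_right) auto
    then show "total_weight w (Node Leaf u r) = (\<Sum>j<N. w (j + 2) * (if blue_count r = j then hook_weight w r else 0))"
      by (simp add: total_weight_def mult.commute)
  qed
  also have "\<dots> = (\<Sum>j<N. w (j + 2) * (\<delta> \<odot> chain_sum w j) s S)"
    unfolding unit_kconv[OF assms(1)] chain_sum_def sum_distrib_left
    by (subst (2) sum.swap, subst sum.swap) simp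
  finally show ?thesis using False by (simp add: unit_kernel_def)
qed

text \<open>Multiplying the expansion of \<open>high_tree_sum\<close> by \<open>K\<close> lengthens every product by one factor.
  This shifts the index of \<open>w\<close>, and the term for \<open>w 1\<close> fits in as the product with one factor.\<close>

lemma chain_sum_moment_eqn:
  fixes w :: "nat \<Rightarrow> 'a::comm_ring_1"
  assumes fin: "finite S" and N: "card S \<le> N"
  defines "K \<equiv> chain_sum w 0"
  shows "K s S = \<delta> s S + ((\<lambda>_. tree_sum w) \<odot> K) s S - (\<Sum>k<N. w (Suc k) * (\<delta> \<odot> kernel_pow K k) s S)"
proof -
  have step: "((\<delta> \<odot> kernel_pow K j) \<odot> K) s S = (\<delta> \<odot> kernel_pow K (Suc j)) s S" for j
    unfolding kconv_assoc[OF fin] by (rule kconv_cong) (use fin in \<open>auto simp del: kernel_pow.simps simp: kernel_pow_kconv\<close>)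
  have "(high_tree_sum w \<odot> K) s S = ((\<lambda>s S. w 1 * \<delta> s S + (\<Sum>j<N. w (j + 2) * (\<delta> \<odot> kernel_pow K j) s S)) \<odot> K) s S"
  proof (rule kconv_cong)
    fix R u assume Ru: "(R, u) \<in> splits s S"
    note c = splits_card[OF fin Ru]
    have "(\<delta> \<odot> chain_sum w j) s R = (\<delta> \<odot> kernel_pow K j) s R" for j
      unfolding K_def by (rule kconv_cong) (auto intro!: chain_sum_eq_kernel_pow simp: c(3))
    moreover have "card R \<le> N" using c(1) N by simp
    ultimately show "high_tree_sum w s R = w 1 * \<delta> s R + (\<Sum>j<N. w (j + 2) * (\<delta> \<odot> kernel_pow K j) s R)"
      by (simp only: high_tree_sum_eqn[OF c(3)])
  qed simp
  also have "\<dots> = w 1 * (\<delta> \<odot> kernel_pow K 0) s S + (\<Sum>j<N. w (j + 2) * ((\<delta> \<odot> kernel_pow K j) \<odot> K) s S)"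
    unfolding kconv_add_left kconv_sum_left kconv_scale_left by simp
  also have "\<dots> = w 1 * (\<delta> \<odot> kernel_pow K 0) s S + (\<Sum>j<N. w (j + 2) * (\<delta> \<odot> kernel_pow K (Suc j)) s S)"
    unfolding step ..
  also have "\<dots> = (\<Sum>k<Suc N. w (Suc k) * (\<delta> \<odot> kernel_pow K k) s S)"
    unfolding sum.lessThan_Suc_shift by simp
  also have "\<dots> = (\<Sum>k<N. w (Suc k) * (\<delta> \<odot> kernel_pow K k) s S)"
    using kernel_pow_unit_eq_0[OF fin N, of K s] by simp
  finally show ?thesis
    using chain_sum_0_eqn[OF fin, of w s] unfolding K_def kconv_diff_left by simp
qed

section \<open>Classical cumulants as sums over hook trees\<close>

text \<open>Both sides satisfy the same equation, whose right-hand side involves smaller sets only.\<close>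

lemma chain_sum_eq_seq_kernel:
  fixes \<kappa> :: "nat \<Rightarrow> 'a::comm_ring_1"
  assumes "finite S"
  defines "w \<equiv> \<lambda>k. - \<kappa> k"
  shows "chain_sum w 0 s S = seq_kernel (tree_sum w) (nc_moment \<kappa>) s S"
  using assms(1)
proof (induction "card S" arbitrary: s S rule: less_induct)
  case less
  let ?K = "chain_sum w 0" and ?M = "seq_kernel (tree_sum w) (nc_moment \<kappa>)"
  note fin = \<open>finite S\<close>
  have IH: "?K u Q = ?M u Q" if "(R, v) \<in> splits s S" "Q \<subseteq> S - R - {v}" for R v u Q
  proof (rule less(1))
    have "finite (S - R - {v})" using fin by simp
    from card_mono[OF this that(2)] splits_card(2)[OF fin that(1)]
    show "card Q < card S" by simp
    show "finite Q" using that(2) fin finite_subset by blast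
  qed
  have 1: "((\<lambda>_. tree_sum w) \<odot> ?K) s S = ((\<lambda>_. tree_sum w) \<odot> ?M) s S"
    by (rule kconv_cong) (simp_all add: IH)
  have 2: "(\<delta> \<odot> kernel_pow ?K k) s S = (\<delta> \<odot> kernel_pow ?M k) s S" for k
  proof (rule kconv_cong)
    fix R u assume Ru: "(R, u) \<in> splits s S"
    show "kernel_pow ?K k u (S - R - {u}) = kernel_pow ?M k u (S - R - {u})"
      by (rule kernel_pow_cong) (use fin IH[OF Ru] in auto)
  qed simp
  have "?K s S = \<delta> s S + ((\<lambda>_. tree_sum w) \<odot> ?K) s S - (\<Sum>k<card S. w (Suc k) * (\<delta> \<odot> kernel_pow ?K k) s S)"
    by (rule chain_sum_moment_eqn[OF fin order.refl])
  also have "\<dots> = \<delta> s S + ((\<lambda>_. tree_sum w) \<odot> ?M) s S + (\<Sum>k<card S. \<kappa> (Suc k) * (\<delta> \<odot> kernel_pow ?M k) s S)"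
    unfolding 1 2 by (simp add: w_def sum_negf)
  also have "\<dots> = ?M s S"
    by (rule seq_kernel_nc_moment_eqn[OF fin order.refl, symmetric])
  finally show ?case .
qed

text \<open>No hook can start before the first point.\<close>

lemma hook_chain_sum_at_0:
  assumes "finite S"
  shows "chain_sum w 0 0 S = \<delta> 0 S"
proof -
  have "((\<lambda>s R. tree_sum w R - high_tree_sum w s R) \<odot> chain_sum w 0) 0 S = 0"
    unfolding kconv_def by (rule sum.neutral) (auto simp: high_tree_sum_0)
  with chain_sum_0_eqn[OF assms, of w 0] show ?thesis by simp
qed

text \<open>The two evaluations of the hook chains at \<open>s = 0\<close>.\<close>

lemma moment_tree_convolution:
  fixes \<kappa> :: "nat \<Rightarrow> 'a::comm_ring_1"
  assumes "finite S" "0 \<notin> S"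
  shows "(\<Sum>A\<in>Pow S. nc_moment \<kappa> (card A) * exp_kernel (tree_sum (\<lambda>k. - \<kappa> k)) 0 (S - A)) = \<delta> 0 S"
proof -
  have "{x \<in> S. 0 < x} = S" using assms(2) by (auto intro: gr0I)
  then show ?thesis
    using chain_sum_eq_seq_kernel[OF assms(1), of \<kappa> 0] hook_chain_sum_at_0[OF assms(1), of "\<lambda>k. - \<kappa> k"]
    by (simp add: seq_kernel_def)
qed

text \<open>Add a largest label \<open>u\<close> to \<open>S\<close> and compare the exponential of \<open>V\<close> with that of the negated
  cumulants on \<open>X = insert u S\<close>. By induction the two agree on proper subsets of \<open>X\<close>, and on \<open>X\<close>
  itself they differ only in the partition with a single block, by \<open>V S + c (card X)\<close>. Both are
  convolution inverses of the moments on \<open>X\<close>, so this difference vanishes.\<close>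

lemma tree_sum_eq_cumulant:
  fixes \<kappa> c :: "nat \<Rightarrow> 'a::comm_ring_1"
  assumes m: "\<And>n. nc_moment \<kappa> n = partition_sum (\<lambda>B. c (card B)) {1..n}"
  assumes "finite S" "0 \<notin> S"
  shows "tree_sum (\<lambda>k. - \<kappa> k) S = - c (Suc (card S))"
  using assms(2,3)
proof (induction "card S" arbitrary: S rule: less_induct)
  case less
  let ?V = "tree_sum (\<lambda>k. - \<kappa> k)"
  let ?C = "partition_sum (\<lambda>B. c (card B)) :: nat set \<Rightarrow> 'a"
    and ?D = "partition_sum (\<lambda>B. - c (card B)) :: nat set \<Rightarrow> 'a"
  \<comment> \<open>Inserting \<open>0\<close> makes the maximum meaningful for empty \<open>S\<close> and \<open>u\<close> positive.\<close>
  define u where "u = Suc (Max (insert 0 S))"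
  have lt: "x < u" if "x \<in> insert 0 S" for x
    unfolding u_def using Max_ge[of "insert 0 S" x] that less.prems by (simp add: le_imp_less_Suc)
  have u: "u \<notin> S" "0 < u" using lt by auto
  define X where "X = insert u S"
  have X: "finite X" "0 \<notin> X" "card X = Suc (card S)" using less.prems u by (auto simp: X_def)
  have top: "top_weight ?V 0 B = - c (card B)" if B: "B \<subseteq> X" "B \<noteq> {}" "card B \<le> card S" for B
  proof -
    have fB: "finite B" using B X finite_subset by blast
    then have M: "Max B \<in> B" using B by simp
    then have "0 < Max B" using B X(2) by (auto intro: gr0I)
    moreover have c: "card B = Suc (card (B - {Max B}))" using fB M by (rule card.remove)
    then have "?V (B - {Max B}) = - c (Suc (card (B - {Max B})))"
      using B fB X(2) by (intro less) auto
    ultimately show ?thesis by (simp only: top_weight_def if_True c)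
  qed
  have exp_kernel_D: "exp_kernel ?V 0 Y = ?D Y" if Y: "Y \<subseteq> X" "card Y \<le> card S" for Y
    unfolding exp_kernel_def
  proof (rule partition_sum_cong)
    fix B assume B: "B \<subseteq> Y" "B \<noteq> {}"
    have "finite Y" using Y(1) X(1) finite_subset by blast
    from card_mono[OF this B(1)] show "top_weight ?V 0 B = - c (card B)"
      using B Y by (intro top) auto
  qed
  have card_lt: "card Y \<le> card S" if "Y \<subset> X" for Y
    using psubset_card_mono[OF X(1) that] X(3) by simp
  have split: "partition_sum f X = f X + (\<Sum>B\<in>{B. B \<subset> X \<and> u \<in> B}. f B * partition_sum f (X - B))"
    for f :: "nat set \<Rightarrow> 'a"
  proof -
    have "{B. B \<subseteq> X \<and> u \<in> B} = insert X {B. B \<subset> X \<and> u \<in> B}" by (auto simp: X_def)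
    moreover have "finite {B. B \<subset> X \<and> u \<in> B}" using X(1) by (rule_tac finite_subset[of _ "Pow X"]) auto
    ultimately show ?thesis using partition_sum_split_block[OF X(1), of u f] by (simp add: X_def)
  qed
  have le: "y \<le> u" if "y \<in> X" for y using that lt[of y] by (auto simp: X_def)
  have "Max X = u" by (rule Max_eqI[OF X(1) le]) (auto simp: X_def)
  then have topX: "top_weight ?V 0 X = ?V S"
    using u by (simp add: top_weight_def X_def)
  have "exp_kernel ?V 0 X = ?V S + (\<Sum>B\<in>{B. B \<subset> X \<and> u \<in> B}. - c (card B) * ?D (X - B))"
  proof -
    have "top_weight ?V 0 B * partition_sum (top_weight ?V 0) (X - B) = - c (card B) * ?D (X - B)"
      if B: "B \<in> {B. B \<subset> X \<and> u \<in> B}" for B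
    proof -
      have "X - B \<subset> X" "B \<subset> X" "B \<noteq> {}" using B by (auto simp: X_def)
      then show ?thesis
        using top[of B] exp_kernel_D[of "X - B"] card_lt[of B] card_lt[of "X - B"] unfolding exp_kernel_def by simp
    qed
    then show ?thesis unfolding exp_kernel_def split[of "top_weight ?V 0"] topX by simp
  qed
  also have "\<dots> = ?V S + c (card X) + ?D X"
    unfolding split[of "\<lambda>B. - c (card B)"] by simp
  finally have E: "exp_kernel ?V 0 X = ?V S + c (card X) + ?D X" .
  have m': "nc_moment \<kappa> (card A) = ?C A" if "A \<subseteq> X" for A
    unfolding m using that X(1) by (intro partition_sum_card_cong) (auto intro: finite_subset)
  have "0 = (\<Sum>A\<in>Pow X. nc_moment \<kappa> (card A) * exp_kernel ?V 0 (X - A))"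
    using moment_tree_convolution[OF X(1,2), of \<kappa>] by (simp add: unit_kernel_def X_def)
  also have "\<dots> = (\<Sum>A\<in>Pow X. ?C A * ?D (X - A) + (if A = {} then ?V S + c (card X) else 0))"
  proof (intro sum.cong refl)
    fix A assume A: "A \<in> Pow X"
    show "nc_moment \<kappa> (card A) * exp_kernel ?V 0 (X - A) = ?C A * ?D (X - A) + (if A = {} then ?V S + c (card X) else 0)"
    proof (cases "A = {}")
      case True
      then show ?thesis using m'[of "{}"] E by simp
    next
      case False
      then have "X - A \<subset> X" using A by auto
      then show ?thesis using False A m'[of A] exp_kernel_D[of "X - A"] card_lt[of "X - A"] by auto
    qed
  qed
  also have "\<dots> = (\<Sum>A\<in>Pow X. ?C A * ?D (X - A)) + (?V S + c (card X))"
    using X(1) by (simp add: sum.distrib sum.delta)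
  also have "(\<Sum>A\<in>Pow X. ?C A * ?D (X - A)) = 0"
    using partition_sum_uminus[OF X(1), of "\<lambda>B. c (card B)"] by (simp add: X_def)
  finally show ?case using X(3) by (simp add: eq_neg_iff_add_eq_0)
qed

section \<open>The hooks of a tree\<close>

text \<open>The hooks of a tree whose points occupy the abscissas \<open>q + 1, ..., q + size t\<close>; the
  preceding visible point has abscissa \<open>q\<close>. The list is sorted by southwest endpoints.\<close>

fun hook_arcs :: "nat \<Rightarrow> 'b tree \<Rightarrow> hook list" where
  "hook_arcs q Leaf = []"
| "hook_arcs q (Node l v r) =
     (if l = Leaf then [] else [(q, Suc (q + size l))]) @ hook_arcs q l @ hook_arcs (Suc (q + size l)) r"

definition reads :: "(nat \<Rightarrow> 'b) \<Rightarrow> nat \<Rightarrow> 'b tree \<Rightarrow> bool" where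
  "reads \<pi> q t \<longleftrightarrow> map \<pi> [Suc q..<Suc (q + size t)] = inorder t"

lemma reads_Leaf [simp]: "reads \<pi> q Leaf"
  by (simp add: reads_def)

lemma reads_Node [simp]:
  "reads \<pi> q (Node l v r) \<longleftrightarrow> reads \<pi> q l \<and> \<pi> (Suc (q + size l)) = v \<and> reads \<pi> (Suc (q + size l)) r"
proof -
  have "[Suc q..<Suc (q + size (Node l v r))]
      = [Suc q..<Suc (q + size l)] @ Suc (q + size l) # [Suc (Suc (q + size l))..<Suc (Suc (q + size l) + size r)]"
    using upt_add_eq_append[of "Suc q" "Suc (q + size l)" "Suc (size r)"]
    by (simp add: upt_conv_Cons add_ac del: upt_Suc)
  then show ?thesis
    by (simp add: reads_def append_eq_append_conv del: upt_Suc)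
qed

lemma reads_set: "reads \<pi> q t \<Longrightarrow> set_tree t = \<pi> ` {Suc q..q + size t}"
proof -
  assume "reads \<pi> q t"
  then have "set (inorder t) = set (map \<pi> [Suc q..<Suc (q + size t)])"
    by (simp only: reads_def)
  then show ?thesis by (simp only: set_inorder set_map set_upt atLeastLessThanSuc_atLeastAtMost)
qed

lemma reads_mem: "reads \<pi> q t \<Longrightarrow> q < i \<Longrightarrow> i \<le> q + size t \<Longrightarrow> \<pi> i \<in> set_tree t"
  by (auto simp: reads_set)

lemma hook_arcs_bounds: "(i, j) \<in> set (hook_arcs q t) \<Longrightarrow> q \<le> i \<and> i < j \<and> j \<le> q + size t"
proof (induction t arbitrary: q)
  case (Node l v r)
  from Node.prems consider "(i, j) = (q, Suc (q + size l))" | "(i, j) \<in> set (hook_arcs q l)"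
    | "(i, j) \<in> set (hook_arcs (Suc (q + size l)) r)"
    by (auto split: if_splits)
  then show ?case
    using Node.IH(1)[of q] Node.IH(2)[of "Suc (q + size l)"] by cases auto
qed simp

lemma hook_tree_0_Node: "hook_tree 0 (Node l v r) \<Longrightarrow> l = Leaf"
  using hook_tree_greater[of 0 l] by (cases "l = Leaf") auto

text \<open>The first point of a configuration with threshold \<open>0\<close> is blue, so no hook leads from
  abscissa \<open>q\<close> to a visible point.\<close>

lemma hook_arcs_0_start: "hook_tree 0 t \<Longrightarrow> (i, j) \<in> set (hook_arcs q t) \<Longrightarrow> q < i"
proof (cases t)
  case (Node l v r)
  assume "hook_tree 0 t" "(i, j) \<in> set (hook_arcs q t)"
  moreover from this Node have "l = Leaf" using hook_tree_0_Node by blast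
  ultimately show ?thesis using Node hook_arcs_bounds[of i j "Suc q" r] by simp
qed simp

lemma hook_arcs_Node_cases:
  assumes "(i, j) \<in> set (hook_arcs q (Node l v r))" "hook_tree s (Node l v r)"
  obtains (root) "l \<noteq> Leaf" "i = q" "j = Suc (q + size l)"
  | (child) "(i, j) \<in> set (hook_arcs q l)" "q < i" "j \<le> q + size l"
  | (rest) "(i, j) \<in> set (hook_arcs (Suc (q + size l)) r)" "Suc (q + size l) \<le> i"
  using assms hook_arcs_bounds[of i j q l] hook_arcs_bounds[of i j "Suc (q + size l)" r]
    hook_arcs_0_start[of l i j q]
  by (auto split: if_splits)

lemma sorted_hook_arcs: "hook_tree s t \<Longrightarrow> sorted_wrt (<) (map fst (hook_arcs q t))"
proof (induction t arbitrary: s q)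
  case (Node l v r)
  let ?p = "Suc (q + size l)"
  have l: "q < i \<and> i < q + size l" if "i \<in> fst ` set (hook_arcs q l)" for i
    using that hook_arcs_bounds[of _ _ q l] hook_arcs_0_start[of l _ _ q] Node.prems by force
  have r: "?p \<le> i" if "i \<in> fst ` set (hook_arcs ?p r)" for i
    using that hook_arcs_bounds[of _ _ ?p r] by force
  have sl: "sorted_wrt (<) (map fst (hook_arcs q l))" and sr: "sorted_wrt (<) (map fst (hook_arcs ?p r))"
    using Node by auto
  have app: "sorted_wrt (<) (map fst (hook_arcs q l) @ map fst (hook_arcs ?p r))"
    unfolding sorted_wrt_append using sl sr l r by fastforce
  moreover have "q < i" if "i \<in> fst ` set (hook_arcs q l) \<union> fst ` set (hook_arcs ?p r)" for i
  proof -
    from that consider "i \<in> fst ` set (hook_arcs q l)" | "i \<in> fst ` set (hook_arcs ?p r)" by blast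
    then show ?thesis using l r by cases (blast, fastforce)
  qed
  ultimately show ?case by (cases "l = Leaf") auto
qed simp

text \<open>Southwest endpoints are exactly the descents. Abscissa \<open>q\<close> needs special treatment, because
  for the configuration below a hook the threshold \<open>s = 0\<close> is not the height of the preceding
  point.\<close>

lemma fst_hook_arcs:
  assumes "hook_tree s t" "reads \<pi> q t" "distinct (inorder t)" "s \<notin> set_tree t" "0 \<notin> set_tree t"
  shows "fst ` set (hook_arcs q t) = {i. q \<le> i \<and> i < q + size t \<and> \<pi> (Suc i) < (if i = q then s else \<pi> i)}"
  using assms
proof (induction t arbitrary: s q)
  case (Node l v r)
  let ?p = "Suc (q + size l)"
  let ?D = "\<lambda>q s n. {i. q \<le> i \<and> i < q + n \<and> \<pi> (Suc i) < (if i = q then s else \<pi> i)}"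
  have L: "fst ` set (hook_arcs q l) = ?D q 0 (size l)"
    using Node.prems by (intro Node.IH(1)) auto
  have R: "fst ` set (hook_arcs ?p r) = ?D ?p v (size r)"
    using Node.prems by (intro Node.IH(2)) auto
  have v: "\<pi> ?p = v" using Node.prems by simp
  have last: "\<not> \<pi> ?p < (if q + size l = q then s else \<pi> (q + size l))"
  proof (cases "l = Leaf")
    case False
    then have "0 < size l" by (cases l) auto
    then have "\<pi> (q + size l) \<in> set_tree l" using Node.prems by (intro reads_mem[of _ q]) auto
    then show ?thesis using Node.prems v \<open>0 < size l\<close> by auto
  qed (use Node.prems v in auto)
  have first: "\<pi> (Suc q) < s" if ne: "l \<noteq> Leaf"
  proof -
    obtain l' y r' where l: "l = Node l' y r'" using ne by (cases l) auto
    then have "l' = Leaf" using Node.prems hook_tree_0_Node by auto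
    then have "\<pi> (Suc q) = value l" using Node.prems l by simp
    moreover have "value l \<noteq> s" using Node.prems l by auto
    ultimately show ?thesis using Node.prems that by auto
  qed
  have "i \<in> fst ` set (hook_arcs q (Node l v r)) \<longleftrightarrow> i \<in> ?D q s (size (Node l v r))" for i
  proof -
    consider "i < q" | "i = q" "l \<noteq> Leaf" | "q < i" "i < q + size l" | "i = q + size l" | "?p \<le> i"
    proof (cases "l = Leaf")
      case True
      then have "size l = 0" by simp
      then show ?thesis using that(1,4,5) by linarith
    next
      case False
      then show ?thesis using that by linarith
    qed
    then show ?thesis
    proof cases
      case 1
      then show ?thesis using hook_arcs_bounds[of _ _ q "Node l v r"] by force
    next
      case 2
      then show ?thesis using first by simp
    next
      case 3
      then show ?thesis unfolding hook_arcs.simps set_append image_Un L R by auto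
    next
      case 4
      then have "i \<notin> ?D q s (size (Node l v r))" using last by auto
      moreover have "i \<notin> fst ` set (hook_arcs q (Node l v r))"
        unfolding hook_arcs.simps set_append image_Un L R using 4 by (cases l) auto
      ultimately show ?thesis by simp
    next
      case 5
      then show ?thesis unfolding hook_arcs.simps set_append image_Un L R using v by auto
    qed
  qed
  then show ?case by blast
qed simp

lemma hook_arcs_above_points:
  assumes "hook_tree s t" "reads \<pi> q t" "(i, j) \<in> set (hook_arcs q t)"
  shows "(if i = q then s else \<pi> i) < \<pi> j \<and> (\<forall>x. i < x \<and> x < j \<longrightarrow> \<pi> x < \<pi> j)"
  using assms
proof (induction t arbitrary: s q)
  case (Node l v r)
  let ?p = "Suc (q + size l)"
  from Node.prems(3,1) show ?case
  proof (cases rule: hook_arcs_Node_cases)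
    case root
    then show ?thesis using Node.prems reads_mem[of \<pi> q l] by auto
  next
    case child
    then show ?thesis using Node.IH(1)[of 0 q] Node.prems by auto
  next
    case rest
    then show ?thesis using Node.IH(2)[of v ?p] Node.prems by (auto split: if_splits)
  qed
qed simp

lemma hook_arcs_laminar:
  assumes "hook_tree s t" "(i, j) \<in> set (hook_arcs q t)" "(i', j') \<in> set (hook_arcs q t)" "i < i'"
  shows "j \<le> i' \<or> j' < j"
  using assms
proof (induction t arbitrary: s q)
  case (Node l v r)
  let ?p = "Suc (q + size l)"
  from Node.prems(2,1) show ?case
  proof (cases rule: hook_arcs_Node_cases)
    case root
    from Node.prems(3,1) show ?thesis
      by (cases rule: hook_arcs_Node_cases) (use root Node.prems(4) in auto)
  next
    case child
    note c = child
    from Node.prems(3,1) show ?thesis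
    proof (cases rule: hook_arcs_Node_cases)
      case child
      then show ?thesis using c Node.IH(1)[of 0 q] Node.prems by auto
    qed (use c Node.prems(4) in auto)
  next
    case rest
    note c = rest
    from Node.prems(3,1) show ?thesis
    proof (cases rule: hook_arcs_Node_cases)
      case rest
      then show ?thesis using c Node.IH(2)[of v ?p] Node.prems by auto
    next
      case child
      then show ?thesis using hook_arcs_bounds[of i' j' q l] c Node.prems(4) by auto
    qed (use c Node.prems(4) in auto)
  qed
qed simp

lemma distinct_snd_hook_arcs: "hook_tree s t \<Longrightarrow> distinct (map snd (hook_arcs q t))"
proof (induction t arbitrary: s q)
  case (Node l v r)
  let ?p = "Suc (q + size l)"
  have l: "j \<le> q + size l" if "j \<in> snd ` set (hook_arcs q l)" for j
    using that hook_arcs_bounds[of _ _ q l] by force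
  have r: "?p < j" if "j \<in> snd ` set (hook_arcs ?p r)" for j
    using that hook_arcs_bounds[of _ _ ?p r] by force
  have "distinct (map snd (hook_arcs q l))" "distinct (map snd (hook_arcs ?p r))" using Node by auto
  moreover have "snd ` set (hook_arcs q l) \<inter> snd ` set (hook_arcs ?p r) = {}"
    using l r by fastforce
  moreover have "?p \<notin> snd ` set (hook_arcs q l)" "?p \<notin> snd ` set (hook_arcs ?p r)"
    using l[of ?p] r[of ?p] by auto
  ultimately show ?case by simp
qed simp

text \<open>The hook that starts at \<open>q\<close>, or its absence, reveals the position of the root; the remaining
  hooks are distributed to the two subtrees according to their abscissas.\<close>

lemma hook_tree_unique:
  assumes "hook_tree s t" "hook_tree s' t'" "reads \<pi> q t" "reads \<pi> q t'" "size t = size t'"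
    "set (hook_arcs q t) = set (hook_arcs q t')"
  shows "t = t'"
  using assms
proof (induction t arbitrary: s s' q t')
  case Leaf
  then show ?case by simp
next
  case (Node l v r)
  then obtain l' v' r' where t': "t' = Node l' v' r'" by (cases t') auto
  let ?A = "set (hook_arcs q (Node l v r))"
  have start: "(q, j) \<in> set (hook_arcs q (Node l v r)) \<longleftrightarrow> l \<noteq> Leaf \<and> j = Suc (q + size l)"
    if "hook_tree s (Node l v r)" for s l r j and v :: nat
  proof
    assume "(q, j) \<in> set (hook_arcs q (Node l v r))"
    from this that show "l \<noteq> Leaf \<and> j = Suc (q + size l)"
      by (cases rule: hook_arcs_Node_cases) auto
  qed auto
  have child: "set (hook_arcs q l) = {(i, j)\<in>set (hook_arcs q (Node l v r)). q < i \<and> j \<le> q + size l}"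
    if "hook_tree s (Node l v r)" for s l r and v :: nat
  proof (intro equalityI subsetI)
    fix z assume z: "z \<in> set (hook_arcs q l)"
    then show "z \<in> {(i, j)\<in>set (hook_arcs q (Node l v r)). q < i \<and> j \<le> q + size l}"
      using that hook_arcs_bounds[of "fst z" "snd z" q l] hook_arcs_0_start[of l "fst z" "snd z" q] by auto
  next
    fix z assume z: "z \<in> {(i, j)\<in>set (hook_arcs q (Node l v r)). q < i \<and> j \<le> q + size l}"
    then have m: "(fst z, snd z) \<in> set (hook_arcs q (Node l v r))" by auto
    have b: "fst z < snd z" using hook_arcs_bounds[OF m] by simp
    have z': "q < fst z" "snd z \<le> q + size l" using z by auto
    from m that show "z \<in> set (hook_arcs q l)"
      by (cases rule: hook_arcs_Node_cases) (use z' b in simp_all)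
  qed
  have rest: "set (hook_arcs (Suc (q + size l)) r) = {(i, j)\<in>set (hook_arcs q (Node l v r)). Suc (q + size l) \<le> i}"
    if "hook_tree s (Node l v r)" for s l r and v :: nat
  proof (intro equalityI subsetI)
    fix z assume z: "z \<in> set (hook_arcs (Suc (q + size l)) r)"
    then show "z \<in> {(i, j)\<in>set (hook_arcs q (Node l v r)). Suc (q + size l) \<le> i}"
      using hook_arcs_bounds[of "fst z" "snd z" "Suc (q + size l)" r] by auto
  next
    fix z assume z: "z \<in> {(i, j)\<in>set (hook_arcs q (Node l v r)). Suc (q + size l) \<le> i}"
    then have m: "(fst z, snd z) \<in> set (hook_arcs q (Node l v r))" by auto
    have b: "fst z < snd z" using hook_arcs_bounds[OF m] by simp
    have z': "Suc (q + size l) \<le> fst z" using z by auto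
    from m that show "z \<in> set (hook_arcs (Suc (q + size l)) r)"
      by (cases rule: hook_arcs_Node_cases) (use z' b in simp_all)
  qed
  have ok: "hook_tree s (Node l v r)" "hook_tree s' (Node l' v' r')" using Node.prems t' by auto
  have eqA: "set (hook_arcs q (Node l' v' r')) = ?A" using Node.prems t' by simp
  have iff: "l \<noteq> Leaf \<and> j = Suc (q + size l) \<longleftrightarrow> l' \<noteq> Leaf \<and> j = Suc (q + size l')" for j
    using start[OF ok(1), of j] start[OF ok(2), of j] unfolding eqA by (simp only:)
  have sz: "size l = size l'"
  proof (cases "l = Leaf")
    case True
    then have "l' = Leaf" using iff[of "Suc (q + size l')"] by blast
    with True show ?thesis by simp
  next
    case False
    then show ?thesis using iff[of "Suc (q + size l)"] by simp
  qed
  have rd: "reads \<pi> q l'" "\<pi> (Suc (q + size l)) = v'" "reads \<pi> (Suc (q + size l)) r'"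
    using Node.prems(4) t' sz by simp_all
  have "l = l'"
  proof (rule Node.IH(1)[where s = 0 and s' = 0 and q = q])
    show "hook_tree 0 l" "hook_tree 0 l'" using ok by simp_all
    show "reads \<pi> q l" "reads \<pi> q l'" using Node.prems(3) rd by simp_all
    show "set (hook_arcs q l) = set (hook_arcs q l')"
      unfolding child[OF ok(1)] child[OF ok(2)] eqA sz ..
  qed (rule sz)
  moreover have "r = r'"
  proof (rule Node.IH(2)[where s = v and s' = v' and q = "Suc (q + size l)"])
    show "hook_tree v r" "hook_tree v' r'" using ok by simp_all
    show "reads \<pi> (Suc (q + size l)) r" "reads \<pi> (Suc (q + size l)) r'" using Node.prems(3) rd by simp_all
    show "size r = size r'" using Node.prems(5) t' sz by simp
    show "set (hook_arcs (Suc (q + size l)) r) = set (hook_arcs (Suc (q + size l)) r')"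
      unfolding rest[OF ok(1)] using rest[OF ok(2)] unfolding eqA sz[symmetric] by (rule sym)
  qed
  moreover have "v = v'" using Node.prems(3) rd(2) by simp
  ultimately show ?case using t' by simp
qed

text \<open>A laminar family of arcs on a segment of abscissas is cut at the northeast endpoint of the
  arc that starts at \<open>q\<close> (or at \<open>q + 1\<close> if there is none). Laminarity keeps every other arc on one
  side of the cut.\<close>

lemma hook_tree_exists:
  assumes "q \<le> p"
    and bounds: "\<And>i j. (i, j) \<in> A \<Longrightarrow> q \<le> i \<and> i < j \<and> j \<le> p"
    and below: "\<And>i j. (i, j) \<in> A \<Longrightarrow> (if i = q then s else \<pi> i) < \<pi> j \<and> (\<forall>x. i < x \<and> x < j \<longrightarrow> \<pi> x < \<pi> j)"
    and fst_inj: "\<And>i j j'. (i, j) \<in> A \<Longrightarrow> (i, j') \<in> A \<Longrightarrow> j = j'"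
    and laminar: "\<And>i j i' j'. (i, j) \<in> A \<Longrightarrow> (i', j') \<in> A \<Longrightarrow> i < i' \<Longrightarrow> j \<le> i' \<or> j' < j"
    and starts: "fst ` A = {i. q \<le> i \<and> i < p \<and> \<pi> (Suc i) < (if i = q then s else \<pi> i)}"
    and inj: "inj_on \<pi> {q<..p}" and s: "s \<notin> \<pi> ` {q<..p}" and pos: "0 \<notin> \<pi> ` {q<..p}"
  shows "\<exists>t. hook_tree s t \<and> size t = p - q \<and> reads \<pi> q t \<and> set (hook_arcs q t) = A"
  using assms
proof (induction "p - q" arbitrary: p q s A rule: less_induct)
  case less
  note IH = less(1) and bounds = less(3) and below = less(4) and fst_inj = less(5)
    and laminar = less(6) and starts = less(7) and inj = less(8) and s = less(9) and pos = less(10)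
  show ?case
  proof (cases "q = p")
    case True
    then have "A = {}" using bounds by (cases "A = {}") force+
    then show ?thesis using True by (intro exI[of _ Leaf]) simp
  next
    case False
    with less(2) have qp: "q < p" by simp
    have startsD: "\<pi> (Suc i) < (if i = q then s else \<pi> i)" if "(i, j) \<in> A" for i j
    proof -
      have "i \<in> fst ` A" using that by force
      then show ?thesis unfolding starts by simp
    qed
    have startI: "i \<in> fst ` A \<longleftrightarrow> q \<le> i \<and> i < p \<and> \<pi> (Suc i) < (if i = q then s else \<pi> i)" for i
      unfolding starts by simp
    show ?thesis
    proof (cases "\<pi> (Suc q) < s")
      case False
      moreover have "\<pi> (Suc q) \<noteq> s"
      proof
        assume "\<pi> (Suc q) = s"
        then have "s \<in> \<pi> ` {q<..p}" using qp by (intro image_eqI[of _ _ "Suc q"]) auto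
        with s show False ..
      qed
      ultimately have gt: "s < \<pi> (Suc q)" by simp
      have gtq: "q < i" if "(i, j) \<in> A" for i j
        using startsD[OF that] bounds[OF that] False by (cases "i = q") auto
      have "\<exists>r. hook_tree (\<pi> (Suc q)) r \<and> size r = p - Suc q \<and> reads \<pi> (Suc q) r \<and> set (hook_arcs (Suc q) r) = A"
      proof (rule IH)
        show "p - Suc q < p - q" "Suc q \<le> p" using qp by auto
        show "Suc q \<le> i \<and> i < j \<and> j \<le> p" if "(i, j) \<in> A" for i j
          using gtq[OF that] bounds[OF that] by auto
        show "(if i = Suc q then \<pi> (Suc q) else \<pi> i) < \<pi> j \<and> (\<forall>x. i < x \<and> x < j \<longrightarrow> \<pi> x < \<pi> j)" if "(i, j) \<in> A" for i j
          using gtq[OF that] below[OF that] by auto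
        show "fst ` A = {i. Suc q \<le> i \<and> i < p \<and> \<pi> (Suc i) < (if i = Suc q then \<pi> (Suc q) else \<pi> i)}"
          unfolding starts using False by (auto simp: Suc_le_eq order_less_le)
        have sub: "{Suc q<..p} \<subseteq> {q<..p}" by auto
        show "inj_on \<pi> {Suc q<..p}" using inj sub by (rule inj_on_subset)
        show "0 \<notin> \<pi> ` {Suc q<..p}" using pos sub by blast
        show "\<pi> (Suc q) \<notin> \<pi> ` {Suc q<..p}"
        proof
          assume "\<pi> (Suc q) \<in> \<pi> ` {Suc q<..p}"
          then obtain x where "x \<in> {Suc q<..p}" "\<pi> (Suc q) = \<pi> x" by auto
          with inj_onD[OF inj, of "Suc q" x] qp show False by auto
        qed
        show "i' = i''" if "(i, i') \<in> A" "(i, i'') \<in> A" for i i' i''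
          using that fst_inj by blast
        show "b \<le> i' \<or> b' < b" if "(i, b) \<in> A" "(i', b') \<in> A" "i < i'" for i b i' b'
          using that laminar by blast
      qed
      then obtain r where r: "hook_tree (\<pi> (Suc q)) r" "size r = p - Suc q" "reads \<pi> (Suc q) r" "set (hook_arcs (Suc q) r) = A"
        by blast
      show ?thesis using r gt qp by (intro exI[of _ "Node Leaf (\<pi> (Suc q)) r"]) auto
    next
      case True
      then have "q \<in> fst ` A" unfolding starts using qp by simp
      then obtain j where j: "(q, j) \<in> A" by auto
      have jb: "q < j" "j \<le> p" using bounds[OF j] by auto
      have sj: "s < \<pi> j" and bj: "\<And>x. q < x \<Longrightarrow> x < j \<Longrightarrow> \<pi> x < \<pi> j" using below[OF j] by auto
      have "j \<noteq> Suc q" using True sj by auto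
      with jb have jq: "Suc q < j" by simp
      define Al where "Al = {(i, i') \<in> A. q < i \<and> i < j}"
      define Ar where "Ar = {(i, i') \<in> A. j \<le> i}"
      have A: "A = insert (q, j) (Al \<union> Ar)"
      proof (intro equalityI subsetI)
        fix z assume z: "z \<in> A"
        obtain a b where ab: "z = (a, b)" by (cases z)
        with z bounds[of a b] fst_inj[of q b j] j show "z \<in> insert (q, j) (Al \<union> Ar)"
          by (cases "a = q") (auto simp: Al_def Ar_def)
      qed (use j in \<open>auto simp: Al_def Ar_def\<close>)
      have memA: "(i, i') \<in> A" if "(i, i') \<in> Al \<or> (i, i') \<in> Ar" for i i' using that by (auto simp: Al_def Ar_def)
      have "\<exists>l. hook_tree 0 l \<and> size l = (j - 1) - q \<and> reads \<pi> q l \<and> set (hook_arcs q l) = Al"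
      proof (rule IH)
        show "j - 1 - q < p - q" "q \<le> j - 1" using jb by auto
        show "q \<le> i \<and> i < i' \<and> i' \<le> j - 1" if "(i, i') \<in> Al" for i i'
          using that bounds[of i i'] laminar[OF j, of i i'] by (auto simp: Al_def)
        show "(if i = q then 0 else \<pi> i) < \<pi> i' \<and> (\<forall>x. i < x \<and> x < i' \<longrightarrow> \<pi> x < \<pi> i')" if "(i, i') \<in> Al" for i i'
          using that below[of i i'] by (auto simp: Al_def)
        show "i' = i''" if "(i, i') \<in> Al" "(i, i'') \<in> Al" for i i' i''
          using that fst_inj memA by blast
        show "b \<le> i' \<or> b' < b" if "(i, b) \<in> Al" "(i', b') \<in> Al" "i < i'" for i b i' b'
          using that laminar memA by blast
        have fst_Al: "fst ` Al = {i \<in> fst ` A. q < i \<and> i < j}" by (force simp: Al_def)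
        have "\<pi> (j - 1) < \<pi> j" using jq by (intro bj) auto
        then have "\<not> \<pi> j < \<pi> (j - 1)" by simp
        then have end_l: "\<not> \<pi> (Suc i) < \<pi> i" if "q < i" "i < j" "\<not> i < j - 1" for i
          using that by (cases "i = j - 1") auto
        show "fst ` Al = {i. q \<le> i \<and> i < j - 1 \<and> \<pi> (Suc i) < (if i = q then 0 else \<pi> i)}"
        proof (rule set_eqI)
          fix i
          show "i \<in> fst ` Al \<longleftrightarrow> i \<in> {i. q \<le> i \<and> i < j - 1 \<and> \<pi> (Suc i) < (if i = q then 0 else \<pi> i)}"
            unfolding fst_Al mem_Collect_eq startI using jb end_l[of i] by (cases "i = q") auto
        qed
        have sub: "{q<..j - 1} \<subseteq> {q<..p}" using jb by auto
        show "inj_on \<pi> {q<..j - 1}" using inj sub by (rule inj_on_subset)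
        show "0 \<notin> \<pi> ` {q<..j - 1}" using pos sub by blast
        then show "0 \<notin> \<pi> ` {q<..j - 1}" .
      qed
      then obtain l where l: "hook_tree 0 l" "size l = (j - 1) - q" "reads \<pi> q l" "set (hook_arcs q l) = Al"
        by blast
      have "\<exists>r. hook_tree (\<pi> j) r \<and> size r = p - j \<and> reads \<pi> j r \<and> set (hook_arcs j r) = Ar"
      proof (rule IH)
        show "p - j < p - q" "j \<le> p" using jb by auto
        show "j \<le> i \<and> i < i' \<and> i' \<le> p" if "(i, i') \<in> Ar" for i i'
          using that bounds[of i i'] by (auto simp: Ar_def)
        show "(if i = j then \<pi> j else \<pi> i) < \<pi> i' \<and> (\<forall>x. i < x \<and> x < i' \<longrightarrow> \<pi> x < \<pi> i')" if "(i, i') \<in> Ar" for i i'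
          using that below[of i i'] jb by (auto simp: Ar_def split: if_splits)
        show "i' = i''" if "(i, i') \<in> Ar" "(i, i'') \<in> Ar" for i i' i''
          using that fst_inj memA by blast
        show "b \<le> i' \<or> b' < b" if "(i, b) \<in> Ar" "(i', b') \<in> Ar" "i < i'" for i b i' b'
          using that laminar memA by blast
        have fst_Ar: "fst ` Ar = {i \<in> fst ` A. j \<le> i}" by (force simp: Ar_def)
        show "fst ` Ar = {i. j \<le> i \<and> i < p \<and> \<pi> (Suc i) < (if i = j then \<pi> j else \<pi> i)}"
        proof (rule set_eqI)
          fix i
          show "i \<in> fst ` Ar \<longleftrightarrow> i \<in> {i. j \<le> i \<and> i < p \<and> \<pi> (Suc i) < (if i = j then \<pi> j else \<pi> i)}"
            unfolding fst_Ar mem_Collect_eq startI using jb by (cases "i = j") auto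
        qed
        have sub: "{j<..p} \<subseteq> {q<..p}" using jb by auto
        show "inj_on \<pi> {j<..p}" using inj sub by (rule inj_on_subset)
        show "0 \<notin> \<pi> ` {j<..p}" using pos sub by blast
        show "\<pi> j \<notin> \<pi> ` {j<..p}"
        proof
          assume "\<pi> j \<in> \<pi> ` {j<..p}"
          then obtain x where "x \<in> {j<..p}" "\<pi> j = \<pi> x" by auto
          with inj_onD[OF inj, of j x] jb show False by auto
        qed
      qed
      then obtain r where r: "hook_tree (\<pi> j) r" "size r = p - j" "reads \<pi> j r" "set (hook_arcs j r) = Ar"
        by blast
      have pj: "Suc (q + size l) = j" using l(2) jq by simp
      have lN: "l \<noteq> Leaf" using l(2) jq by auto
      then obtain l1 y l2 where lN': "l = Node l1 y l2" by (cases l) auto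
      with l(1) have "l1 = Leaf" using hook_tree_0_Node by blast
      then have "value l = \<pi> (Suc q)" using l(3) lN' by simp
      then have "value l \<le> s" using True by simp
      moreover have "x < \<pi> j" if "x \<in> set_tree l" for x
        using that bj pj unfolding reads_set[OF l(3)] by auto
      ultimately have "hook_tree s (Node l (\<pi> j) r)" using sj l(1) r(1) by simp
      then show ?thesis
        using l r pj lN A jb by (intro exI[of _ "Node l (\<pi> j) r"]) auto
    qed
  qed
qed

section \<open>Hook trees and valid hook configurations\<close>

lemma closed_segment_Pair_fst: "closed_segment (a, c) (a, d) = {a} \<times> closed_segment c (d :: real)" for a :: real
proof -
  have "(1 - u) * a + u * a = a" for u by (simp add: algebra_simps)
  then show ?thesis unfolding closed_segment_def by auto
qed

lemma closed_segment_Pair_snd: "closed_segment (a, c) (b, c) = closed_segment a b \<times> {c}" for a b c :: real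
proof -
  have "(1 - u) * c + u * c = c" for u by (simp add: algebra_simps)
  then show ?thesis unfolding closed_segment_def by auto
qed

lemma hook_points_iff:
  assumes "i < j" "\<pi> i < \<pi> j"
  shows "(x, y) \<in> hook_points \<pi> (i, j) \<longleftrightarrow>
    x = real i \<and> real (\<pi> i) \<le> y \<and> y \<le> real (\<pi> j) \<or> y = real (\<pi> j) \<and> real i \<le> x \<and> x \<le> real j"
  using assms by (auto simp: hook_points_def closed_segment_Pair_fst closed_segment_Pair_snd closed_segment_eq_real_ivl)

definition laminar_hooks :: "hook set \<Rightarrow> bool" where
  "laminar_hooks A \<longleftrightarrow> (\<forall>(i, j)\<in>A. \<forall>(i', j')\<in>A. i < i' \<longrightarrow> j \<le> i' \<or> j' < j)"

definition hooks_above :: "(nat \<Rightarrow> nat) \<Rightarrow> hook set \<Rightarrow> bool" where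
  "hooks_above \<pi> A \<longleftrightarrow> (\<forall>(i, j)\<in>A. i < j \<and> (\<forall>x. i \<le> x \<and> x < j \<longrightarrow> \<pi> x < \<pi> j))"

text \<open>If \<open>i < i' < j \<le> j'\<close>, the vertical part of the second hook meets the horizontal part of the
  first one at abscissa \<open>i'\<close> and height \<open>\<pi> j\<close>. In a laminar family, two hooks either lie side by
  side, meeting at most in a common endpoint, or one of them lies strictly to the right of the
  vertical side and below the horizontal side of the other.\<close>

lemma disjoint_hooks_iff:
  assumes h: "hooks_above \<pi> A" and inj: "\<And>i j j'. (i, j) \<in> A \<Longrightarrow> (i, j') \<in> A \<Longrightarrow> j = j'"
  shows "(\<forall>h\<in>A. \<forall>h'\<in>A. h \<noteq> h' \<longrightarrow> hook_points \<pi> h \<inter> hook_points \<pi> h' = {} \<or> snd h = fst h' \<or> snd h' = fst h)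
    \<longleftrightarrow> laminar_hooks A" (is "?L \<longleftrightarrow> _")
proof
  assume L: ?L
  show "laminar_hooks A"
    unfolding laminar_hooks_def
  proof (clarify, rule ccontr)
    fix i j i' j' assume A: "(i, j) \<in> A" "(i', j') \<in> A" and ii: "i < i'" and "\<not> j' < j" "\<not> j \<le> i'"
    then have j: "i' < j" "j \<le> j'" by auto
    have a: "i < j" "\<And>x. i \<le> x \<Longrightarrow> x < j \<Longrightarrow> \<pi> x < \<pi> j" and b: "i' < j'" "\<And>x. i' \<le> x \<Longrightarrow> x < j' \<Longrightarrow> \<pi> x < \<pi> j'"
      using h A unfolding hooks_above_def by auto
    have "hook_points \<pi> (i, j) \<inter> hook_points \<pi> (i', j') = {}"
      using L[rule_format, OF A] ii j b(1) by auto
    moreover have "(real i', real (\<pi> j)) \<in> hook_points \<pi> (i, j)"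
      using a(1) a(2)[of i] ii j by (subst hook_points_iff) auto
    moreover have "(real i', real (\<pi> j)) \<in> hook_points \<pi> (i', j')"
    proof -
      have "\<pi> j \<le> \<pi> j'" using b(2)[of j] j by (cases "j = j'") auto
      moreover have "\<pi> i' \<le> \<pi> j" using a(2)[of i'] ii j by auto
      ultimately show ?thesis using b(1) b(2)[of i'] by (subst hook_points_iff) auto
    qed
    ultimately show False by blast
  qed
next
  assume lam: "laminar_hooks A"
  have *: "hook_points \<pi> (i, j) \<inter> hook_points \<pi> (i', j') = {} \<or> j = i'"
    if A: "(i, j) \<in> A" "(i', j') \<in> A" and ii: "i < i'" for i j i' j'
  proof -
    have a: "i < j" "\<pi> i < \<pi> j" and b: "i' < j'" "\<pi> i' < \<pi> j'" and c: "\<And>x. i \<le> x \<Longrightarrow> x < j \<Longrightarrow> \<pi> x < \<pi> j"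
      using h A unfolding hooks_above_def by auto
    have "j \<le> i' \<or> j' < j" using lam A ii unfolding laminar_hooks_def by blast
    then consider "j = i'" | "j < i'" | "j' < j" by linarith
    then show ?thesis
    proof cases
      case 2
      have "\<not> ((x, y) \<in> hook_points \<pi> (i, j) \<and> (x, y) \<in> hook_points \<pi> (i', j'))" for x y
        unfolding hook_points_iff[of _ _ \<pi>, OF a] hook_points_iff[of _ _ \<pi>, OF b] using 2 a(1) b(1) by auto
      then show ?thesis by auto
    next
      case 3
      have "\<pi> j' < \<pi> j" using c[of j'] ii b(1) 3 by auto
      then have "\<not> ((x, y) \<in> hook_points \<pi> (i, j) \<and> (x, y) \<in> hook_points \<pi> (i', j'))" for x y
        unfolding hook_points_iff[of _ _ \<pi>, OF a] hook_points_iff[of _ _ \<pi>, OF b] using 3 a b ii by auto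
      then show ?thesis by auto
    qed simp
  qed
  show ?L
  proof (intro ballI impI)
    fix h h' assume hh: "h \<in> A" "h' \<in> A" "h \<noteq> h'"
    obtain i j i' j' where e: "h = (i, j)" "h' = (i', j')" by (cases h; cases h') auto
    have "i \<noteq> i'" using inj hh e by auto
    then consider "i < i'" | "i' < i" by linarith
    then show "hook_points \<pi> h \<inter> hook_points \<pi> h' = {} \<or> snd h = fst h' \<or> snd h' = fst h"
    proof cases
      case 1
      then show ?thesis using *[of i j i' j'] hh e by auto
    next
      case 2
      then show ?thesis using *[of i' j' i j] hh e by (auto simp: Int_commute)
    qed
  qed
qed

lemma finite_descents [simp]: "finite (descents m \<pi>)"
  by (rule finite_subset[of _ "{..m}"]) (auto simp: descents_def)

lemma VHC_iff:
  "H \<in> VHC m \<pi> \<longleftrightarrow>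
     map fst H = sorted_list_of_set (descents m \<pi>) \<and> (\<forall>(i, j)\<in>set H. 1 \<le> i \<and> j \<le> m) \<and>
     hooks_above \<pi> (set H) \<and> laminar_hooks (set H)"
proof (cases "map fst H = sorted_list_of_set (descents m \<pi>)")
  case True
  have "distinct (map fst H)" unfolding True by simp
  then have inj: "j = j'" if "(i, j) \<in> set H" "(i, j') \<in> set H" for i j j'
    using that by (auto simp: distinct_map dest: inj_onD[of fst "set H" "(i, j)" "(i, j')"])
  have pt: "(i, j) \<in> hooks m \<pi> \<and> (\<forall>x. i < x \<and> x < j \<longrightarrow> \<pi> x < \<pi> j)
      \<longleftrightarrow> (1 \<le> i \<and> j \<le> m) \<and> i < j \<and> (\<forall>x. i \<le> x \<and> x < j \<longrightarrow> \<pi> x < \<pi> j)" for i j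
    by (auto simp: hooks_def le_less)
  have "set H \<subseteq> hooks m \<pi> \<and> (\<forall>(d, j)\<in>set H. \<forall>x. d < x \<and> x < j \<longrightarrow> \<pi> x < \<pi> j)
      \<longleftrightarrow> (\<forall>(i, j)\<in>set H. (i, j) \<in> hooks m \<pi> \<and> (\<forall>x. i < x \<and> x < j \<longrightarrow> \<pi> x < \<pi> j))"
    by auto
  also have "\<dots> \<longleftrightarrow> (\<forall>(i, j)\<in>set H. (1 \<le> i \<and> j \<le> m) \<and> i < j \<and> (\<forall>x. i \<le> x \<and> x < j \<longrightarrow> \<pi> x < \<pi> j))"
    by (simp only: pt)
  also have "\<dots> \<longleftrightarrow> (\<forall>(i, j)\<in>set H. 1 \<le> i \<and> j \<le> m) \<and> hooks_above \<pi> (set H)"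
    unfolding hooks_above_def by auto
  finally have eq: "set H \<subseteq> hooks m \<pi> \<and> (\<forall>(d, j)\<in>set H. \<forall>x. d < x \<and> x < j \<longrightarrow> \<pi> x < \<pi> j)
      \<longleftrightarrow> (\<forall>(i, j)\<in>set H. 1 \<le> i \<and> j \<le> m) \<and> hooks_above \<pi> (set H)" .
  have "H \<in> VHC m \<pi> \<longleftrightarrow> (set H \<subseteq> hooks m \<pi> \<and> (\<forall>(d, j)\<in>set H. \<forall>x. d < x \<and> x < j \<longrightarrow> \<pi> x < \<pi> j)) \<and>
     (\<forall>h\<in>set H. \<forall>h'\<in>set H. h \<noteq> h' \<longrightarrow>
        hook_points \<pi> h \<inter> hook_points \<pi> h' = {} \<or> snd h = fst h' \<or> snd h' = fst h)"
    unfolding VHC_def mem_Collect_eq using True by (simp only: simp_thms conj_assoc)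
  also have "\<dots> \<longleftrightarrow> ((\<forall>(i, j)\<in>set H. 1 \<le> i \<and> j \<le> m) \<and> hooks_above \<pi> (set H)) \<and> laminar_hooks (set H)"
    unfolding eq by (rule conj_cong[OF refl]) (erule conjE, rule disjoint_hooks_iff, assumption, rule inj)
  finally show ?thesis using True by (simp only: simp_thms conj_assoc)
qed (simp add: VHC_def)

definition tree_perm :: "nat tree \<Rightarrow> nat \<Rightarrow> nat" where
  "tree_perm t i = (if 1 \<le> i \<and> i \<le> size t then inorder t ! (i - 1) else i)"

lemma size_hook_trees:
  assumes "t \<in> hook_trees s S"
  shows "size t = card S"
  using assms distinct_card[of "inorder t"] by (simp add: hook_trees_def)

lemma reads_tree_perm: "reads (tree_perm t) 0 t"
  unfolding reads_def by (rule nth_equalityI) (auto simp: tree_perm_def simp del: upt_Suc)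

lemma tree_perm_permutes:
  assumes "t \<in> hook_trees 0 {1..m}"
  shows "tree_perm t permutes {1..m}"
proof (rule bij_imp_permutes)
  have sz: "size t = m" using size_hook_trees[OF assms] by simp
  have d: "distinct (inorder t)" "set (inorder t) = {1..m}" using assms by (auto simp: hook_trees_def)
  show "bij_betw (tree_perm t) {1..m} {1..m}"
    unfolding bij_betw_def
  proof
    show "inj_on (tree_perm t) {1..m}"
      by (rule inj_onI) (use sz d(1) in \<open>auto simp: tree_perm_def nth_eq_iff_index_eq\<close>)
    show "tree_perm t ` {1..m} = {1..m}"
      using reads_set[OF reads_tree_perm[of t]] sz d(2) by (simp add: atLeastSucAtMost_greaterThanAtMost)
  qed
qed (use size_hook_trees[OF assms] in \<open>auto simp: tree_perm_def\<close>)

lemma hook_arcs_in_VHC: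
  assumes t: "t \<in> hook_trees 0 {1..m}" and rd: "reads \<pi> 0 t" and \<pi>0: "\<pi> 0 = 0"
  shows "hook_arcs 0 t \<in> VHC m \<pi>"
proof -
  have ht: "hook_tree 0 t" "set_tree t = {1..m}" "distinct (inorder t)" using t by (auto simp: hook_trees_def)
  have sz: "size t = m" using size_hook_trees[OF t] by simp
  have A: "0 < i" "j \<le> m" "i < j" if "(i, j) \<in> set (hook_arcs 0 t)" for i j
    using hook_arcs_0_start[OF ht(1) that] hook_arcs_bounds[OF that] sz by auto
  have "fst ` set (hook_arcs 0 t) = descents m \<pi>"
    using fst_hook_arcs[OF ht(1) rd ht(3)] ht(2) sz \<pi>0 by (auto simp: descents_def Suc_le_eq intro: gr0I)
  then have "set (map fst (hook_arcs 0 t)) = set (sorted_list_of_set (descents m \<pi>))" by simp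
  then have "map fst (hook_arcs 0 t) = sorted_list_of_set (descents m \<pi>)"
    using sorted_hook_arcs[OF ht(1), of 0]
    by (intro sorted_distinct_set_unique) (auto simp: strict_sorted_iff)
  moreover have "hooks_above \<pi> (set (hook_arcs 0 t))"
    unfolding hooks_above_def
  proof clarify
    fix i j assume ij: "(i, j) \<in> set (hook_arcs 0 t)"
    from hook_arcs_above_points[OF ht(1) rd ij] A[OF ij]
    show "i < j \<and> (\<forall>x. i \<le> x \<and> x < j \<longrightarrow> \<pi> x < \<pi> j)" by (auto simp: le_less)
  qed
  moreover have "laminar_hooks (set (hook_arcs 0 t))"
    unfolding laminar_hooks_def using hook_arcs_laminar[OF ht(1)] by blast
  ultimately show ?thesis unfolding VHC_iff using A(1,2) by (auto simp: Suc_le_eq)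
qed

lemma list_eq_if_same_keys:
  assumes "map fst xs = map fst ys" "distinct (map fst xs)" "set xs = set ys"
  shows "xs = ys"
proof (rule nth_equalityI)
  show len: "length xs = length ys" using assms(1) map_eq_imp_length_eq by blast
  fix i assume i: "i < length xs"
  then have "xs ! i \<in> set ys" using assms(3) nth_mem by blast
  then obtain k where k: "k < length ys" "ys ! k = xs ! i" by (auto simp: in_set_conv_nth)
  have "map fst xs ! k = map fst xs ! i" using k i assms(1) len by (metis nth_map)
  then have "k = i" using nth_eq_iff_index_eq[OF assms(2), of k i] k(1) i len by simp
  then show "xs ! i = ys ! i" using k by simp
qed

text \<open>The recursion is started with the convention that \<open>\<pi> 0 = 0\<close>, which permutations of \<open>{1..m}\<close>
  satisfy.\<close>

lemma VHC_tree_exists: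
  assumes \<pi>: "\<pi> permutes {1..m}" and H: "H \<in> VHC m \<pi>"
  obtains t where "t \<in> hook_trees 0 {1..m}" "reads \<pi> 0 t" "hook_arcs 0 t = H"
proof -
  have \<pi>0: "\<pi> 0 = 0" using permutes_not_in[OF \<pi>, of 0] by simp
  have f: "map fst H = sorted_list_of_set (descents m \<pi>)" and b: "\<And>i j. (i, j) \<in> set H \<Longrightarrow> 1 \<le> i \<and> j \<le> m"
    and ab: "hooks_above \<pi> (set H)" and lam: "laminar_hooks (set H)"
    using H unfolding VHC_iff by auto
  have dist: "distinct (map fst H)" unfolding f by simp
  have img: "\<pi> ` {0<..m} = {1..m}"
    using permutes_image[OF \<pi>] by (simp add: atLeastSucAtMost_greaterThanAtMost[symmetric])
  have injp: "inj_on \<pi> {0<..m}" using permutes_inj[OF \<pi>] by (rule inj_on_subset) simp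
  have "\<exists>t. hook_tree 0 t \<and> size t = m - 0 \<and> reads \<pi> 0 t \<and> set (hook_arcs 0 t) = set H"
  proof (rule hook_tree_exists)
    show "0 \<le> i \<and> i < j \<and> j \<le> m" if "(i, j) \<in> set H" for i j
      using b[OF that] ab that unfolding hooks_above_def by auto
    show "(if i = 0 then 0 else \<pi> i) < \<pi> j \<and> (\<forall>x. i < x \<and> x < j \<longrightarrow> \<pi> x < \<pi> j)" if "(i, j) \<in> set H" for i j
      using b[OF that] ab that unfolding hooks_above_def by auto
    show "j = j'" if "(i, j) \<in> set H" "(i, j') \<in> set H" for i j j'
      using that dist by (auto simp: distinct_map dest: inj_onD[of fst "set H" "(i, j)" "(i, j')"])
    show "j \<le> i' \<or> j' < j" if "(i, j) \<in> set H" "(i', j') \<in> set H" "i < i'" for i j i' j'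
      using lam that unfolding laminar_hooks_def by blast
    have "fst ` set H = descents m \<pi>" using arg_cong[OF f, of set] by simp
    then show "fst ` set H = {i. 0 \<le> i \<and> i < m \<and> \<pi> (Suc i) < (if i = 0 then 0 else \<pi> i)}"
      by (auto simp: descents_def Suc_le_eq split: if_splits)
    show "inj_on \<pi> {0<..m}" by (rule injp)
    show "0 \<notin> \<pi> ` {0<..m}" unfolding img by simp
    then show "0 \<notin> \<pi> ` {0<..m}" .
  qed simp
  then obtain t where t: "hook_tree 0 t" "size t = m" "reads \<pi> 0 t" "set (hook_arcs 0 t) = set H" by auto
  have st: "set_tree t = {1..m}"
    using reads_set[OF t(3)] img t(2) by (simp add: atLeastSucAtMost_greaterThanAtMost)
  have "distinct (inorder t)"
  proof -
    have "distinct (map \<pi> [Suc 0..<Suc m])"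
      using permutes_inj_on[OF \<pi>] by (simp add: distinct_map del: upt_Suc)
    then show ?thesis using t(2,3) unfolding reads_def by simp
  qed
  with t st have mem: "t \<in> hook_trees 0 {1..m}" by (simp add: hook_trees_def)
  have "map fst (hook_arcs 0 t) = map fst H"
    using hook_arcs_in_VHC[OF mem t(3) \<pi>0] f unfolding VHC_iff by simp
  then have "hook_arcs 0 t = H"
    using list_eq_if_same_keys[of "hook_arcs 0 t" H] dist t(4) by simp
  with mem t(3) show ?thesis by (rule that)
qed

lemma bij_betw_hook_trees_VHC:
  "bij_betw (\<lambda>t. (tree_perm t, hook_arcs 0 t)) (hook_trees 0 {1..m}) (VHC_all m)"
  unfolding bij_betw_def
proof
  show "inj_on (\<lambda>t. (tree_perm t, hook_arcs 0 t)) (hook_trees 0 {1..m})"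
  proof (rule inj_onI)
    fix t t' assume t: "t \<in> hook_trees 0 {1..m}" "t' \<in> hook_trees 0 {1..m}"
      and eq: "(tree_perm t, hook_arcs 0 t) = (tree_perm t', hook_arcs 0 t')"
    show "t = t'"
    proof (rule hook_tree_unique)
      show "hook_tree 0 t" "hook_tree 0 t'" using t by (auto simp: hook_trees_def)
      show "reads (tree_perm t) 0 t" by (rule reads_tree_perm)
      show "reads (tree_perm t) 0 t'" using eq reads_tree_perm[of t'] by simp
    qed (use eq size_hook_trees t in auto)
  qed
  show "(\<lambda>t. (tree_perm t, hook_arcs 0 t)) ` hook_trees 0 {1..m} = VHC_all m"
  proof (intro equalityI subsetI)
    fix z assume "z \<in> (\<lambda>t. (tree_perm t, hook_arcs 0 t)) ` hook_trees 0 {1..m}"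
    then obtain t where t: "t \<in> hook_trees 0 {1..m}" "z = (tree_perm t, hook_arcs 0 t)" by auto
    have "tree_perm t 0 = 0" by (simp add: tree_perm_def)
    then show "z \<in> VHC_all m"
      using hook_arcs_in_VHC[OF t(1) reads_tree_perm] tree_perm_permutes[OF t(1)] t(2) by (simp add: VHC_all_def)
  next
    fix z assume z: "z \<in> VHC_all m"
    obtain \<pi> H where zz: "z = (\<pi>, H)" by (cases z)
    with z have pH: "\<pi> permutes {1..m}" "H \<in> VHC m \<pi>" by (auto simp: VHC_all_def)
    then obtain t where t: "t \<in> hook_trees 0 {1..m}" "reads \<pi> 0 t" "hook_arcs 0 t = H"
      by (rule VHC_tree_exists)
    have "tree_perm t i = \<pi> i" for i
    proof (cases "1 \<le> i \<and> i \<le> m")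
      case True
      have sz: "size t = m" using size_hook_trees[OF t(1)] by simp
      have "inorder t ! (i - 1) = map \<pi> [Suc 0..<Suc m] ! (i - 1)" using t(2) sz by (simp add: reads_def)
      also have "\<dots> = \<pi> i" using True by (subst nth_map) (auto simp del: upt_Suc)
      finally show ?thesis using True sz by (simp add: tree_perm_def)
    next
      case False
      then show ?thesis
        using permutes_not_in[OF pH(1), of i] size_hook_trees[OF t(1)] by (auto simp: tree_perm_def)
    qed
    then have "tree_perm t = \<pi>" by blast
    then show "z \<in> (\<lambda>t. (tree_perm t, hook_arcs 0 t)) ` hook_trees 0 {1..m}"
      using t zz by (intro image_eqI[of _ _ t]) auto
  qed
qed

section \<open>Colors and block sizes\<close>

text \<open>The colors of the points in the order of their abscissas, where \<open>c\<close> is the color seen from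
  the visible points that are not northeast endpoints.\<close>

fun tree_colors :: "hook option \<Rightarrow> nat \<Rightarrow> 'b tree \<Rightarrow> hook option list" where
  "tree_colors c q Leaf = []"
| "tree_colors c q (Node l v r) =
     (if l = Leaf then [c]
      else tree_colors (Some (q, Suc (q + size l))) q l @ [Some (q, Suc (q + size l))])
     @ tree_colors c (Suc (q + size l)) r"

lemma length_tree_colors [simp]: "length (tree_colors c q t) = size t"
  by (induction t arbitrary: c q) auto

lemma set_tree_colors: "set (tree_colors c q t) \<subseteq> insert c (Some ` set (hook_arcs q t))"
proof (induction t arbitrary: c q)
  case (Node l v r)
  show ?case
    using Node.IH(1)[of "Some (q, Suc (q + size l))" q] Node.IH(2)[of c "Suc (q + size l)"]
    by (cases "l = Leaf") auto
qed simp

lemma Some_arcs_in_tree_colors: "Some ` set (hook_arcs q t) \<subseteq> set (tree_colors c q t)"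
proof (induction t arbitrary: c q)
  case (Node l v r)
  show ?case
    using Node.IH(1)[of q "Some (q, Suc (q + size l))"] Node.IH(2)[of "Suc (q + size l)" c]
    by (cases "l = Leaf") auto
qed simp

lemma count_tree_colors_eq_0: "c \<noteq> x \<Longrightarrow> x \<notin> Some ` set (hook_arcs q t) \<Longrightarrow> count_list (tree_colors c q t) x = 0"
  using set_tree_colors[of c q t] by (auto simp: count_list_0_iff)

lemma hook_arcs_Node_separate:
  shows "(i, j) \<in> set (hook_arcs q l) \<Longrightarrow> i < Suc (q + size l) \<and> j < Suc (q + size l)"
    and "(i, j) \<in> set (hook_arcs (Suc (q + size l)) r) \<Longrightarrow> Suc (q + size l) \<le> i \<and> Suc (q + size l) < j"
  using hook_arcs_bounds[of i j q l] hook_arcs_bounds[of i j "Suc (q + size l)" r] by auto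

lemma count_tree_colors_ambient: 
  "c \<notin> Some ` set (hook_arcs q t) \<Longrightarrow> count_list (tree_colors c q t) c = blue_count t"
proof (induction t arbitrary: c q)
  case (Node l v r)
  let ?p = "Suc (q + size l)"
  have r: "count_list (tree_colors c ?p r) c = blue_count r"
    using Node.prems by (intro Node.IH(2)) auto
  show ?case
  proof (cases "l = Leaf")
    case False
    then have c: "c \<noteq> Some (q, ?p)" "c \<notin> Some ` set (hook_arcs q l)" using Node.prems by auto
    then have "count_list (tree_colors (Some (q, ?p)) q l) c = 0"
      by (intro count_tree_colors_eq_0) auto
    with r c False show ?thesis by simp
  qed (use r in simp)
qed simp

text \<open>The color of a hook occurs only at its northeast endpoint and at the blue points of the
  configuration directly below it, so the counts of the two subtrees do not interfere.\<close>

lemma prod_count_tree_colors: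
  assumes "c \<notin> Some ` set (hook_arcs q t)"
  shows "(\<Prod>h\<in>set (hook_arcs q t). w (count_list (tree_colors c q t) (Some h))) = hook_weight w t"
  using assms
proof (induction t arbitrary: c q)
  case (Node l v r)
  let ?p = "Suc (q + size l)"
  let ?A = "set (hook_arcs q l)" and ?B = "set (hook_arcs ?p r)"
  have sepA: "i < ?p \<and> j < ?p" if "(i, j) \<in> ?A" for i j using hook_arcs_Node_separate(1)[OF that] .
  have sepB: "?p \<le> i \<and> ?p < j" if "(i, j) \<in> ?B" for i j using hook_arcs_Node_separate(2)[OF that] .
  have AB: "?A \<inter> ?B = {}" using sepA sepB by fastforce
  have cB: "c \<notin> Some ` ?B" and cA: "c \<notin> Some ` ?A" using Node.prems by auto
  have R: "(\<Prod>h\<in>?B. w (count_list (tree_colors c ?p r) (Some h))) = hook_weight w r"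
    by (rule Node.IH(2)[OF cB])
  show ?case
  proof (cases "l = Leaf")
    case True
    have "count_list (tree_colors c q (Node l v r)) (Some h) = count_list (tree_colors c ?p r) (Some h)" if "h \<in> ?B" for h
      using that cB True by auto
    then show ?thesis using True R by simp
  next
    case False
    let ?h0 = "(q, ?p)"
    have h0A: "?h0 \<notin> ?A" using sepA[of q ?p] by blast
    have h0B: "?h0 \<notin> ?B" using sepB[of q ?p] by auto
    have c0: "c \<noteq> Some ?h0" using Node.prems False by auto
    let ?n = "\<lambda>x. count_list (tree_colors c q (Node l v r)) x"
    have n: "?n x = count_list (tree_colors (Some ?h0) q l) x + (if x = Some ?h0 then 1 else 0) + count_list (tree_colors c ?p r) x" for x
      using False by simp
    have "?n (Some ?h0) = Suc (blue_count l)"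
    proof -
      have "Some ?h0 \<notin> Some ` ?A" "Some ?h0 \<notin> Some ` ?B" using h0A h0B by blast+
      from count_tree_colors_ambient[OF this(1)] count_tree_colors_eq_0[OF c0 this(2)]
      show ?thesis unfolding n by simp
    qed
    moreover have "?n (Some h) = count_list (tree_colors (Some ?h0) q l) (Some h)" if h: "h \<in> ?A" for h
    proof -
      have "Some h \<notin> Some ` ?B" "c \<noteq> Some h" "h \<noteq> ?h0" using h AB cA h0A by blast+
      then show ?thesis unfolding n by (simp add: count_tree_colors_eq_0)
    qed
    moreover have "?n (Some h) = count_list (tree_colors c ?p r) (Some h)" if h: "h \<in> ?B" for h
    proof -
      have "Some h \<notin> Some ` ?A" "h \<noteq> ?h0" using h AB h0B by blast+
      then show ?thesis unfolding n by (simp add: count_tree_colors_eq_0)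
    qed
    moreover have "(\<Prod>h\<in>?A. w (count_list (tree_colors (Some ?h0) q l) (Some h))) = hook_weight w l"
      using h0A by (intro Node.IH(1)) auto
    moreover have "set (hook_arcs q (Node l v r)) = insert ?h0 (?A \<union> ?B)" using False by auto
    ultimately have "(\<Prod>h\<in>set (hook_arcs q (Node l v r)). w (?n (Some h))) = w (Suc (blue_count l)) * (hook_weight w l * hook_weight w r)"
      using h0A h0B AB R by (simp only:) (subst prod.insert; simp add: prod.union_disjoint)
    then show ?thesis using False by (simp add: mult_ac)
  qed
qed simp

text \<open>The color \<open>x\<close> of the point with abscissa \<open>i\<close>, expressed as a relation, with \<open>c\<close> in place of
  blue. Unlike the definition by a choice of a minimum, it can be transferred between a tree and
  its subtrees.\<close>

definition covering_color :: "(nat \<Rightarrow> nat) \<Rightarrow> hook set \<Rightarrow> hook option \<Rightarrow> nat \<Rightarrow> hook option \<Rightarrow> bool" where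
  "covering_color \<pi> A c i x \<longleftrightarrow>
     (\<exists>h\<in>A. snd h = i \<and> x = Some h) \<or>
     (\<forall>h\<in>A. snd h \<noteq> i) \<and>
       ((\<exists>h\<in>A. fst h < i \<and> i < snd h \<and> x = Some h \<and>
           (\<forall>h'\<in>A. fst h' < i \<and> i < snd h' \<longrightarrow> \<pi> (snd h) \<le> \<pi> (snd h'))) \<or>
        (\<forall>h\<in>A. \<not> (fst h < i \<and> i < snd h)) \<and> x = c)"

text \<open>The color of a point depends only on the hooks that end at or pass over it.\<close>

lemma covering_color_local:
  assumes "{h\<in>A. fst h < i \<and> i \<le> snd h} = {h\<in>B. fst h < i \<and> i \<le> snd h}"
    and "\<And>h. h \<in> A \<union> B \<Longrightarrow> fst h < snd h"
  shows "covering_color \<pi> A c i x \<longleftrightarrow> covering_color \<pi> B c i x"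
proof -
  have 1: "h \<in> A \<and> snd h = i \<longleftrightarrow> h \<in> B \<and> snd h = i" for h
    using arg_cong[OF assms(1), of "\<lambda>X. h \<in> X"] assms(2)[of h] by auto
  have 2: "h \<in> A \<and> fst h < i \<and> i < snd h \<longleftrightarrow> h \<in> B \<and> fst h < i \<and> i < snd h" for h
    using arg_cong[OF assms(1), of "\<lambda>X. h \<in> X"] by auto
  have "covering_color \<pi> A c i x \<longleftrightarrow>
     (\<exists>h. (h \<in> A \<and> snd h = i) \<and> x = Some h) \<or>
     (\<forall>h. \<not> (h \<in> A \<and> snd h = i)) \<and>
       ((\<exists>h. (h \<in> A \<and> fst h < i \<and> i < snd h) \<and> x = Some h \<and>
           (\<forall>h'. h' \<in> A \<and> fst h' < i \<and> i < snd h' \<longrightarrow> \<pi> (snd h) \<le> \<pi> (snd h'))) \<or>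
        (\<forall>h. \<not> (h \<in> A \<and> fst h < i \<and> i < snd h)) \<and> x = c)" for A :: "hook set"
    unfolding covering_color_def by blast
  note * = this
  show ?thesis unfolding *[of A] *[of B] 1 2 ..
qed

text \<open>A hook that passes over a point of the left subtree and belongs to this subtree is lower
  than the hook ending at the root, because its northeast endpoint is a point of the subtree.\<close>

lemma tree_colors_covering:
  assumes "hook_tree s t" "reads \<pi> q t" "q < i" "i \<le> q + size t"
  shows "covering_color \<pi> (set (hook_arcs q t)) c i (tree_colors c q t ! (i - Suc q))"
  using assms
proof (induction t arbitrary: s c q)
  case (Node l v r)
  let ?p = "Suc (q + size l)"
  let ?t = "Node l v r"
  let ?A = "set (hook_arcs q l)" and ?B = "set (hook_arcs ?p r)"
  have sepA: "i < ?p \<and> j < ?p \<and> i < j" if "(i, j) \<in> ?A" for i j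
    using hook_arcs_Node_separate(1)[OF that] hook_arcs_bounds[OF that] by simp
  have sepB: "?p \<le> i \<and> ?p < j \<and> i < j" if "(i, j) \<in> ?B" for i j
    using hook_arcs_Node_separate(2)[OF that] hook_arcs_bounds[OF that] by simp
  have set: "set (hook_arcs q ?t) = (if l = Leaf then {} else {(q, ?p)}) \<union> ?A \<union> ?B" by auto
  have lt: "fst h < snd h" if "h \<in> set (hook_arcs q ?t)" for h
    using hook_arcs_bounds[of "fst h" "snd h" q ?t] that by simp
  from Node.prems(3,4) consider "i < ?p" | "i = ?p" | "?p < i" by linarith
  then show ?case
  proof cases
    case 1
    then have ne: "l \<noteq> Leaf" using Node.prems(3) by auto
    let ?x = "tree_colors (Some (q, ?p)) q l ! (i - Suc q)"
    have x: "tree_colors c q ?t ! (i - Suc q) = ?x"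
    proof -
      have "i - Suc q < size l" using 1 Node.prems(3) by linarith
      then show ?thesis using ne by (simp add: nth_append)
    qed
    have IH: "covering_color \<pi> ?A (Some (q, ?p)) i ?x"
      using Node.prems 1 by (intro Node.IH(1)[of 0]) auto
    have v: "\<pi> ?p = v" using Node.prems by simp
    have below: "\<pi> (snd h) \<le> \<pi> ?p" if "h \<in> ?A" for h
    proof -
      have "\<pi> (snd h) \<in> set_tree l"
        using hook_arcs_bounds[of "fst h" "snd h" q l] that Node.prems by (intro reads_mem[of _ q]) auto
      then show ?thesis using Node.prems v by auto
    qed
    have "covering_color \<pi> (insert (q, ?p) ?A) c i ?x"
    proof (cases "\<exists>h\<in>?A. snd h = i")
      case True
      then have "\<exists>h\<in>?A. snd h = i \<and> ?x = Some h" using IH unfolding covering_color_def by blast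
      then show ?thesis unfolding covering_color_def by blast
    next
      case noNE: False
      then have NE: "\<forall>h\<in>insert (q, ?p) ?A. snd h \<noteq> i" using 1 by auto
      show ?thesis
      proof (cases "\<exists>h\<in>?A. fst h < i \<and> i < snd h")
        case True
        then obtain h where h: "h \<in> ?A" "fst h < i" "i < snd h" "?x = Some h"
          "\<forall>h'\<in>?A. fst h' < i \<and> i < snd h' \<longrightarrow> \<pi> (snd h) \<le> \<pi> (snd h')"
          using IH noNE unfolding covering_color_def by blast
        have "\<forall>h'\<in>insert (q, ?p) ?A. fst h' < i \<and> i < snd h' \<longrightarrow> \<pi> (snd h) \<le> \<pi> (snd h')"
          using h(5) below[OF h(1)] by simp
        then show ?thesis unfolding covering_color_def using h(1-4) NE by blast
      next
        case False
        then have "?x = Some (q, ?p)" using IH noNE unfolding covering_color_def by blast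
        moreover have "\<forall>h'\<in>insert (q, ?p) ?A. fst h' < i \<and> i < snd h' \<longrightarrow> \<pi> (snd (q, ?p)) \<le> \<pi> (snd h')"
          using False by auto
        moreover have "fst (q, ?p) < i" "i < snd (q, ?p)" using 1 Node.prems(3) by auto
        ultimately show ?thesis unfolding covering_color_def using NE by blast
      qed
    qed
    moreover have "covering_color \<pi> (insert (q, ?p) ?A) c i ?x \<longleftrightarrow> covering_color \<pi> (set (hook_arcs q ?t)) c i ?x"
    proof (rule covering_color_local)
      show "{h \<in> insert (q, ?p) ?A. fst h < i \<and> i \<le> snd h} = {h \<in> set (hook_arcs q ?t). fst h < i \<and> i \<le> snd h}"
        unfolding set using ne sepB 1 by fastforce
      show "fst h < snd h" if "h \<in> insert (q, ?p) ?A \<union> set (hook_arcs q ?t)" for h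
        using that lt[of h] ne unfolding set by auto
    qed
    ultimately show ?thesis unfolding x by simp
  next
    case 2
    show ?thesis
    proof (cases "l = Leaf")
      case True
      have "tree_colors c q ?t ! (i - Suc q) = c" using True 2 by simp
      moreover have "\<forall>h\<in>?B. snd h \<noteq> i" "\<forall>h\<in>?B. \<not> (fst h < i \<and> i < snd h)"
        using 2 sepB by fastforce+
      ultimately show ?thesis using True unfolding covering_color_def set by simp
    next
      case False
      have "tree_colors c q ?t ! (i - Suc q) = Some (q, ?p)" using False 2 by (simp add: nth_append)
      moreover have "(q, ?p) \<in> set (hook_arcs q ?t)" using False by simp
      ultimately show ?thesis unfolding covering_color_def using 2 by (intro disjI1 bexI[of _ "(q, ?p)"]) auto
    qed
  next
    case 3
    have idx: "i - Suc q = Suc (size l) + (i - Suc ?p)" using 3 by simp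
    let ?pre = "if l = Leaf then [c] else tree_colors (Some (q, ?p)) q l @ [Some (q, ?p)]"
    have "length ?pre = Suc (size l)" by simp
    then have x: "tree_colors c q ?t ! (i - Suc q) = tree_colors c ?p r ! (i - Suc ?p)"
      unfolding idx using nth_append_length_plus[of ?pre "tree_colors c ?p r" "i - Suc ?p"] by simp
    have "covering_color \<pi> ?B c i (tree_colors c ?p r ! (i - Suc ?p))"
      using Node.prems 3 by (intro Node.IH(2)[of v]) auto
    moreover have "covering_color \<pi> ?B c i x \<longleftrightarrow> covering_color \<pi> (set (hook_arcs q ?t)) c i x" for x
    proof (rule covering_color_local)
      show "{h \<in> ?B. fst h < i \<and> i \<le> snd h} = {h \<in> set (hook_arcs q ?t). fst h < i \<and> i \<le> snd h}"
      proof -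
        have "\<not> i \<le> snd h" if "h \<in> (if l = Leaf then {} else {(q, ?p)}) \<union> ?A" for h
          using that sepA[of "fst h" "snd h"] 3 by (auto split: if_splits)
        then show ?thesis unfolding set by blast
      qed
      show "fst h < snd h" if "h \<in> ?B \<union> set (hook_arcs q ?t)" for h
        using that lt[of h] unfolding set by auto
    qed
    ultimately show ?thesis unfolding x by simp
  qed
qed simp

lemma point_color_unique:
  assumes x: "covering_color \<pi> (set H) None i x" and d: "distinct (map snd H)" and inj: "inj \<pi>"
  shows "point_color \<pi> H i = x"
proof (cases "\<exists>h\<in>set H. snd h = i")
  case True
  then obtain h where h: "h \<in> set H" "snd h = i" "x = Some h"
    using x unfolding covering_color_def by blast
  have "(THE h. h \<in> set H \<and> snd h = i) = h"
    using h d by (intro the_equality) (auto simp: distinct_map dest: inj_onD)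
  with True h show ?thesis by (simp add: point_color_def)
next
  case noNE: False
  let ?P = "\<lambda>h. h \<in> set H \<and> fst h < i \<and> i < snd h"
  show ?thesis
  proof (cases "\<exists>h\<in>set H. fst h < i \<and> i < snd h")
    case True
    then obtain h where h: "?P h" "x = Some h" "\<And>h'. ?P h' \<Longrightarrow> \<pi> (snd h) \<le> \<pi> (snd h')"
      using x noNE unfolding covering_color_def by blast
    let ?a = "arg_min (\<lambda>h. \<pi> (snd h)) ?P"
    have "?P ?a" "\<pi> (snd ?a) \<le> \<pi> (snd h)"
      using arg_min_nat_lemma[of ?P h "\<lambda>h. \<pi> (snd h)"] h(1) by blast+
    then have "\<pi> (snd ?a) = \<pi> (snd h)" using h(3)[of ?a] by (meson order_antisym)
    then have "snd ?a = snd h" using inj by (simp add: inj_eq)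
    then have "?a = h" using d \<open>?P ?a\<close> h(1) by (auto simp: distinct_map dest: inj_onD)
    with True noNE h show ?thesis by (simp add: point_color_def)
  next
    case False
    then have "x = None" using x noNE unfolding covering_color_def by blast
    with noNE False show ?thesis by (simp add: point_color_def)
  qed
qed

lemma map_point_color:
  assumes "hook_tree s t" "reads \<pi> 0 t" "inj \<pi>"
  shows "map (point_color \<pi> (hook_arcs 0 t)) [Suc 0..<Suc (size t)] = tree_colors None 0 t"
proof (rule nth_equalityI)
  fix k assume "k < length (map (point_color \<pi> (hook_arcs 0 t)) [Suc 0..<Suc (size t)])"
  then have k: "k < size t" by (simp del: upt_Suc)
  have "point_color \<pi> (hook_arcs 0 t) (Suc k) = tree_colors None 0 t ! k"
    using tree_colors_covering[OF assms(1,2), of "Suc k" None] k distinct_snd_hook_arcs[OF assms(1)] assms(3)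
    by (intro point_color_unique) auto
  then show "map (point_color \<pi> (hook_arcs 0 t)) [Suc 0..<Suc (size t)] ! k = tree_colors None 0 t ! k"
    using k by (simp del: upt_Suc)
qed (simp del: upt_Suc)

text \<open>The classes of the kernel of a map are its fibers, indexed by the image.\<close>

lemma prod_over_fibers:
  fixes f :: "'b \<Rightarrow> 'c"
  assumes "finite A"
  shows "(\<Prod>B\<in>A // {(a, a'). a \<in> A \<and> a' \<in> A \<and> f a = f a'}. g (card B))
     = (\<Prod>x\<in>f ` A. g (card {a\<in>A. f a = x}))"
proof -
  have "{(a, a'). a \<in> A \<and> a' \<in> A \<and> f a = f a'} `` {a} = {b\<in>A. f b = f a}" if "a \<in> A" for a
    using that by auto
  then have "A // {(a, a'). a \<in> A \<and> a' \<in> A \<and> f a = f a'} = (\<lambda>x. {a\<in>A. f a = x}) ` f ` A"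
    unfolding quotient_def image_image UNION_singleton_eq_range by (intro image_cong refl)
  moreover have "inj_on (\<lambda>x. {a\<in>A. f a = x}) (f ` A)"
    by (rule inj_onI) blast
  ultimately show ?thesis by (simp add: prod.reindex)
qed

lemma count_list_map:
  assumes "distinct xs"
  shows "count_list (map f xs) x = card {i\<in>set xs. f i = x}"
  using assms
proof (induction xs)
  case (Cons a xs)
  have "{i \<in> set (a # xs). f i = x} = (if f a = x then insert a {i \<in> set xs. f i = x} else {i \<in> set xs. f i = x})"
    by auto
  with Cons show ?case by auto
qed simp

text \<open>The blocks are the color classes. Every color occurs, blue on the sky and the color of a
  hook on its northeast endpoint, so that the product ranges over blue and all hooks.\<close>

lemma partition_weight_hook_arcs:
  assumes t: "t \<in> hook_trees 0 {1..n - 1}" and n: "n \<ge> 1" and rd: "reads \<pi> 0 t" and \<pi>: "\<pi> permutes {1..n - 1}"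
  shows "partition_weight w (VHC_partition n \<pi> (hook_arcs 0 t)) = total_weight w t"
proof -
  let ?H = "hook_arcs 0 t"
  let ?hc = "height_color n \<pi> ?H" and ?pc = "point_color \<pi> ?H"
  have ht: "hook_tree 0 t" using t by (simp add: hook_trees_def)
  have sz: "size t = n - 1" using size_hook_trees[OF t] by simp
  have inj: "inj \<pi>" by (rule permutes_inj[OF \<pi>])
  have colors: "map ?pc [Suc 0..<Suc (n - 1)] = tree_colors None 0 t"
    using map_point_color[OF ht rd inj] sz by simp
  have count: "card {i\<in>{1..n - 1}. ?pc i = x} = count_list (tree_colors None 0 t) x" for x
  proof -
    have "set [Suc 0..<Suc (n - 1)] = {1..n - 1}" by auto
    then show ?thesis
      using count_list_map[of "[Suc 0..<Suc (n - 1)]" ?pc x] colors by (simp del: upt_Suc)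
  qed
  have heights: "card {a\<in>{1..n - 1}. ?hc a = x} = card {i\<in>{1..n - 1}. ?pc i = x}" for x
  proof (rule bij_betw_same_card[of "inv \<pi>"])
    have inv: "inv \<pi> permutes {1..n - 1}" by (rule permutes_inv[OF \<pi>])
    have "inv \<pi> ` {a\<in>{1..n - 1}. ?hc a = x} = {i\<in>{1..n - 1}. ?pc i = x}"
    proof (intro equalityI subsetI)
      fix i assume "i \<in> inv \<pi> ` {a\<in>{1..n - 1}. ?hc a = x}"
      then obtain a where a: "i = inv \<pi> a" "a \<in> {1..n - 1}" "?hc a = x" by auto
      moreover have "a \<noteq> n" using a n by auto
      ultimately show "i \<in> {i\<in>{1..n - 1}. ?pc i = x}"
        using permutes_in_image[OF inv, of a] by (simp add: height_color_def)
    next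
      fix i assume i: "i \<in> {i\<in>{1..n - 1}. ?pc i = x}"
      then have m: "\<pi> i \<in> {1..n - 1}" using permutes_in_image[OF \<pi>, of i] by simp
      then have "\<pi> i \<noteq> n" using n by auto
      moreover have e: "inv \<pi> (\<pi> i) = i" by (rule inv_f_f[OF inj])
      ultimately have "?hc (\<pi> i) = x" using i by (simp add: height_color_def)
      then show "i \<in> inv \<pi> ` {a\<in>{1..n - 1}. ?hc a = x}"
        using m e by (intro image_eqI[of _ _ "\<pi> i"]) auto
    qed
    then show "bij_betw (inv \<pi>) {a\<in>{1..n - 1}. ?hc a = x} {i\<in>{1..n - 1}. ?pc i = x}"
      unfolding bij_betw_def using permutes_inj_on[OF inv] by simp
  qed
  have total: "card {a\<in>{1..n}. ?hc a = x} = count_list (tree_colors None 0 t) x + (if x = None then 1 else 0)" for x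
  proof -
    have n1: "{1..n} = insert n {1..n - 1}" using n by auto
    have hcn: "?hc n = None" by (simp add: height_color_def)
    have notin: "n \<notin> {a\<in>{1..n - 1}. ?hc a = x}" using n by auto
    have "card {a\<in>{1..n}. ?hc a = x} = card {a\<in>{1..n - 1}. ?hc a = x} + (if x = None then 1 else 0)"
    proof (cases "x = None")
      case True
      have "{a\<in>{1..n}. ?hc a = x} = insert n {a\<in>{1..n - 1}. ?hc a = x}"
        unfolding n1 using hcn True by blast
      moreover have "card (insert n {a\<in>{1..n - 1}. ?hc a = x}) = Suc (card {a\<in>{1..n - 1}. ?hc a = x})"
        by (rule card_insert_disjoint[OF _ notin]) simp
      ultimately show ?thesis unfolding True by simp
    next
      case False
      then have "{a\<in>{1..n}. ?hc a = x} = {a\<in>{1..n - 1}. ?hc a = x}"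
        unfolding n1 using hcn by blast
      then show ?thesis using False by (simp only: if_False add_0_right)
    qed
    then show ?thesis unfolding heights count .
  qed
  have range: "?hc ` {1..n} = insert None (Some ` set ?H)"
  proof (intro equalityI subsetI)
    fix x assume "x \<in> ?hc ` {1..n}"
    then have "{a\<in>{1..n}. ?hc a = x} \<noteq> {}" by auto
    then have "card {a\<in>{1..n}. ?hc a = x} \<noteq> 0" by simp
    then have "x = None \<or> x \<in> set (tree_colors None 0 t)"
      unfolding total by (auto split: if_splits simp: count_list_0_iff)
    then show "x \<in> insert None (Some ` set ?H)" using set_tree_colors[of None 0 t] by auto
  next
    fix x assume "x \<in> insert None (Some ` set ?H)"
    then have "x = None \<or> x \<in> set (tree_colors None 0 t)" using Some_arcs_in_tree_colors[of 0 t None] by auto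
    then have "card {a\<in>{1..n}. ?hc a = x} \<noteq> 0" unfolding total by (auto simp: count_list_0_iff)
    then have "{a\<in>{1..n}. ?hc a = x} \<noteq> {}" by (metis card.empty)
    then show "x \<in> ?hc ` {1..n}" by auto
  qed
  have "partition_weight w (VHC_partition n \<pi> ?H) = (\<Prod>x\<in>?hc ` {1..n}. w (card {a\<in>{1..n}. ?hc a = x}))"
    unfolding partition_weight_def VHC_partition_def by (rule prod_over_fibers) simp
  also have "\<dots> = w (Suc (count_list (tree_colors None 0 t) None)) * (\<Prod>h\<in>set ?H. w (count_list (tree_colors None 0 t) (Some h)))"
    unfolding range total by (subst prod.insert) (auto simp: prod.reindex)
  also have "\<dots> = total_weight w t"
    using count_tree_colors_ambient[of None 0 t] prod_count_tree_colors[of None 0 t w]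
    by (auto simp: total_weight_def mult.commute)
  finally show ?thesis .
qed

lemma VHC_sum_eq_tree_sum:
  assumes "n \<ge> 1"
  shows "(\<Sum>(\<pi>, H)\<in>VHC_all (n - 1). partition_weight w (VHC_partition n \<pi> H)) = tree_sum w {1..n - 1}"
proof -
  have "(\<Sum>(\<pi>, H)\<in>VHC_all (n - 1). partition_weight w (VHC_partition n \<pi> H))
      = (\<Sum>t\<in>hook_trees 0 {1..n - 1}. partition_weight w (VHC_partition n (tree_perm t) (hook_arcs 0 t)))"
    by (subst sum.reindex_bij_betw[OF bij_betw_hook_trees_VHC, symmetric]) simp
  also have "\<dots> = tree_sum w {1..n - 1}"
    unfolding tree_sum_def
    by (intro sum.cong refl partition_weight_hook_arcs assms reads_tree_perm tree_perm_permutes)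
  finally show ?thesis .
qed

theorem corollary5p5:
  fixes \<kappa> c :: "nat \<Rightarrow> 'a::field"
  assumes "cumulants_correspond \<kappa> c"
  shows "\<forall>n\<ge>1. - c n =
    (\<Sum>(\<pi>, H)\<in>VHC_all (n - 1). partition_weight (\<lambda>k. - \<kappa> k) (VHC_partition n \<pi> H))"
proof (intro allI impI)
  fix n :: nat assume n: "n \<ge> 1"
  have "nc_moment \<kappa> k = partition_sum (\<lambda>B. c (card B)) {1..k}" for k
  proof (cases "k = 0")
    case True
    then show ?thesis by (simp add: nc_moment_def partition_weight_def)
  next
    case False
    then have "(\<Sum>\<rho>\<in>set_partitions k. partition_weight c \<rho>) = (\<Sum>\<eta>\<in>noncrossing_partitions k. partition_weight \<kappa> \<eta>)"
      using assms unfolding cumulants_correspond_def by (metis One_nat_def Suc_leI neq0_conv)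
    moreover have "noncrossing_partitions k = nc_parts {1..k}"
      by (auto simp: noncrossing_partitions_def nc_parts_def set_partitions_def)
    ultimately show ?thesis
      by (simp add: nc_moment_def partition_sum_def set_partitions_def partition_weight_def)
  qed
  from tree_sum_eq_cumulant[OF this, of "{1..n - 1}"] n
  show "- c n = (\<Sum>(\<pi>, H)\<in>VHC_all (n - 1). partition_weight (\<lambda>k. - \<kappa> k) (VHC_partition n \<pi> H))"
    unfolding VHC_sum_eq_tree_sum[OF n] by simp
qed

end
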